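(* Let $\alpha\in(0,2]$. Let $X$ be an $n\times n$ Wigner matrix satisfying the concentration property $\mathcal{C}_\alpha$ with some $\kappa>0$. There exists a constant $c_\alpha>0$, depending on $\alpha$, such that for any $t>0$, $$\mathbb{P}\left(d\big(\mu_{X/\sqrt n},\mathbb{E}\mu_{X/\sqrt n}\big)>t+\delta_n\right)\le\frac{32}{t^2}\exp\big(-c_\alpha k_\alpha(t)\big),$$ where $\delta_n=O\big(\kappa n^{-1}(\log n)^{(1/\alpha-1)_+}\big)$, and where for $\alpha\in[1,2]$, $$k_\alpha(t)=\min\Big(\frac{n^2t^2}{\kappa^2},\frac{n^{1+\frac\alpha2}t^\alpha}{\kappa^\alpha}\Big),$$ whereas for $\alpha\in(0,1)$, $$k_\alpha(t)=\min\Big(\frac{n^2t^2}{\kappa^2(\log n)^{2(\frac1\alpha-1)}},\frac{n^{1+\frac\alpha2}t}{\kappa}\Big).$$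
   Context: $\mathcal{H}_n^{(\beta)}$ is the set of $n\times n$ Hermitian matrices if $\beta=2$ and real symmetric matrices if $\beta=1$. A Wigner matrix is a random matrix in $\mathcal{H}_n^{(\beta)}$ with independent coefficients up to the symmetry, such that $(X_{i,i})_i$ are identically distributed and $(X_{i,j})_{i<j}$ are identically distributed. $\mu_A$ is the empirical spectral measure $\frac1n\sum_i\delta_{\lambda_i}$ of $A$ ($\lambda_i$ its eigenvalues); $\mathbb{E}\mu_{X/\sqrt n}$ is the expected (mean) measure. $x_+=\max(x,0)$. For $p>0$ and $Y\in\mathcal{H}_n^{(\beta)}$, $\|Y\|_{\ell^p}^p=\sum_{i,j}|Y_{i,j}|^p$ and $B_{\ell^p}=\{Y\in\mathcal{H}_n^{(\beta)}:\|Y\|_{\ell^p}\le1\}$. Concentration property $\mathcal{C}_\alpha$ with constant $\kappa>0$: for any Borel subset $A$ of $\mathcal{H}_n^{(\beta)}$ with $\mathbb{P}(X\in A)\ge1/2$ and any $t>0$, if $\alpha\in[1,2]$: $\mathbb{P}(X\notin A+\kappa\sqrt t\,B_{\ell^2}+\kappa t^{1/\alpha}B_{\ell^\alpha})\le2e^{-t}$; if $\alpha\in(0,1)$: $\mathbb{P}\big(X\notin A+\kappa(\log n)^{\frac1\alpha-1}(\sqrt t\,B_{\ell^2}+t\,B_{\ell^1})+\kappa t^{1/\alpha}B_{\ell^\alpha}\big)\le4e^{-t}$. The distance $d$ on probability measures on $\mathbb{R}$ is $d(\mu,\nu)=\sup_{z\in\mathcal{K}}|g_\mu(z)-g_\nu(z)|$,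 where $g_\mu(z)=\int\frac{d\mu(t)}{z-t}$ is the Stieltjes transform and $\mathcal{K}$ is a fixed compact subset of $\{z\in\mathbb{C}:\mathrm{Im}\,z\ge2\}$ with an accumulation point and with $\mathrm{diam}(\mathcal{K})\le1$.
   Formalization: For α<1 the claim with a constant depending on α alone fails as κ→0; there the constants c_α and in δ_n may depend on a lower bound κ₀≤κ, and for n=1 (log n=0) k_α is read as 0. Constants are stated for a given sample space; passing to the law of X removes this. *)

theory Defs
  imports "HOL-Probability.Probability" "Jordan_Normal_Form.Char_Poly"
    "HOL-Library.Set_Algebras"
begin

text \<open>The real symmetric matrices (\<open>\<beta> = 1\<close>) are viewed as complex Hermitian matrices with real
  entries, so that both cases share the type \<^typ>\<open>complex mat\<close>.\<close>

definition herm_mats :: "nat \<Rightarrow> nat \<Rightarrow> complex mat set" where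
  "herm_mats \<beta> n = {A \<in> carrier_mat n n.
     (\<forall>i<n. \<forall>j<n. A $$ (i, j) = cnj (A $$ (j, i))) \<and>
     (\<beta> = 1 \<longrightarrow> (\<forall>i<n. \<forall>j<n. A $$ (i, j) \<in> \<real>))}"

text \<open>The Borel sigma-algebra of \<^const>\<open>herm_mats\<close> (for its topology as a subspace of
  the space of families of \<open>n * n\<close> complex numbers): it is pulled back along the map that sends
  a matrix to its family of entries.\<close>

definition herm_borel :: "nat \<Rightarrow> nat \<Rightarrow> complex mat measure" where
  "herm_borel \<beta> n = vimage_algebra (herm_mats \<beta> n)
     (\<lambda>A. \<lambda>p\<in>{..<n} \<times> {..<n}. A $$ p)
     (PiM ({..<n} \<times> {..<n}) (\<lambda>_. borel))"

definition wigner :: "nat \<Rightarrow> nat \<Rightarrow> 'w measure \<Rightarrow> ('w \<Rightarrow> complex mat) \<Rightarrow> bool" where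
  "wigner \<beta> n M X \<longleftrightarrow>
     prob_space M \<and>
     X \<in> measurable M (herm_borel \<beta> n) \<and>
     prob_space.indep_vars M (\<lambda>_. borel) (\<lambda>p \<omega>. X \<omega> $$ p) {(i, j). i \<le> j \<and> j < n} \<and>
     (\<forall>i<n. \<forall>j<n. distr M borel (\<lambda>\<omega>. X \<omega> $$ (i, i)) = distr M borel (\<lambda>\<omega>. X \<omega> $$ (j, j))) \<and>
     (\<forall>i j k l. i < j \<and> j < n \<and> k < l \<and> l < n \<longrightarrow>
        distr M borel (\<lambda>\<omega>. X \<omega> $$ (i, j)) = distr M borel (\<lambda>\<omega>. X \<omega> $$ (k, l)))"

definition lp_norm :: "real \<Rightarrow> complex mat \<Rightarrow> real" where
  "lp_norm p Y = (\<Sum>i<dim_row Y. \<Sum>j<dim_col Y. cmod (Y $$ (i, j)) powr p) powr (1 / p)"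

definition lp_ball :: "nat \<Rightarrow> nat \<Rightarrow> real \<Rightarrow> complex mat set" where
  "lp_ball \<beta> n p = {Y \<in> herm_mats \<beta> n. lp_norm p Y \<le> 1}"

definition scale_mats :: "real \<Rightarrow> complex mat set \<Rightarrow> complex mat set" where
  "scale_mats c S = (\<lambda>Y. complex_of_real c \<cdot>\<^sub>m Y) ` S"

text \<open>Sums of sets of matrices are Minkowski sums. The Minkowski sum of a Borel set and compact
  sets is analytic, but need not be Borel. Analytic sets are universally measurable, so the event
  that \<open>X\<close> lies outside such a sum belongs to the completion of \<open>M\<close>, and its probability is
  taken there.\<close>

definition concentration_property ::
  "real \<Rightarrow> real \<Rightarrow> nat \<Rightarrow> nat \<Rightarrow> 'w measure \<Rightarrow> ('w \<Rightarrow> complex mat) \<Rightarrow> bool" where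
  "concentration_property \<alpha> \<kappa> \<beta> n M X \<longleftrightarrow>
     (\<forall>A \<in> sets (herm_borel \<beta> n). \<forall>t>0. measure M {\<omega> \<in> space M. X \<omega> \<in> A} \<ge> 1 / 2 \<longrightarrow>
       (if 1 \<le> \<alpha> then
          measure (completion M) {\<omega> \<in> space M. X \<omega> \<notin>
            A + scale_mats (\<kappa> * sqrt t) (lp_ball \<beta> n 2)
              + scale_mats (\<kappa> * t powr (1 / \<alpha>)) (lp_ball \<beta> n \<alpha>)} \<le> 2 * exp (- t)
        else
          measure (completion M) {\<omega> \<in> space M. X \<omega> \<notin>
            A + scale_mats (\<kappa> * ln (real n) powr (1 / \<alpha> - 1))
                  (scale_mats (sqrt t) (lp_ball \<beta> n 2) + scale_mats t (lp_ball \<beta> n 1))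
              + scale_mats (\<kappa> * t powr (1 / \<alpha>)) (lp_ball \<beta> n \<alpha>)} \<le> 4 * exp (- t)))"

text \<open>Eigenvalues are counted with algebraic multiplicity, as the multiset of roots of the
  characteristic polynomial; those of a Hermitian matrix are real, so \<^const>\<open>Re\<close> only changes
  their type.\<close>

definition spectral_measure :: "complex mat \<Rightarrow> real measure" where
  "spectral_measure A =
     distr (measure_pmf (pmf_of_multiset (proots (char_poly A)))) borel Re"

definition normalized_spectral_measure :: "nat \<Rightarrow> complex mat \<Rightarrow> real measure" where
  "normalized_spectral_measure n A = spectral_measure (complex_of_real (1 / sqrt (real n)) \<cdot>\<^sub>m A)"

text \<open>The Giry bind is the mean measure: it gives a Borel set \<open>B\<close> the expectation under \<open>M\<close>
  of the mass of \<open>B\<close> under the random measure.\<close>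

definition mean_spectral_measure ::
  "nat \<Rightarrow> 'w measure \<Rightarrow> ('w \<Rightarrow> complex mat) \<Rightarrow> real measure" where
  "mean_spectral_measure n M X = M \<bind> (\<lambda>\<omega>. normalized_spectral_measure n (X \<omega>))"

definition stieltjes :: "real measure \<Rightarrow> complex \<Rightarrow> complex" where
  "stieltjes \<mu> z = (\<integral>x. 1 / (z - complex_of_real x) \<partial>\<mu>)"

definition stieltjes_dist :: "complex set \<Rightarrow> real measure \<Rightarrow> real measure \<Rightarrow> real" where
  "stieltjes_dist K \<mu> \<nu> = (SUP z\<in>K. cmod (stieltjes \<mu> z - stieltjes \<nu> z))"

text \<open>\<open>(log n)\<^sup>s\<close> with the convention \<open>0\<^sup>0 = 1\<close>, whereas \<^term>\<open>0 powr 0\<close> is \<open>0\<close>; the two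
  differ only for \<open>n = 1\<close> and \<open>s = 0\<close>.\<close>

definition log_pow :: "nat \<Rightarrow> real \<Rightarrow> real" where
  "log_pow n s = (if s = 0 then 1 else ln (real n) powr s)"

text \<open>For \<open>\<alpha> < 1\<close> and \<open>n = 1\<close> the first quotient has denominator \<open>0\<close>, hence the value \<open>0\<close>.\<close>

definition rate :: "real \<Rightarrow> real \<Rightarrow> nat \<Rightarrow> real \<Rightarrow> real" where
  "rate \<alpha> \<kappa> n t =
     (if 1 \<le> \<alpha> then
        min (real n ^ 2 * t ^ 2 / \<kappa> ^ 2)
            (real n powr (1 + \<alpha> / 2) * t powr \<alpha> / \<kappa> powr \<alpha>)
      else
        min (real n ^ 2 * t ^ 2 / (\<kappa> ^ 2 * ln (real n) powr (2 * (1 / \<alpha> - 1))))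
            (real n powr (1 + \<alpha> / 2) * t / \<kappa>))"

end

theory Submission
  imports Defs "Jordan_Normal_Form.Schur_Decomposition" "HOL-Real_Asymp.Real_Asymp"
begin

text \<open>For Hermitian \<open>A\<close> and \<open>Im z \<ge> 2\<close>, the Stieltjes transform of the spectral measure of
  \<open>A / sqrt n\<close> at \<open>z\<close> is the normalized trace of the resolvent of \<open>A / sqrt n\<close>. The theorem holds
  because this function of \<open>A\<close> is stable under exactly the shifts that the concentration property
  allows, and because \<open>K\<close> can be replaced by a small net.

  Stability: the resolvents have norm at most \<open>1 / 2\<close>, and the resolvent identity writes the change
  of the trace under \<open>A \<mapsto> A + D\<close> as the trace of \<open>D\<close> times a product \<open>Q\<close> of two resolvents. For \<open>p\<close>
  between \<open>1\<close> and \<open>2\<close> the columns of \<open>Q\<close> have bounded \<open>\<ell>\<^sup>2\<close> norm, which bounds the change by a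
  multiple of the \<open>\<ell>\<^sup>p\<close> norm of \<open>D\<close> with the right power of \<open>n\<close> (\<open>trace_res_diff_le_lp\<close>). For
  \<open>\<alpha> < 1\<close> a second idea is needed: changing one entry pair by \<open>x\<close> is a perturbation of rank at most
  \<open>2\<close>, so it moves the trace at most linearly in \<open>\<bar>x\<bar>\<close> but also at most by a constant, hence by at
  most a multiple of \<open>\<bar>x\<bar>\<close> to the power \<open>\<alpha>\<close>. Exchanging the entries successively gives a bound by
  the sum of these powers (\<open>trace_res_diff_le_quasinorm\<close>).

  Concentration: applied to the sets on which the real or imaginary part of the transform lies below
  (or above) a level near its median, the property gives exponential tails about the median.
  Integrating these tails shows that median and mean differ by \<open>O(\<kappa> / n)\<close> times the power of the
  logarithm, which is the origin of \<open>\<delta>\<close>. The sets to be enlarged are open, so the enlarged sets are open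
  and their complements define events. The outcome is \<open>stieltjes_concentration\<close>. Its centre, the mean of
  the transforms, is the transform of the mean measure; this rests on the measurability of the
  spectral measure as a function of the matrix
  (\<open>measurable_normalized_spectral_measure\<close>).

  Uniformity: Stieltjes transforms are Lipschitz in \<open>z\<close>, so for \<open>t \<le> 1\<close> it suffices to control them
  on a net of mesh \<open>t\<close> in \<open>K\<close>, which has at most \<open>49 / t\<^sup>2\<close> points. For \<open>t > 1\<close> the event is
  empty.\<close>

text \<open>The symbol \<open>$\<close> is reserved for the entries of vectors of variable dimension.\<close>

unbundle no vec_syntax

section \<open>Vectors and resolvents of Hermitian matrices\<close>

definition vec_norm :: "complex vec \<Rightarrow> real" where
  "vec_norm v = L2_set (\<lambda>i. cmod (v $ i)) {..<dim_vec v}"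

lemma vec_norm_nonneg [simp]: "0 \<le> vec_norm v"
  by (simp add: vec_norm_def)

lemma vec_norm_carrier: "v \<in> carrier_vec n \<Longrightarrow> vec_norm v = L2_set (\<lambda>i. cmod (v $ i)) {..<n}"
  by (auto simp: vec_norm_def)

lemma vec_norm_power2: "v \<in> carrier_vec n \<Longrightarrow> (vec_norm v)\<^sup>2 = (\<Sum>i<n. (cmod (v $ i))\<^sup>2)"
  by (simp add: vec_norm_carrier L2_set_def sum_nonneg)

lemma vec_norm_diff_le:
  assumes "v \<in> carrier_vec n" "w \<in> carrier_vec n"
  shows "vec_norm (v - w) \<le> vec_norm v + vec_norm w"
proof -
  have "vec_norm (v - w) = L2_set (\<lambda>i. cmod (v $ i - w $ i)) {..<n}"
    using assms by (subst vec_norm_carrier[of _ n]) (auto intro!: L2_set_cong)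
  also have "\<dots> \<le> L2_set (\<lambda>i. cmod (v $ i) + cmod (w $ i)) {..<n}"
    by (intro L2_set_mono norm_triangle_ineq4) auto
  also have "\<dots> \<le> vec_norm v + vec_norm w"
    using assms by (simp add: vec_norm_carrier[of _ n] L2_set_triangle_ineq)
  finally show ?thesis .
qed

lemma vec_norm_smult: "vec_norm (c \<cdot>\<^sub>v v) = cmod c * vec_norm v"
  by (auto simp: vec_norm_def norm_mult L2_set_right_distrib intro!: L2_set_cong)

lemma vec_norm_eq_0_iff:
  assumes "v \<in> carrier_vec n"
  shows "vec_norm v = 0 \<longleftrightarrow> v = 0\<^sub>v n"
  using assms by (auto simp: vec_norm_carrier L2_set_eq_0_iff intro!: eq_vecI)

lemma Cauchy_Schwarz_vec:
  assumes "v \<in> carrier_vec n" "w \<in> carrier_vec n"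
  shows "cmod (\<Sum>i<n. cnj (v $ i) * w $ i) \<le> vec_norm v * vec_norm w"
proof -
  have "cmod (\<Sum>i<n. cnj (v $ i) * w $ i) \<le> (\<Sum>i<n. \<bar>cmod (v $ i)\<bar> * \<bar>cmod (w $ i)\<bar>)"
    by (rule sum_norm_le) (simp add: norm_mult)
  also have "\<dots> \<le> vec_norm v * vec_norm w"
    unfolding vec_norm_carrier[OF assms(1)] vec_norm_carrier[OF assms(2)]
    by (rule L2_set_mult_ineq)
  finally show ?thesis .
qed

lemma mult_mat_vec_index_sum:
  assumes "A \<in> carrier_mat n n" "v \<in> carrier_vec n" "i < n"
  shows "(A *\<^sub>v v) $ i = (\<Sum>j<n. A $$ (i, j) * v $ j)"
  using assms by (auto simp: scalar_prod_def atLeast0LessThan intro!: sum.cong)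

lemma mult_mat_index_sum:
  assumes "A \<in> carrier_mat n n" "B \<in> carrier_mat n n" "i < n" "j < n"
  shows "(A * B) $$ (i, j) = (\<Sum>k<n. A $$ (i, k) * B $$ (k, j))"
  using assms by (auto simp: scalar_prod_def atLeast0LessThan intro!: sum.cong)

definition shifted :: "complex \<Rightarrow> complex mat \<Rightarrow> complex mat" where
  "shifted z A = z \<cdot>\<^sub>m 1\<^sub>m (dim_row A) - A"

definition resolvent :: "complex \<Rightarrow> complex mat \<Rightarrow> complex mat" where
  "resolvent z A = (SOME R. R \<in> carrier_mat (dim_row A) (dim_row A) \<and>
     R * shifted z A = 1\<^sub>m (dim_row A) \<and> shifted z A * R = 1\<^sub>m (dim_row A))"

lemma shifted_carrier [simp]: "A \<in> carrier_mat n n \<Longrightarrow> shifted z A \<in> carrier_mat n n"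
  by (auto simp: shifted_def)

lemma herm_mats_carrier: "A \<in> herm_mats \<beta> n \<Longrightarrow> A \<in> carrier_mat n n"
  by (simp add: herm_mats_def)

lemma herm_mats_cnj: "A \<in> herm_mats \<beta> n \<Longrightarrow> i < n \<Longrightarrow> j < n \<Longrightarrow> cnj (A $$ (i, j)) = A $$ (j, i)"
  unfolding herm_mats_def mem_Collect_eq by metis

lemma hermitian_form_real:
  assumes A: "A \<in> herm_mats \<beta> n" and v: "v \<in> carrier_vec n"
  shows "Im (\<Sum>i<n. cnj (v $ i) * (A *\<^sub>v v) $ i) = 0"
proof -
  let ?S = "\<Sum>i<n. \<Sum>j<n. cnj (v $ i) * (A $$ (i, j) * v $ j)"
  have "cnj ?S = (\<Sum>i<n. \<Sum>j<n. cnj (v $ j) * (A $$ (j, i) * v $ i))"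
    unfolding cnj_sum
    by (intro sum.cong refl) (simp add: herm_mats_cnj[OF A] mult.commute mult.left_commute)
  also have "\<dots> = ?S" by (rule sum.swap)
  finally have "Im ?S = 0" 
    by (simp only: Reals_cnj_iff[symmetric] complex_is_Real_iff)
  moreover have "(\<Sum>i<n. cnj (v $ i) * (A *\<^sub>v v) $ i) = ?S"
    by (intro sum.cong refl)
      (simp only: mult_mat_vec_index_sum[OF herm_mats_carrier[OF A] v] sum_distrib_left lessThan_iff)
  ultimately show ?thesis by (simp only:)
qed

lemma shifted_mult_vec_index:
  assumes "A \<in> carrier_mat n n" "v \<in> carrier_vec n" "i < n"
  shows "(shifted z A *\<^sub>v v) $ i = z * v $ i - (A *\<^sub>v v) $ i"
proof -
  have "(shifted z A *\<^sub>v v) $ i = (\<Sum>j<n. (if i = j then z * v $ j else 0) - A $$ (i, j) * v $ j)"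
    using assms by (subst mult_mat_vec_index_sum[of _ n])
      (auto simp: shifted_def algebra_simps intro!: sum.cong)
  thus ?thesis using assms
    by (simp add: sum_subtractf mult_mat_vec_index_sum[of _ n] del: index_mult_mat_vec)
qed

text \<open>The quadratic form of \<open>A\<close> is real, so the imaginary part of \<open>\<langle>v, (z - A) v\<rangle>\<close> is \<open>Im z\<close>
  times the squared norm of \<open>v\<close>; Cauchy-Schwarz turns this into a lower bound for \<open>(z - A) v\<close>.\<close>

lemma vec_norm_shifted_ge:
  assumes A: "A \<in> herm_mats \<beta> n" and v: "v \<in> carrier_vec n" and z: "0 < Im z"
  shows "Im z * vec_norm v \<le> vec_norm (shifted z A *\<^sub>v v)"
proof (cases "vec_norm v = 0")
  case False
  note Ac = herm_mats_carrier[OF A]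
  let ?q = "\<Sum>i<n. cnj (v $ i) * (shifted z A *\<^sub>v v) $ i"
  have "?q = (\<Sum>i<n. z * of_real ((cmod (v $ i))\<^sup>2) - cnj (v $ i) * (A *\<^sub>v v) $ i)"
  proof (rule sum.cong)
    fix i assume "i \<in> {..<n}"
    have "z * of_real ((cmod (v $ i))\<^sup>2) = cnj (v $ i) * (z * v $ i)"
      by (simp only: complex_norm_square mult_ac)
    with \<open>i \<in> {..<n}\<close> v Ac show "cnj (v $ i) * (shifted z A *\<^sub>v v) $ i
        = z * of_real ((cmod (v $ i))\<^sup>2) - cnj (v $ i) * (A *\<^sub>v v) $ i"
      by (simp only: shifted_mult_vec_index lessThan_iff right_diff_distrib)
  qed simp
  also have "\<dots> = z * of_real ((vec_norm v)\<^sup>2) - (\<Sum>i<n. cnj (v $ i) * (A *\<^sub>v v) $ i)"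
    by (simp add: vec_norm_power2[OF v] sum_subtractf sum_distrib_left del: index_mult_mat_vec)
  finally have "Im ?q = Im z * (vec_norm v)\<^sup>2"
    using hermitian_form_real[OF A v] by (simp del: index_mult_mat_vec)
  hence "Im z * (vec_norm v)\<^sup>2 \<le> cmod ?q"
    using abs_Im_le_cmod[of ?q] by linarith
  also have "\<dots> \<le> vec_norm v * vec_norm (shifted z A *\<^sub>v v)"
    by (rule Cauchy_Schwarz_vec[OF v mult_mat_vec_carrier[OF shifted_carrier[OF Ac] v]])
  finally have "vec_norm v * (Im z * vec_norm v) \<le> vec_norm v * vec_norm (shifted z A *\<^sub>v v)"
    by (simp add: power2_eq_square ac_simps)
  moreover have "0 < vec_norm v" using False vec_norm_nonneg[of v] by linarith
  ultimately show ?thesis by (rule mult_left_le_imp_le)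
qed simp

lemma resolvent_exists:
  assumes A: "A \<in> herm_mats \<beta> n" and z: "0 < Im z"
  shows "resolvent z A \<in> carrier_mat n n"
    and "resolvent z A * shifted z A = 1\<^sub>m n" and "shifted z A * resolvent z A = 1\<^sub>m n"
proof -
  note Ac = herm_mats_carrier[OF A]
  have "v = 0\<^sub>v n" if v: "v \<in> carrier_vec n" and "shifted z A *\<^sub>v v = 0\<^sub>v n" for v
  proof -
    have "Im z * vec_norm v \<le> 0"
      using vec_norm_shifted_ge[OF A v z] that vec_norm_eq_0_iff[of "0\<^sub>v n" n] by simp
    thus ?thesis
      using z v vec_norm_nonneg[of v] vec_norm_eq_0_iff[OF v]
      by (simp add: mult_le_0_iff)
  qed
  hence "det (shifted z A) \<noteq> 0"
    using det_0_iff_vec_prod_zero_field[of "shifted z A" n] Ac by auto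
  hence "shifted z A \<in> Units (ring_mat TYPE(complex) n ())"
    using Ac by (intro det_non_zero_imp_unit) auto
  hence "\<exists>R. R \<in> carrier_mat n n \<and> R * shifted z A = 1\<^sub>m n \<and> shifted z A * R = 1\<^sub>m n"
    by (auto simp: Units_def ring_mat_def)
  from someI_ex[OF this] show "resolvent z A \<in> carrier_mat n n"
    and "resolvent z A * shifted z A = 1\<^sub>m n" and "shifted z A * resolvent z A = 1\<^sub>m n"
    using Ac by (auto simp: resolvent_def)
qed

text \<open>This is the operator norm bound \<open>1 / Im z\<close>, on which all later estimates rest.\<close>

lemma vec_norm_resolvent_le:
  assumes A: "A \<in> herm_mats \<beta> n" and v: "v \<in> carrier_vec n" and z: "0 < Im z"
  shows "vec_norm (resolvent z A *\<^sub>v v) \<le> vec_norm v / Im z"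
proof -
  note R = resolvent_exists[OF A z]
  have "shifted z A *\<^sub>v (resolvent z A *\<^sub>v v) = v"
    using R v herm_mats_carrier[OF A]
    by (subst assoc_mult_mat_vec[symmetric, of _ n n _ n]) auto
  with vec_norm_shifted_ge[OF A _ z, of "resolvent z A *\<^sub>v v"] R v z show ?thesis
    by (simp add: field_simps)
qed

text \<open>The resolvent identity.\<close>

lemma resolvent_diff:
  assumes A: "A \<in> herm_mats \<beta> n" and B: "B \<in> herm_mats \<beta> n" and z: "0 < Im z"
  shows "resolvent z A - resolvent z B = resolvent z A * (A - B) * resolvent z B"
proof -
  note Ac = herm_mats_carrier[OF A] and Bc = herm_mats_carrier[OF B]
  note RA = resolvent_exists[OF A z] and RB = resolvent_exists[OF B z]
  have "A - B = shifted z B - shifted z A"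
    using Ac Bc by (auto simp: shifted_def intro!: eq_matI)
  hence "resolvent z A * (A - B) * resolvent z B
      = (resolvent z A * shifted z B - resolvent z A * shifted z A) * resolvent z B"
    using mult_minus_distrib_mat[OF RA(1) shifted_carrier[OF Bc] shifted_carrier[OF Ac]] by metis
  also have "\<dots> = (resolvent z A * shifted z B - 1\<^sub>m n) * resolvent z B"
    by (simp only: RA)
  also have "\<dots> = resolvent z A * shifted z B * resolvent z B - 1\<^sub>m n * resolvent z B"
    by (rule minus_mult_distrib_mat[OF mult_carrier_mat[OF RA(1) shifted_carrier[OF Bc]] one_carrier_mat RB(1)])
  also have "resolvent z A * shifted z B * resolvent z B = resolvent z A * (shifted z B * resolvent z B)"
    by (rule assoc_mult_mat[OF RA(1) shifted_carrier[OF Bc] RB(1)])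
  also have "\<dots> = resolvent z A"
    by (simp only: RB right_mult_one_mat[OF RA(1)])
  also have "1\<^sub>m n * resolvent z B = resolvent z B"
    by (rule left_mult_one_mat[OF RB(1)])
  finally show ?thesis by (rule sym)
qed

definition trace_res :: "complex \<Rightarrow> complex mat \<Rightarrow> complex" where
  "trace_res z A = (\<Sum>i<dim_row A. resolvent z A $$ (i, i))"

lemma trace_cycle:
  assumes "P \<in> carrier_mat n n" "D \<in> carrier_mat n n" "(Q :: complex mat) \<in> carrier_mat n n"
  shows "(\<Sum>i<n. (P * D * Q) $$ (i, i)) = (\<Sum>i<n. \<Sum>j<n. (Q * P) $$ (i, j) * D $$ (j, i))"
proof -
  have "(\<Sum>i<n. (P * D * Q) $$ (i, i))
      = (\<Sum>i<n. \<Sum>k<n. P $$ (i, k) * (\<Sum>j<n. D $$ (k, j) * Q $$ (j, i)))"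
    using assms by (simp add: mult_mat_index_sum[of _ n] del: index_mult_mat)
  also have "\<dots> = (\<Sum>i<n. \<Sum>k<n. \<Sum>j<n. Q $$ (j, i) * P $$ (i, k) * D $$ (k, j))"
    by (simp add: sum_distrib_left mult_ac)
  also have "\<dots> = (\<Sum>i<n. \<Sum>j<n. \<Sum>k<n. Q $$ (j, i) * P $$ (i, k) * D $$ (k, j))"
    by (rule sum.cong[OF refl sum.swap])
  also have "\<dots> = (\<Sum>j<n. \<Sum>i<n. \<Sum>k<n. Q $$ (j, i) * P $$ (i, k) * D $$ (k, j))"
    by (rule sum.swap)
  also have "\<dots> = (\<Sum>j<n. \<Sum>k<n. \<Sum>i<n. Q $$ (j, i) * P $$ (i, k) * D $$ (k, j))"
    by (rule sum.cong[OF refl sum.swap])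
  also have "\<dots> = (\<Sum>j<n. \<Sum>k<n. (\<Sum>i<n. Q $$ (j, i) * P $$ (i, k)) * D $$ (k, j))"
    by (simp only: sum_distrib_right)
  also have "\<dots> = (\<Sum>j<n. \<Sum>k<n. (Q * P) $$ (j, k) * D $$ (k, j))"
    by (intro sum.cong refl) (simp only: mult_mat_index_sum[OF assms(3,1)] lessThan_iff)
  finally show ?thesis .
qed

lemma trace_res_diff:
  assumes A: "A \<in> herm_mats \<beta> n" and B: "B \<in> herm_mats \<beta> n" and z: "0 < Im z"
  shows "trace_res z A - trace_res z B
    = (\<Sum>i<n. \<Sum>j<n. (resolvent z B * resolvent z A) $$ (i, j) * (A - B) $$ (j, i))"
proof -
  note Ac = herm_mats_carrier[OF A] and Bc = herm_mats_carrier[OF B]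
  note RA = resolvent_exists[OF A z] and RB = resolvent_exists[OF B z]
  have "trace_res z A - trace_res z B = (\<Sum>i<n. (resolvent z A - resolvent z B) $$ (i, i))"
    using Ac Bc RA RB by (simp add: trace_res_def sum_subtractf)
  also have "\<dots> = (\<Sum>i<n. (resolvent z A * (A - B) * resolvent z B) $$ (i, i))"
    by (simp only: resolvent_diff[OF A B z])
  also have "\<dots> = (\<Sum>i<n. \<Sum>j<n. (resolvent z B * resolvent z A) $$ (i, j) * (A - B) $$ (j, i))"
    using Ac Bc RA RB by (intro trace_cycle) auto
  finally show ?thesis .
qed

section \<open>Stability of the trace of the resolvent\<close>

text \<open>A substitute for Hoelder's inequality, up to the factor \<open>2\<close>: \<open>Q\<close> has entries at most \<open>1\<close>
  and at most \<open>n\<close> as the sum of squared entries, so its \<open>\<ell>\<^sup>q\<close> norm for the conjugate exponent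
  \<open>q \<ge> 2\<close> is at most \<open>n\<close> to the power \<open>1 - 1 / p\<close>. The proof splits pointwise, which treats all
  \<open>p\<close> in \<open>[1, 2]\<close> at once, including \<open>p = 1\<close>, where the conjugate exponent is infinite.\<close>

lemma sum_mult_le_of_column_bound:
  fixes Q D :: "nat \<Rightarrow> nat \<Rightarrow> real"
  assumes p: "1 \<le> p" "p \<le> 2" and n: "1 \<le> n" and \<Delta>: "0 < \<Delta>"
    and Q0: "\<And>i j. 0 \<le> Q i j" and D0: "\<And>i j. 0 \<le> D i j"
    and Q: "\<And>j. j < n \<Longrightarrow> (\<Sum>i<n. (Q i j)\<^sup>2) \<le> 1"
    and D: "(\<Sum>i<n. \<Sum>j<n. D j i powr p) \<le> \<Delta> powr p"
  shows "(\<Sum>i<n. \<Sum>j<n. Q i j * D j i) \<le> 2 * (real n powr (1 - 1 / p) * \<Delta>)"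
proof -
  \<comment> \<open>\<open>M\<close> is the entry size of a \<open>D\<close> that attains the bound up to the factor \<open>2\<close>:
    one with \<open>n\<close> equal nonzero entries, paired with a permutation matrix.\<close>
  define M where "M = \<Delta> * real n powr (- 1 / p)"
  have M: "0 < M" using \<Delta> n by (simp add: M_def)
  have pt: "Q i j * D j i \<le> M * (Q i j)\<^sup>2 + M powr (1 - p) * D j i powr p" if "j < n" "i < n" for i j
  proof -
    let ?q = "Q i j" and ?d = "D j i"
    have "?q\<^sup>2 \<le> (\<Sum>i<n. (Q i j)\<^sup>2)"
      by (rule member_le_sum) (use \<open>i < n\<close> in auto)
    hence q1: "?q \<le> 1" using Q[OF \<open>j < n\<close>] by (auto intro: power2_le_imp_le[of _ 1, simplified])
    show ?thesis
    proof (cases "?d \<le> ?q * M")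
      case True
      hence "?q * ?d \<le> ?q * (?q * M)" using Q0 by (intro mult_left_mono) auto
      also have "\<dots> \<le> M * ?q\<^sup>2 + M powr (1 - p) * ?d powr p"
        by (simp add: power2_eq_square mult_ac)
      finally show ?thesis .
    next
      case False
      hence d: "0 < ?d" using mult_nonneg_nonneg[OF Q0[of i j] less_imp_le[OF M]] by linarith
      have "?q \<le> ?q powr (p - 1)"
      proof (cases "?q = 0")
        case False
        thus ?thesis using powr_mono'[of "p - 1" 1 ?q] q1 p Q0[of i j] by simp
      qed simp
      also have "\<dots> \<le> (?d / M) powr (p - 1)"
        using False M Q0[of i j] p by (intro powr_mono2) (auto simp: field_simps)
      finally have "?q * ?d \<le> (?d / M) powr (p - 1) * ?d" using d by (intro mult_right_mono) auto
      also have "\<dots> = M powr (1 - p) * ?d powr p"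
        using d M by (simp add: powr_divide powr_diff field_simps)
      also have "\<dots> \<le> M * ?q\<^sup>2 + M powr (1 - p) * ?d powr p" using M by simp
      finally show ?thesis .
    qed
  qed
  have "(\<Sum>i<n. \<Sum>j<n. Q i j * D j i)
      \<le> (\<Sum>i<n. \<Sum>j<n. M * (Q i j)\<^sup>2 + M powr (1 - p) * D j i powr p)"
    using pt by (intro sum_mono) auto
  also have "\<dots> = M * (\<Sum>i<n. \<Sum>j<n. (Q i j)\<^sup>2)
      + M powr (1 - p) * (\<Sum>i<n. \<Sum>j<n. D j i powr p)"
    by (simp add: sum.distrib sum_distrib_left)
  also have "(\<Sum>i<n. \<Sum>j<n. (Q i j)\<^sup>2) = (\<Sum>j<n. \<Sum>i<n. (Q i j)\<^sup>2)"
    by (rule sum.swap)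
  also have "M * (\<Sum>j<n. \<Sum>i<n. (Q i j)\<^sup>2) + M powr (1 - p) * (\<Sum>i<n. \<Sum>j<n. D j i powr p)
      \<le> M * (\<Sum>j<n. 1) + M powr (1 - p) * \<Delta> powr p"
    using M D Q by (intro add_mono mult_left_mono sum_mono) auto
  also have "M * (\<Sum>j<n. 1) = real n powr (1 - 1 / p) * \<Delta>"
  proof -
    have "real n powr (- 1 / p) * real n powr 1 = real n powr (1 - 1 / p)"
      unfolding powr_add[symmetric] by simp
    thus ?thesis using n by (simp add: M_def mult.commute mult.left_commute)
  qed
  also have "M powr (1 - p) * \<Delta> powr p = real n powr (1 - 1 / p) * \<Delta>"
  proof -
    have "M powr (1 - p) = \<Delta> powr (1 - p) * real n powr (- 1 / p * (1 - p))"
      using \<Delta> n by (simp add: M_def powr_mult powr_powr)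
    also have "- 1 / p * (1 - p) = 1 - 1 / p" using p by (simp add: field_simps)
    finally have "M powr (1 - p) * \<Delta> powr p
        = real n powr (1 - 1 / p) * (\<Delta> powr (1 - p) * \<Delta> powr p)" by simp
    also have "\<Delta> powr (1 - p) * \<Delta> powr p = \<Delta>"
      using \<Delta> by (simp flip: powr_add)
    finally show ?thesis .
  qed
  finally show ?thesis by (simp only: mult_2)
qed

lemma vec_norm_resolvent_mult_le:
  assumes A: "A \<in> herm_mats \<beta> n" and B: "B \<in> herm_mats \<beta>' n"
    and v: "v \<in> carrier_vec n" and z: "0 < Im z"
  shows "vec_norm ((resolvent z B * resolvent z A) *\<^sub>v v) \<le> vec_norm v / (Im z)\<^sup>2"
proof -
  note RA = resolvent_exists[OF A z] and RB = resolvent_exists[OF B z]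
  have "vec_norm ((resolvent z B * resolvent z A) *\<^sub>v v)
      = vec_norm (resolvent z B *\<^sub>v (resolvent z A *\<^sub>v v))"
    by (simp only: assoc_mult_mat_vec[OF RB(1) RA(1) v])
  also have "\<dots> \<le> vec_norm (resolvent z A *\<^sub>v v) / Im z"
    by (rule vec_norm_resolvent_le[OF B mult_mat_vec_carrier[OF RA(1) v] z])
  also have "\<dots> \<le> (vec_norm v / Im z) / Im z"
    using z by (intro divide_right_mono vec_norm_resolvent_le[OF A v z]) simp
  finally show ?thesis by (simp add: power2_eq_square)
qed

text \<open>The columns of a matrix are its values on the unit vectors.\<close>

lemma resolvent_mult_column_bound:
  assumes A: "A \<in> herm_mats \<beta> n" and B: "B \<in> herm_mats \<beta> n" and z: "0 < Im z" and j: "j < n"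
  shows "(\<Sum>i<n. ((Im z)\<^sup>2 * cmod ((resolvent z B * resolvent z A) $$ (i, j)))\<^sup>2) \<le> 1"
proof -
  let ?Q = "resolvent z B * resolvent z A" and ?e = "unit_vec n j :: complex vec"
  note RA = resolvent_exists[OF A z] and RB = resolvent_exists[OF B z]
  have Qc: "?Q \<in> carrier_mat n n" using RA RB by simp
  have e: "(?Q *\<^sub>v ?e) $ i = ?Q $$ (i, j)" if "i < n" for i
  proof -
    have "(?Q *\<^sub>v ?e) $ i = (\<Sum>k<n. ?Q $$ (i, k) * ?e $ k)"
      by (rule mult_mat_vec_index_sum[OF Qc unit_vec_carrier that])
    also have "\<dots> = (\<Sum>k<n. if k = j then ?Q $$ (i, k) else 0)"
      by (intro sum.cong refl) (simp add: j)
    also have "\<dots> = ?Q $$ (i, j)" using j by simp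
    finally show ?thesis .
  qed
  have "vec_norm ?e = 1"
  proof -
    have "(\<Sum>i<n. (cmod (?e $ i))\<^sup>2) = (\<Sum>i<n. if i = j then 1 else 0)"
      using j by (intro sum.cong) auto
    thus ?thesis using j by (simp add: vec_norm_carrier[of _ n] L2_set_def)
  qed
  hence "vec_norm (?Q *\<^sub>v ?e) \<le> 1 / (Im z)\<^sup>2"
    using vec_norm_resolvent_mult_le[OF A B unit_vec_carrier z, of j] by simp
  hence "((Im z)\<^sup>2 * vec_norm (?Q *\<^sub>v ?e))\<^sup>2 \<le> 1"
    using z by (intro power_le_one) (auto simp: field_simps)
  also have "((Im z)\<^sup>2 * vec_norm (?Q *\<^sub>v ?e))\<^sup>2
      = ((Im z)\<^sup>2)\<^sup>2 * (\<Sum>i<n. (cmod ((?Q *\<^sub>v ?e) $ i))\<^sup>2)"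
    by (simp only: power_mult_distrib vec_norm_power2[OF mult_mat_vec_carrier[OF Qc unit_vec_carrier]])
  also have "\<dots> = (\<Sum>i<n. ((Im z)\<^sup>2 * cmod (?Q $$ (i, j)))\<^sup>2)"
    unfolding sum_distrib_left by (intro sum.cong refl) (simp only: e lessThan_iff power_mult_distrib)
  finally show ?thesis .
qed

text \<open>The trace of a resolvent varies by \<open>tr (R\<^sub>B R\<^sub>A (A - B))\<close>, where the product of the resolvents has
  operator norm at most \<open>1 / 4\<close>, so that its columns have \<open>\<ell>\<^sup>2\<close> norm at most \<open>1 / 4\<close>.\<close>

lemma trace_res_diff_le_lp:
  assumes A: "A \<in> herm_mats \<beta> n" and B: "B \<in> herm_mats \<beta> n" and z: "2 \<le> Im z"
    and p: "1 \<le> p" "p \<le> 2" and n: "1 \<le> n" and \<Delta>: "0 < \<Delta>"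
    and D: "(\<Sum>i<n. \<Sum>j<n. cmod ((A - B) $$ (i, j)) powr p) \<le> \<Delta> powr p"
  shows "cmod (trace_res z A - trace_res z B) \<le> real n powr (1 - 1 / p) * \<Delta> / 2"
proof -
  let ?Q = "resolvent z B * resolvent z A"
  have z0: "0 < Im z" using z by simp
  have z4: "4 \<le> (Im z)\<^sup>2" using power_mono[OF z, of 2] by simp
  let ?S = "\<Sum>i<n. \<Sum>j<n. cmod (?Q $$ (i, j)) * cmod ((A - B) $$ (j, i))"
  have "4 * cmod (trace_res z A - trace_res z B) \<le> (Im z)\<^sup>2 * cmod (trace_res z A - trace_res z B)"
    using z4 by (intro mult_right_mono) auto
  also have "\<dots> \<le> (Im z)\<^sup>2 * ?S"
    unfolding trace_res_diff[OF A B z0]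
    by (intro mult_left_mono order_trans[OF norm_sum] sum_mono) (simp_all add: norm_mult)
  also have "\<dots>
      = (\<Sum>i<n. \<Sum>j<n. ((Im z)\<^sup>2 * cmod (?Q $$ (i, j))) * cmod ((A - B) $$ (j, i)))"
    by (simp add: sum_distrib_left mult.assoc)
  also have "\<dots> \<le> 2 * (real n powr (1 - 1 / p) * \<Delta>)"
  proof (rule sum_mult_le_of_column_bound[OF p n \<Delta>])
    show "(\<Sum>i<n. ((Im z)\<^sup>2 * cmod (?Q $$ (i, j)))\<^sup>2) \<le> 1" if "j < n" for j
      by (rule resolvent_mult_column_bound[OF A B z0 that])
    have "(\<Sum>i<n. \<Sum>j<n. cmod ((A - B) $$ (j, i)) powr p)
        = (\<Sum>j<n. \<Sum>i<n. cmod ((A - B) $$ (j, i)) powr p)"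
      by (rule sum.swap)
    thus "(\<Sum>i<n. \<Sum>j<n. cmod ((A - B) $$ (j, i)) powr p) \<le> \<Delta> powr p"
      using D by linarith
  qed auto
  finally show ?thesis by linarith
qed

text \<open>Adding \<open>s v v\<^sup>*\<close> changes the trace at most linearly in \<open>s\<close>, but also never by more than a
  constant: the difference of the resolvents has rank one, hence the absolute value of its trace is
  at most its operator norm, which is at most \<open>2 / Im z\<close>.\<close>

lemma trace_res_rank_one:
  assumes A: "A \<in> herm_mats \<beta> n" and B: "B \<in> herm_mats \<beta> n" and z: "0 < Im z"
    and v: "v \<in> carrier_vec n"
    and AB: "\<And>i j. i < n \<Longrightarrow> j < n \<Longrightarrow> A $$ (i, j) - B $$ (i, j) = of_real s * v $ i * cnj (v $ j)"
  shows "cmod (trace_res z A - trace_res z B) \<le> \<bar>s\<bar> * (vec_norm v)\<^sup>2 / (Im z)\<^sup>2"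
    and "cmod (trace_res z A - trace_res z B) \<le> 2 / Im z"
proof -
  note Ac = herm_mats_carrier[OF A] and Bc = herm_mats_carrier[OF B]
  note RA = resolvent_exists[OF A z] and RB = resolvent_exists[OF B z]
  let ?RA = "resolvent z A" and ?RB = "resolvent z B"
  let ?Q = "?RB * ?RA"
  have Qc: "?Q \<in> carrier_mat n n" by (rule mult_carrier_mat[OF RB(1) RA(1)])
  have ABi: "(A - B) $$ (i, j) = of_real s * v $ i * cnj (v $ j)" if "i < n" "j < n" for i j
    using AB[OF that] Ac Bc that by simp
  define q where "q = (\<Sum>i<n. cnj (v $ i) * (?Q *\<^sub>v v) $ i)"
  have tr: "trace_res z A - trace_res z B = of_real s * q"
    unfolding trace_res_diff[OF A B z] q_def sum_distrib_left
    by (intro sum.cong refl)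
      (simp add: ABi mult_mat_vec_index_sum[OF Qc v] sum_distrib_left mult_ac del: index_mult_mat_vec)
  have "cmod q \<le> vec_norm v * vec_norm (?Q *\<^sub>v v)"
    unfolding q_def by (rule Cauchy_Schwarz_vec[OF v mult_mat_vec_carrier[OF Qc v]])
  also have "\<dots> \<le> vec_norm v * (vec_norm v / (Im z)\<^sup>2)"
    by (intro mult_left_mono vec_norm_resolvent_mult_le[OF A B v z]) simp
  finally have "\<bar>s\<bar> * cmod q \<le> \<bar>s\<bar> * (vec_norm v * (vec_norm v / (Im z)\<^sup>2))"
    by (intro mult_left_mono) auto
  thus "cmod (trace_res z A - trace_res z B) \<le> \<bar>s\<bar> * (vec_norm v)\<^sup>2 / (Im z)\<^sup>2"
    by (simp add: tr norm_mult power2_eq_square)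
  define a where "a = ?RA *\<^sub>v v"
  define b where "b = vec n (\<lambda>k. cnj (\<Sum>i<n. cnj (v $ i) * ?RB $$ (i, k)))"
  have a: "a \<in> carrier_vec n" unfolding a_def by (rule mult_mat_vec_carrier[OF RA(1) v])
  have b: "b \<in> carrier_vec n" by (simp add: b_def)
  \<comment> \<open>By definition \<open>b = R\<^sub>B\<^sup>* v\<close>, so \<open>R\<^sub>A - R\<^sub>B = s a b\<^sup>*\<close>. Applying both sides to \<open>b\<close> bounds
    \<open>\<bar>s\<bar> \<parallel>a\<parallel> \<parallel>b\<parallel>\<close>, and the trace is \<open>s \<langle>b, a\<rangle>\<close>.\<close>
  have adj: "(\<Sum>i<n. cnj (v $ i) * (?RB *\<^sub>v w) $ i) = (\<Sum>k<n. cnj (b $ k) * w $ k)"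
    if w: "w \<in> carrier_vec n" for w
  proof -
    have "(\<Sum>i<n. cnj (v $ i) * (?RB *\<^sub>v w) $ i)
        = (\<Sum>i<n. \<Sum>k<n. cnj (v $ i) * ?RB $$ (i, k) * w $ k)"
      by (intro sum.cong refl)
        (simp only: mult_mat_vec_index_sum[OF RB(1) w] lessThan_iff sum_distrib_left mult.assoc)
    also have "\<dots> = (\<Sum>k<n. \<Sum>i<n. cnj (v $ i) * ?RB $$ (i, k) * w $ k)"
      by (rule sum.swap)
    also have "\<dots> = (\<Sum>k<n. cnj (b $ k) * w $ k)"
      by (intro sum.cong refl) (simp add: b_def sum_distrib_right)
    finally show ?thesis .
  qed
  have "q = (\<Sum>k<n. cnj (b $ k) * a $ k)"
    unfolding q_def assoc_mult_mat_vec[OF RB(1) RA(1) v] a_def[symmetric] by (rule adj[OF a])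
  hence q_le: "cmod q \<le> vec_norm b * vec_norm a"
    using Cauchy_Schwarz_vec[OF b a] by simp
  have w: "?RB *\<^sub>v b \<in> carrier_vec n" by (rule mult_mat_vec_carrier[OF RB(1) b])
  have nb: "(\<Sum>k<n. cnj (b $ k) * b $ k) = of_real ((vec_norm b)\<^sup>2)"
    unfolding vec_norm_power2[OF b] of_real_sum
    by (intro sum.cong refl) (simp only: complex_norm_square mult.commute)
  have "(A - B) *\<^sub>v (?RB *\<^sub>v b) = (of_real s * of_real ((vec_norm b)\<^sup>2)) \<cdot>\<^sub>v v" (is "?l = ?r")
  proof (rule eq_vecI)
    fix i assume "i < dim_vec ?r"
    hence i: "i < n" using v by simp
    have "?l $ i = (\<Sum>j<n. (of_real s * v $ i * cnj (v $ j)) * (?RB *\<^sub>v b) $ j)"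
      unfolding mult_mat_vec_index_sum[OF minus_carrier_mat[OF Bc] w i]
      by (intro sum.cong refl) (simp only: ABi[OF i] lessThan_iff)
    also have "\<dots> = of_real s * v $ i * (\<Sum>j<n. cnj (v $ j) * (?RB *\<^sub>v b) $ j)"
      by (simp only: sum_distrib_left mult.assoc)
    also have "\<dots> = of_real s * v $ i * of_real ((vec_norm b)\<^sup>2)"
      by (simp only: adj[OF b] nb)
    finally show "?l $ i = ?r $ i" using v i by (simp add: mult_ac)
  qed (use v Ac Bc in simp)
  hence "(?RA - ?RB) *\<^sub>v b = (of_real s * of_real ((vec_norm b)\<^sup>2)) \<cdot>\<^sub>v a"
    unfolding resolvent_diff[OF A B z] a_def
    by (simp only: assoc_mult_mat_vec[OF mult_carrier_mat[OF RA(1) minus_carrier_mat[OF Bc]] RB(1) b]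
        assoc_mult_mat_vec[OF RA(1) minus_carrier_mat[OF Bc] w] mult_mat_vec[OF RA(1) v])
  hence "\<bar>s\<bar> * (vec_norm b)\<^sup>2 * vec_norm a = vec_norm ((?RA - ?RB) *\<^sub>v b)"
    by (simp only: vec_norm_smult norm_mult norm_of_real abs_power2)
  also have "\<dots> = vec_norm (?RA *\<^sub>v b - ?RB *\<^sub>v b)"
    by (simp only: minus_mult_distrib_mat_vec[OF RA(1) RB(1) b])
  also have "\<dots> \<le> vec_norm (?RA *\<^sub>v b) + vec_norm (?RB *\<^sub>v b)"
    by (rule vec_norm_diff_le[OF mult_mat_vec_carrier[OF RA(1) b] w])
  also have "\<dots> \<le> vec_norm b / Im z + vec_norm b / Im z"
    by (intro add_mono vec_norm_resolvent_le[OF A b z] vec_norm_resolvent_le[OF B b z])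
  finally have key: "vec_norm b * (\<bar>s\<bar> * (vec_norm b * vec_norm a)) \<le> vec_norm b * (2 / Im z)"
    by (simp add: power2_eq_square mult_ac)
  have "\<bar>s\<bar> * (vec_norm b * vec_norm a) \<le> 2 / Im z"
  proof (cases "vec_norm b = 0")
    case True thus ?thesis using z by simp
  next
    case False
    hence "0 < vec_norm b" using vec_norm_nonneg[of b] by linarith
    thus ?thesis using key by (rule mult_left_le_imp_le[rotated])
  qed
  moreover have "\<bar>s\<bar> * cmod q \<le> \<bar>s\<bar> * (vec_norm b * vec_norm a)"
    using q_le by (intro mult_left_mono) auto
  ultimately show "cmod (trace_res z A - trace_res z B) \<le> 2 / Im z"
    by (simp add: tr norm_mult)
qed

text \<open>This interpolates between the bounded and the linear estimate: the minimum of \<open>1\<close> and \<open>r\<close> is at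
  most every power of \<open>r\<close> with exponent in \<open>(0, 1]\<close>.\<close>

lemma min_one_le_powr:
  fixes r :: real
  assumes "x \<le> 1" "x \<le> r" "0 \<le> r" "0 < a" "a \<le> 1"
  shows "x \<le> r powr a"
proof (cases "r \<le> 1")
  case True
  hence "r \<le> r powr a" using powr_mono'[of a 1 r] assms by (cases "r = 0") auto
  thus ?thesis using assms by simp
next
  case False
  hence "1 \<le> r powr a" using assms by (simp add: ge_one_powr_ge_zero)
  thus ?thesis using assms by simp
qed

text \<open>A Hermitian matrix supported on the positions \<open>(a, b)\<close> and \<open>(b, a)\<close> with entry \<open>x\<close> is a
  difference of two Hermitian rank-one matrices of size \<open>cmod x\<close> each (a single one if \<open>a = b\<close>),
  so the rank-one bounds apply twice.\<close>

lemma trace_res_entry_change: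
  assumes A: "A \<in> herm_mats 2 n" and B: "B \<in> herm_mats 2 n" and z: "2 \<le> Im z"
    and ab: "a \<le> b" "b < n" and \<alpha>: "0 < \<alpha>" "\<alpha> \<le> 1"
    and eq: "\<And>i j. i < n \<Longrightarrow> j < n \<Longrightarrow> (i, j) \<noteq> (a, b) \<Longrightarrow> (i, j) \<noteq> (b, a) \<Longrightarrow> A $$ (i, j) = B $$ (i, j)"
  shows "cmod (trace_res z A - trace_res z B) \<le> 2 * cmod (A $$ (a, b) - B $$ (a, b)) powr \<alpha>"
proof -
  have z0: "0 < Im z" using z by simp
  have z4: "4 \<le> (Im z)\<^sup>2" using power_mono[OF z, of 2] by simp
  define x where "x = A $$ (a, b) - B $$ (a, b)"
  have cnjx: "cnj x = A $$ (b, a) - B $$ (b, a)"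
    using ab herm_mats_cnj[OF A, of a b] herm_mats_cnj[OF B, of a b] by (simp add: x_def)
  have step: "cmod (trace_res z G - trace_res z H) \<le> cmod x powr \<alpha>"
    if "G \<in> herm_mats 2 n" "H \<in> herm_mats 2 n" "v \<in> carrier_vec n"
      "\<And>i j. i < n \<Longrightarrow> j < n \<Longrightarrow> G $$ (i, j) - H $$ (i, j) = of_real s * v $ i * cnj (v $ j)"
      "\<bar>s\<bar> * (vec_norm v)\<^sup>2 \<le> cmod x" for G H v s
  proof (rule min_one_le_powr[OF _ _ _ \<alpha>])
    have "cmod (trace_res z G - trace_res z H) \<le> 2 / Im z"
      by (rule trace_res_rank_one(2)[OF that(1,2) z0 that(3) that(4)])
    also have "\<dots> \<le> 1" using z by simp
    finally show "cmod (trace_res z G - trace_res z H) \<le> 1" .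
    have "cmod (trace_res z G - trace_res z H) \<le> \<bar>s\<bar> * (vec_norm v)\<^sup>2 / (Im z)\<^sup>2"
      by (rule trace_res_rank_one(1)[OF that(1,2) z0 that(3) that(4)])
    also have "\<dots> \<le> cmod x / 1" using z4 that(5) by (intro frac_le) auto
    finally show "cmod (trace_res z G - trace_res z H) \<le> cmod x" by simp
  qed simp
  show ?thesis
  proof (cases "a = b")
    case True
    have "cnj x = x" using cnjx by (simp only: True x_def)
    hence xr: "of_real (Re x) = x" by (simp only: Reals_cnj_iff[symmetric] of_real_Re)
    have n1: "(vec_norm (unit_vec n a :: complex vec))\<^sup>2 = 1"
    proof -
      have "(\<Sum>i<n. (cmod ((unit_vec n a :: complex vec) $ i))\<^sup>2) = (\<Sum>i<n. if i = a then 1 else 0)"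
        using ab by (intro sum.cong) auto
      thus ?thesis using ab by (simp add: vec_norm_power2[OF unit_vec_carrier])
    qed
    have "cmod (trace_res z A - trace_res z B) \<le> cmod x powr \<alpha>"
    proof (rule step[OF A B unit_vec_carrier[of n a], where s = "Re x"])
      fix i j assume ij: "i < n" "j < n"
      show "A $$ (i, j) - B $$ (i, j) = of_real (Re x) * unit_vec n a $ i * cnj (unit_vec n a $ j)"
      proof (cases "i = a \<and> j = a")
        case c: True
        hence "A $$ (i, j) - B $$ (i, j) = x" using True by (simp add: x_def)
        thus ?thesis using xr c ij by simp
      next
        case False
        thus ?thesis using eq[OF ij] ij ab True by auto
      qed
    qed (simp add: n1 abs_Re_le_cmod)
    also have "\<dots> \<le> 2 * cmod x powr \<alpha>" by simp
    finally show ?thesis by (simp add: x_def)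
  next
    case False
    show ?thesis
    proof (cases "x = 0")
      case True
      have "A $$ (b, a) - B $$ (b, a) = 0" "A $$ (a, b) - B $$ (a, b) = 0"
        using True by (simp_all only: cnjx[symmetric] x_def[symmetric] complex_cnj_zero)
      hence "A $$ (a, b) = B $$ (a, b)" "A $$ (b, a) = B $$ (b, a)"
        by (simp_all only: right_minus_eq)
      hence "A $$ (i, j) = B $$ (i, j)" if "i < n" "j < n" for i j
        using eq[OF that] by blast
      hence "A = B" using herm_mats_carrier[OF A] herm_mats_carrier[OF B]
        by (intro eq_matI) auto
      thus ?thesis by simp
    next
      case x0: False
      \<comment> \<open>With \<open>w\<^sub>\<plusminus> = e\<^sub>a \<plusminus> cnj u e\<^sub>b\<close>, the matrix \<open>w\<^sub>+ w\<^sub>+\<^sup>* - w\<^sub>- w\<^sub>-\<^sup>*\<close> has the entry \<open>2 u\<close> at \<open>(a, b)\<close>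
        and its diagonal cancels. \<open>N\<close> is the intermediate matrix after adding the first summand.\<close>
      define u where "u = x / of_real (cmod x)"
      have u: "of_real (cmod x) * u = x" "cmod u = 1"
        using x0 by (simp_all add: u_def norm_divide)
      define w where "w \<epsilon> = vec n (\<lambda>i. if i = a then 1 else if i = b then \<epsilon> * cnj u else 0)" for \<epsilon> :: complex
      have w: "w \<epsilon> \<in> carrier_vec n" for \<epsilon> by (simp add: w_def)
      have wa: "w \<epsilon> $ a = 1" for \<epsilon> using ab by (simp add: w_def)
      have wb: "w \<epsilon> $ b = \<epsilon> * cnj u" for \<epsilon> using ab False by (simp add: w_def)
      have nw: "(vec_norm (w \<epsilon>))\<^sup>2 = 2" if "cmod \<epsilon> = 1" for \<epsilon>
      proof -
        have "(vec_norm (w \<epsilon>))\<^sup>2 = (\<Sum>i<n. (if i = a then 1 else 0) + (if i = b then 1 else 0))"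
          unfolding vec_norm_power2[OF w] using False that u(2)
          by (intro sum.cong refl) (simp add: w_def norm_mult)
        thus ?thesis using ab by (simp add: sum.distrib)
      qed
      define h where "h = cmod x / 2"
      define N where "N = mat n n (\<lambda>(i, j). B $$ (i, j) + of_real h * w 1 $ i * cnj (w 1 $ j))"
      have N: "N \<in> herm_mats 2 n"
      proof -
        have "N $$ (i, j) = cnj (N $$ (j, i))" if "i < n" "j < n" for i j
          using that by (simp add: N_def herm_mats_cnj[OF B])
        moreover have "N \<in> carrier_mat n n" by (simp add: N_def)
        moreover have "(2::nat) \<noteq> 1" by simp
        ultimately show ?thesis unfolding herm_mats_def by blast
      qed
      have NB: "N $$ (i, j) - B $$ (i, j) = of_real h * w 1 $ i * cnj (w 1 $ j)" if "i < n" "j < n" for i j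
        using that by (simp add: N_def)
      have AN: "A $$ (i, j) - N $$ (i, j) = of_real (- h) * w (-1) $ i * cnj (w (-1) $ j)"
        if ij: "i < n" "j < n" for i j
      proof -
        have hu: "of_real h * u = x / 2" "of_real h * cnj u = cnj x / 2"
        proof -
          show hu: "of_real h * u = x / 2" using u(1) by (simp add: h_def)
          have "cnj (of_real h * u) = cnj (x / 2)" by (simp only: hu)
          thus "of_real h * cnj u = cnj x / 2" by simp
        qed
        have "A $$ (i, j) - B $$ (i, j) = of_real h * (w 1 $ i * cnj (w 1 $ j) - w (-1) $ i * cnj (w (-1) $ j))"
        proof -
          consider "i = a" "j = b" | "i = b" "j = a" | "(i, j) \<noteq> (a, b)" "(i, j) \<noteq> (b, a)" by auto
          thus ?thesis
          proof cases
            case 1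
            have "of_real h * (w 1 $ a * cnj (w 1 $ b) - w (-1) $ a * cnj (w (-1) $ b)) = 2 * (of_real h * u)"
              by (simp add: wa wb)
            also have "\<dots> = x" by (simp only: hu) simp
            finally show ?thesis unfolding 1 x_def by (rule sym)
          next
            case 2
            have "of_real h * (w 1 $ b * cnj (w 1 $ a) - w (-1) $ b * cnj (w (-1) $ a)) = 2 * (of_real h * cnj u)"
              by (simp add: wa wb)
            also have "\<dots> = cnj x" by (simp only: hu) simp
            finally show ?thesis unfolding 2 cnjx by (rule sym)
          next
            case 3
            hence "A $$ (i, j) - B $$ (i, j) = 0" using eq[OF ij] by simp
            moreover have "w 1 $ i * cnj (w 1 $ j) - w (-1) $ i * cnj (w (-1) $ j) = 0"
              using 3 ij by (auto simp: w_def)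
            ultimately show ?thesis by simp
          qed
        qed
        thus ?thesis using NB[OF ij] by (simp add: algebra_simps)
      qed
      have "cmod (trace_res z A - trace_res z N) \<le> cmod x powr \<alpha>"
        by (rule step[OF A N w AN]) (simp_all add: nw h_def)
      moreover have "cmod (trace_res z N - trace_res z B) \<le> cmod x powr \<alpha>"
        by (rule step[OF N B w NB]) (simp_all add: nw h_def)
      ultimately have "cmod (trace_res z A - trace_res z B) \<le> cmod x powr \<alpha> + cmod x powr \<alpha>"
        using norm_triangle_ineq[of "trace_res z A - trace_res z N" "trace_res z N - trace_res z B"]
        by simp
      thus ?thesis by (simp add: x_def)
    qed
  qed
qed

text \<open>Replacing the entries of \<open>B\<close> by those of \<open>A\<close> one pair at a time sums the bounds for single
  entries. For \<open>\<alpha> < 1\<close> this is much better than the \<open>\<ell>\<^sup>1\<close> bound when \<open>A - B\<close> has a few huge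
  entries, which is how the elements of a small \<open>\<ell>\<^sup>\<alpha>\<close> ball can look.\<close>

lemma trace_res_diff_le_quasinorm:
  assumes A: "A \<in> herm_mats \<beta> n" and B: "B \<in> herm_mats \<beta> n" and z: "2 \<le> Im z"
    and \<alpha>: "0 < \<alpha>" "\<alpha> \<le> 1"
  shows "cmod (trace_res z A - trace_res z B)
    \<le> 2 * (\<Sum>i<n. \<Sum>j<n. cmod ((A - B) $$ (i, j)) powr \<alpha>)"
proof -
  note Ac = herm_mats_carrier[OF A] and Bc = herm_mats_carrier[OF B]
  \<comment> \<open>Upper triangular positions index the entry pairs; those in \<open>P\<close> are already taken from \<open>A\<close>.\<close>
  define H where "H P = mat n n (\<lambda>(i, j). if (min i j, max i j) \<in> P then A $$ (i, j) else B $$ (i, j))" for P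
  have H: "H P \<in> herm_mats 2 n" for P
  proof -
    have "H P $$ (i, j) = cnj (H P $$ (j, i))" if "i < n" "j < n" for i j
      using that by (simp add: H_def herm_mats_cnj[OF A] herm_mats_cnj[OF B] min.commute max.commute)
    moreover have "H P \<in> carrier_mat n n" by (simp add: H_def)
    moreover have "(2::nat) \<noteq> 1" by simp
    ultimately show ?thesis unfolding herm_mats_def by blast
  qed
  define I where "I = {(i, j). i \<le> j \<and> j < n}"
  have sub: "I \<subseteq> {..<n} \<times> {..<n}" by (auto simp: I_def)
  have "finite P \<Longrightarrow> P \<subseteq> I \<Longrightarrow> cmod (trace_res z (H P) - trace_res z (H {}))
      \<le> 2 * (\<Sum>p\<in>P. cmod ((A - B) $$ p) powr \<alpha>)" for P
  proof (induction P rule: finite_induct)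
    case (insert p P)
    obtain a b where p: "p = (a, b)" by force
    have ab: "a \<le> b" "b < n" using insert.prems by (auto simp: I_def p)
    have "cmod (trace_res z (H (insert p P)) - trace_res z (H P))
        \<le> 2 * cmod (H (insert p P) $$ (a, b) - H P $$ (a, b)) powr \<alpha>"
    proof (rule trace_res_entry_change[OF H H z ab \<alpha>])
      fix i j assume "i < n" "j < n" "(i, j) \<noteq> (a, b)" "(i, j) \<noteq> (b, a)"
      thus "H (insert p P) $$ (i, j) = H P $$ (i, j)"
        by (auto simp: H_def p min_def max_def)
    qed
    also have "H (insert p P) $$ (a, b) - H P $$ (a, b) = (A - B) $$ p"
      using ab insert.hyps Ac Bc by (simp add: H_def p)
    finally show ?case
      using insert norm_triangle_ineq[of "trace_res z (H (insert p P)) - trace_res z (H P)"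
          "trace_res z (H P) - trace_res z (H {})"] by simp
  qed simp
  from this[of I] have "cmod (trace_res z (H I) - trace_res z (H {}))
      \<le> 2 * (\<Sum>p\<in>I. cmod ((A - B) $$ p) powr \<alpha>)"
    using finite_subset[OF sub] by auto
  also have "H I = A" using Ac by (intro eq_matI) (auto simp: H_def I_def min_def max_def)
  also have "H {} = B" using Bc by (intro eq_matI) (auto simp: H_def)
  also have "(\<Sum>p\<in>I. cmod ((A - B) $$ p) powr \<alpha>)
      \<le> (\<Sum>p\<in>{..<n} \<times> {..<n}. cmod ((A - B) $$ p) powr \<alpha>)"
    by (rule sum_mono2) (use sub in auto)
  also have "\<dots> = (\<Sum>i<n. \<Sum>j<n. cmod ((A - B) $$ (i, j)) powr \<alpha>)"
    by (simp add: sum.cartesian_product)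
  finally show ?thesis by simp
qed

section \<open>Spectral measures and their Stieltjes transforms\<close>

text \<open>The listing is a choice; only sums over it are used, and those do not depend on the order.\<close>

definition eigvals :: "complex mat \<Rightarrow> complex list" where
  "eigvals A = (SOME as. char_poly A = (\<Prod>a\<leftarrow>as. [:- a, 1:]) \<and> length as = dim_row A)"

lemma char_poly_eigvals:
  assumes "A \<in> carrier_mat n n"
  shows "char_poly A = (\<Prod>a\<leftarrow>eigvals A. [:- a, 1:])" and "length (eigvals A) = n"
proof -
  from char_poly_factorized[OF assms]
  have "\<exists>as. char_poly A = (\<Prod>a\<leftarrow>as. [:- a, 1:]) \<and> length as = dim_row A" using assms by auto
  from someI_ex[OF this] show "char_poly A = (\<Prod>a\<leftarrow>eigvals A. [:- a, 1:])" "length (eigvals A) = n"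
    using assms by (auto simp: eigvals_def)
qed

lemma proots_linear_factors: "proots (\<Prod>a\<leftarrow>as. [:- a, 1:]) = mset (as :: complex list)"
proof -
  have "0 \<notin> set (map (\<lambda>a. [:- a, 1:]) as)" by auto
  hence "proots (\<Prod>a\<leftarrow>as. [:- a, 1:]) = (\<Sum>p\<leftarrow>map (\<lambda>a. [:- a, 1:]) as. proots p)"
    using proots_prod_list[of "map (\<lambda>a. [:- a, 1:]) as"] by simp
  also have "\<dots> = mset as" by (induction as) auto
  finally show ?thesis .
qed

text \<open>An eigenvector \<open>v\<close> for \<open>a\<close> gives \<open>\<langle>v, A v\<rangle> = a \<parallel>v\<parallel>\<^sup>2\<close>, and the left-hand side is real.\<close>

lemma eigvals_real:
  assumes A: "A \<in> herm_mats \<beta> n" and a: "a \<in> set (eigvals A)"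
  shows "complex_of_real (Re a) = a"
proof -
  note Ac = herm_mats_carrier[OF A]
  have "poly (char_poly A) a = 0"
    unfolding char_poly_eigvals(1)[OF Ac] using a by (auto simp: poly_prod_list_zero_iff)
  hence "eigenvalue A a" using eigenvalue_root_char_poly[OF Ac] by simp
  then obtain v where v: "v \<in> carrier_vec n" "v \<noteq> 0\<^sub>v n" "A *\<^sub>v v = a \<cdot>\<^sub>v v"
    using Ac by (auto simp: eigenvalue_def eigenvector_def)
  have "(\<Sum>i<n. cnj (v $ i) * (A *\<^sub>v v) $ i) = (\<Sum>i<n. a * of_real ((cmod (v $ i))\<^sup>2))"
  proof (intro sum.cong refl)
    fix i assume "i \<in> {..<n}"
    hence "(A *\<^sub>v v) $ i = a * v $ i" unfolding v(3) using v(1) by simp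
    thus "cnj (v $ i) * (A *\<^sub>v v) $ i = a * of_real ((cmod (v $ i))\<^sup>2)"
      by (simp only: complex_norm_square mult.commute mult.left_commute)
  qed
  also have "\<dots> = a * of_real ((vec_norm v)\<^sup>2)"
    by (simp add: vec_norm_power2[OF v(1)] sum_distrib_left)
  finally have "Im a * (vec_norm v)\<^sup>2 = 0"
    using hermitian_form_real[OF A v(1)] by simp
  moreover have "vec_norm v \<noteq> 0" using v vec_norm_eq_0_iff by blast
  ultimately show ?thesis by (simp add: complex_eq_iff)
qed

text \<open>Comparing the entries of row \<open>i\<close> in \<open>R T = 1\<close> from left to right shows that \<open>R\<close> vanishes below the
  diagonal, and the diagonal entry follows.\<close>

lemma upper_triangular_inverse_diag:
  fixes R T :: "complex mat"
  assumes R: "R \<in> carrier_mat n n" and T: "T \<in> carrier_mat n n"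
    and RT: "R * T = 1\<^sub>m n"
    and ut: "\<And>i j. j < i \<Longrightarrow> i < n \<Longrightarrow> T $$ (i, j) = 0"
    and diag: "\<And>i. i < n \<Longrightarrow> T $$ (i, i) \<noteq> 0" and i: "i < n"
  shows "R $$ (i, i) = 1 / T $$ (i, i)"
proof -
  have entry: "(\<Sum>k<n. R $$ (i, k) * T $$ (k, j)) = (if i = j then 1 else 0)" if "j < n" for j
    using mult_mat_index_sum[OF R T i that] i that unfolding RT by simp
  have low: "j < i \<Longrightarrow> R $$ (i, j) = 0" for j
  proof (induction j rule: less_induct)
    case (less j)
    hence j: "j < n" using i by simp
    have "(\<Sum>k<n. R $$ (i, k) * T $$ (k, j)) = (\<Sum>k<n. if k = j then R $$ (i, j) * T $$ (j, j) else 0)"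
    proof (intro sum.cong refl)
      fix k assume "k \<in> {..<n}"
      thus "R $$ (i, k) * T $$ (k, j) = (if k = j then R $$ (i, j) * T $$ (j, j) else 0)"
        using less ut[of j k] by (cases k j rule: linorder_cases) auto
    qed
    hence "R $$ (i, j) * T $$ (j, j) = 0" using entry[OF j] j less.prems by simp
    thus ?case using diag[OF j] by simp
  qed
  have "(\<Sum>k<n. R $$ (i, k) * T $$ (k, i)) = (\<Sum>k<n. if k = i then R $$ (i, i) * T $$ (i, i) else 0)"
  proof (intro sum.cong refl)
    fix k assume "k \<in> {..<n}"
    thus "R $$ (i, k) * T $$ (k, i) = (if k = i then R $$ (i, i) * T $$ (i, i) else 0)"
      using low[of k] ut[of i k] by (cases k i rule: linorder_cases) auto
  qed
  hence "R $$ (i, i) * T $$ (i, i) = 1" using entry[OF i] i by simp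
  thus ?thesis using diag[OF i] by (simp add: field_simps)
qed

lemma shifted_index:
  "A \<in> carrier_mat n n \<Longrightarrow> i < n \<Longrightarrow> j < n \<Longrightarrow> shifted z A $$ (i, j) = (if i = j then z else 0) - A $$ (i, j)"
  by (auto simp: shifted_def)

text \<open>A Schur decomposition makes \<open>A\<close> similar to an upper triangular matrix whose diagonal lists the
  eigenvalues. The resolvent is then similar to the inverse of an upper triangular matrix, whose
  diagonal entries are the reciprocals.\<close>

lemma trace_res_eq_sum_eigvals:
  assumes A: "A \<in> herm_mats \<beta> n" and z: "0 < Im z"
  shows "trace_res z A = (\<Sum>i<n. 1 / (z - complex_of_real (Re (eigvals A ! i))))"
proof -
  note Ac = herm_mats_carrier[OF A] and R = resolvent_exists[OF A z]
  note cp = char_poly_eigvals[OF Ac]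
  obtain T where T: "T \<in> carrier_mat n n" "upper_triangular T" "similar_mat A T"
    using schur_decomposition_exists[OF Ac cp(1)] by blast
  then obtain P Q where wit: "similar_mat_wit A T P Q" by (auto simp: similar_mat_def)
  note W = similar_mat_witD2[OF Ac wit]
  have P: "P \<in> carrier_mat n n" and Q: "Q \<in> carrier_mat n n" and PQ: "P * Q = 1\<^sub>m n"
    and QP: "Q * P = 1\<^sub>m n" and APTQ: "A = P * T * Q"
    using W by auto
  have "mset (diag_mat T) = mset (eigvals A)"
    using proots_linear_factors[of "diag_mat T"] proots_linear_factors[of "eigvals A"]
      char_poly_upper_triangular[OF T(1,2)] char_poly_similar[OF T(3)] cp(1) by simp
  hence sets: "set (diag_mat T) = set (eigvals A)"
    and sums: "(\<Sum>a\<leftarrow>diag_mat T. f a) = (\<Sum>a\<leftarrow>eigvals A. f a)" for f :: "complex \<Rightarrow> complex"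
    by (metis set_mset_mset, metis mset_map sum_mset_sum_list)
  let ?S = "shifted z T"
  have S: "?S \<in> carrier_mat n n" by (rule shifted_carrier[OF T(1)])
  have AT: "Q * shifted z A * P = ?S"
  proof -
    have Z: "z \<cdot>\<^sub>m 1\<^sub>m n \<in> carrier_mat n n" by simp
    have "Q * shifted z A * P = Q * (z \<cdot>\<^sub>m 1\<^sub>m n) * P - Q * A * P"
      unfolding shifted_def carrier_matD(1)[OF Ac] mult_minus_distrib_mat[OF Q Z Ac]
      by (rule minus_mult_distrib_mat[OF mult_carrier_mat[OF Q Z] mult_carrier_mat[OF Q Ac] P])
    also have "Q * (z \<cdot>\<^sub>m 1\<^sub>m n) * P = z \<cdot>\<^sub>m 1\<^sub>m n"
      by (simp only: mult_smult_distrib[OF Q one_carrier_mat] right_mult_one_mat[OF Q]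
          mult_smult_assoc_mat[OF Q P] QP)
    also have "Q * A * P = T"
    proof -
      have "Q * A * P = (Q * P) * T * (Q * P)"
        unfolding APTQ using P Q T(1) by (simp add: assoc_mult_mat[of _ n n _ n _ n])
      thus ?thesis using T(1) by (simp add: QP)
    qed
    finally show ?thesis using T(1) by (simp add: shifted_def)
  qed
  let ?R' = "Q * resolvent z A * P"
  have R': "?R' \<in> carrier_mat n n" using P Q R by simp
  have inv: "?R' * ?S = 1\<^sub>m n"
  proof -
    have "?R' * ?S = Q * (resolvent z A * ((P * Q) * shifted z A)) * P"
      unfolding AT[symmetric] using P Q R(1) shifted_carrier[OF Ac, of z]
      by (simp add: assoc_mult_mat[of _ n n _ n _ n])
    also have "\<dots> = 1\<^sub>m n"
      using P Q R(1) shifted_carrier[OF Ac, of z] by (simp add: PQ QP R(2))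
    finally show ?thesis .
  qed
  have nz: "z - T $$ (i, i) \<noteq> 0" if "i < n" for i
  proof
    assume "z - T $$ (i, i) = 0"
    moreover have "T $$ (i, i) \<in> set (eigvals A)"
      unfolding sets[symmetric] using T(1) that by (auto simp: diag_mat_def)
    ultimately show False using eigvals_real[OF A, of "T $$ (i, i)"] z
      by (metis Im_complex_of_real eq_iff_diff_eq_0 less_irrefl)
  qed
  have "trace_res z A = (\<Sum>i<n. \<Sum>j<n. (P * Q) $$ (i, j) * resolvent z A $$ (j, i))"
  proof -
    have "(\<Sum>j<n. (P * Q) $$ (i, j) * resolvent z A $$ (j, i)) = resolvent z A $$ (i, i)" if "i < n" for i
    proof -
      have "(\<Sum>j<n. (P * Q) $$ (i, j) * resolvent z A $$ (j, i))
          = (\<Sum>j<n. if i = j then resolvent z A $$ (i, i) else 0)"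
        unfolding PQ using that by (intro sum.cong refl) simp
      thus ?thesis using that by simp
    qed
    thus ?thesis using Ac by (simp add: trace_res_def)
  qed
  also have "\<dots> = (\<Sum>i<n. ?R' $$ (i, i))"
    by (rule trace_cycle[OF Q R(1) P, symmetric])
  also have "\<dots> = (\<Sum>i<n. 1 / (z - T $$ (i, i)))"
  proof (intro sum.cong refl)
    fix i assume "i \<in> {..<n}"
    hence i: "i < n" by simp
    have "?R' $$ (i, i) = 1 / ?S $$ (i, i)"
    proof (rule upper_triangular_inverse_diag[OF R' S inv _ _ i])
      show "?S $$ (k, j) = 0" if "j < k" "k < n" for k j
        using that T upper_triangularD[OF T(2), of j k] by (simp add: shifted_index[OF T(1)])
      show "?S $$ (k, k) \<noteq> 0" if "k < n" for k
        using nz that by (simp add: shifted_index[OF T(1)])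
    qed
    thus "?R' $$ (i, i) = 1 / (z - T $$ (i, i))"
      using i by (simp add: shifted_index[OF T(1)])
  qed
  also have "\<dots> = (\<Sum>a\<leftarrow>diag_mat T. 1 / (z - a))"
    using T(1) by (simp add: diag_mat_def sum_list_sum_nth atLeast0LessThan)
  also have "\<dots> = (\<Sum>a\<leftarrow>eigvals A. 1 / (z - a))" by (rule sums)
  also have "\<dots> = (\<Sum>i<n. 1 / (z - eigvals A ! i))"
    by (simp add: sum_list_sum_nth atLeast0LessThan cp(2))
  also have "\<dots> = (\<Sum>i<n. 1 / (z - complex_of_real (Re (eigvals A ! i))))"
    by (intro sum.cong refl) (simp add: eigvals_real[OF A] cp(2))
  finally show ?thesis .
qed

lemma prob_space_spectral_measure: "prob_space (spectral_measure A)"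
  unfolding spectral_measure_def by (intro measure_pmf.prob_space_distr) simp

lemma sets_spectral_measure [simp, measurable_cong]: "sets (spectral_measure A) = sets borel"
  by (simp add: spectral_measure_def)

lemma integral_spectral_measure:
  fixes f :: "real \<Rightarrow> 'b::{banach, second_countable_topology}"
  assumes A: "A \<in> carrier_mat n n" and n: "1 \<le> n" and f: "f \<in> borel_measurable borel"
  shows "(\<integral>x. f x \<partial>spectral_measure A) = (1 / real n) *\<^sub>R (\<Sum>i<n. f (Re (eigvals A ! i)))"
proof -
  note cp = char_poly_eigvals[OF A]
  have "image_mset ((!) (eigvals A)) (mset_set {..<n}) = mset (map ((!) (eigvals A)) [0..<n])"
    by (simp only: mset_set_upto_eq_mset_upto mset_map)
  also have "map ((!) (eigvals A)) [0..<n] = eigvals A" using cp(2) by (simp add: map_nth flip: cp(2))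
  finally have "pmf_of_multiset (proots (char_poly A)) = map_pmf ((!) (eigvals A)) (pmf_of_set {..<n})"
    using n by (subst map_pmf_of_set) (auto simp: cp(1) proots_linear_factors lessThan_empty_iff)
  hence "(\<integral>x. f x \<partial>spectral_measure A)
      = (\<integral>i. f (Re (eigvals A ! i)) \<partial>measure_pmf (pmf_of_set {..<n}))"
    using f by (simp add: spectral_measure_def integral_distr)
  also have "\<dots> = (\<Sum>i<n. pmf (pmf_of_set {..<n}) i *\<^sub>R f (Re (eigvals A ! i)))"
    using n by (intro integral_measure_pmf) (auto simp: lessThan_empty_iff)
  also have "\<dots> = (1 / real n) *\<^sub>R (\<Sum>i<n. f (Re (eigvals A ! i)))"
    using n by (simp add: scaleR_sum_right lessThan_empty_iff)
  finally show ?thesis .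
qed

abbreviation scaled :: "nat \<Rightarrow> complex mat \<Rightarrow> complex mat" where
  "scaled n A \<equiv> complex_of_real (1 / sqrt (real n)) \<cdot>\<^sub>m A"

lemma real_smult_herm_mats:
  assumes "A \<in> herm_mats \<beta> n"
  shows "complex_of_real c \<cdot>\<^sub>m A \<in> herm_mats \<beta> n"
proof -
  have c: "complex_of_real c \<cdot>\<^sub>m A \<in> carrier_mat n n"
    using herm_mats_carrier[OF assms] by simp
  have e: "(complex_of_real c \<cdot>\<^sub>m A) $$ (i, j) = complex_of_real c * A $$ (i, j)" if "i < n" "j < n" for i j
    using herm_mats_carrier[OF assms] that by simp
  have "(complex_of_real c \<cdot>\<^sub>m A) $$ (i, j) = cnj ((complex_of_real c \<cdot>\<^sub>m A) $$ (j, i))"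
    if "i < n" "j < n" for i j
    using that by (simp add: e herm_mats_cnj[OF assms])
  moreover have "(complex_of_real c \<cdot>\<^sub>m A) $$ (i, j) \<in> \<real>" if "\<beta> = 1" "i < n" "j < n" for i j
  proof -
    have "A $$ (i, j) \<in> \<real>" using assms that unfolding herm_mats_def by blast
    thus ?thesis using that by (simp add: e)
  qed
  ultimately show ?thesis using c unfolding herm_mats_def by blast
qed

lemma stieltjes_normalized_spectral_measure:
  assumes A: "A \<in> herm_mats \<beta> n" and n: "1 \<le> n" and z: "0 < Im z"
  shows "stieltjes (normalized_spectral_measure n A) z = trace_res z (scaled n A) / n"
proof -
  note S = real_smult_herm_mats[OF A, of "1 / sqrt (real n)"]
  have "(\<lambda>x. 1 / (z - complex_of_real x)) \<in> borel_measurable borel" by measurable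
  from integral_spectral_measure[OF herm_mats_carrier[OF S] n this]
  show ?thesis
    unfolding stieltjes_def normalized_spectral_measure_def trace_res_eq_sum_eigvals[OF S z]
    by (simp add: scaleR_conv_of_real)
qed

lemma scaled_diff_index:
  assumes "A \<in> carrier_mat n n" "B \<in> carrier_mat n n" "i < n" "j < n"
  shows "cmod ((scaled n A - scaled n B) $$ (i, j)) = cmod ((A - B) $$ (i, j)) / sqrt (real n)"
proof -
  have "(scaled n A - scaled n B) $$ (i, j) = complex_of_real (1 / sqrt (real n)) * (A - B) $$ (i, j)"
    using assms by (simp add: algebra_simps)
  thus ?thesis by (simp add: norm_mult norm_divide)
qed

text \<open>Dividing the matrix by \<open>sqrt n\<close> and averaging over \<open>n\<close> eigenvalues multiplies the bound for the
  trace by \<open>n\<close> to the power \<open>- 3 / 2\<close>.\<close>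

lemma stieltjes_diff_le_lp:
  assumes A: "A \<in> herm_mats \<beta> n" and B: "B \<in> herm_mats \<beta> n" and z: "2 \<le> Im z"
    and p: "1 \<le> p" "p \<le> 2" and n: "1 \<le> n" and \<Delta>: "0 < \<Delta>"
    and D: "(\<Sum>i<n. \<Sum>j<n. cmod ((A - B) $$ (i, j)) powr p) \<le> \<Delta> powr p"
  shows "cmod (stieltjes (normalized_spectral_measure n A) z - stieltjes (normalized_spectral_measure n B) z)
    \<le> real n powr (- 1 / 2 - 1 / p) * \<Delta> / 2"
proof -
  note Ac = herm_mats_carrier[OF A] and Bc = herm_mats_carrier[OF B]
  have z0: "0 < Im z" using z by simp
  have sq: "sqrt (real n) > 0" using n by simp
  have "(\<Sum>i<n. \<Sum>j<n. cmod ((scaled n A - scaled n B) $$ (i, j)) powr p)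
      = (\<Sum>i<n. \<Sum>j<n. cmod ((A - B) $$ (i, j)) powr p) / sqrt (real n) powr p"
    unfolding sum_divide_distrib using sq
    by (intro sum.cong refl) (simp only: scaled_diff_index[OF Ac Bc] lessThan_iff powr_divide norm_ge_zero less_imp_le)
  also have "\<dots> \<le> \<Delta> powr p / sqrt (real n) powr p" by (intro divide_right_mono D) simp
  also have "\<dots> = (\<Delta> / sqrt (real n)) powr p" using \<Delta> by (simp add: powr_divide)
  finally have "cmod (trace_res z (scaled n A) - trace_res z (scaled n B))
      \<le> real n powr (1 - 1 / p) * (\<Delta> / sqrt (real n)) / 2"
    using sq \<Delta> by (intro trace_res_diff_le_lp[OF real_smult_herm_mats[OF A] real_smult_herm_mats[OF B] z p n]) auto
  hence "cmod (trace_res z (scaled n A) - trace_res z (scaled n B)) / n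
      \<le> real n powr (1 - 1 / p) * (\<Delta> / sqrt (real n)) / 2 / n"
    by (intro divide_right_mono) auto
  also have "\<dots> = real n powr (1 - 1 / p) * real n powr (- 1 / 2) * real n powr (- 1) * \<Delta> / 2"
    using n by (simp add: powr_minus powr_half_sqrt field_simps)
  also have "\<dots> = real n powr (- 1 / 2 - 1 / p) * \<Delta> / 2"
    unfolding powr_add[symmetric] by simp
  finally show ?thesis
    by (simp only: stieltjes_normalized_spectral_measure[OF A n z0] stieltjes_normalized_spectral_measure[OF B n z0]
      diff_divide_distrib[symmetric] norm_divide norm_of_nat)
qed

text \<open>Here the division of the matrix by \<open>sqrt n\<close> only gains \<open>n\<close> to the power \<open>- \<alpha> / 2\<close>. The total
  exponent \<open>- 1 - \<alpha> / 2\<close> is the one that appears in the second term of the rate for \<open>\<alpha> < 1\<close>.\<close>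

lemma stieltjes_diff_le_quasinorm:
  assumes A: "A \<in> herm_mats \<beta> n" and B: "B \<in> herm_mats \<beta> n" and z: "2 \<le> Im z"
    and \<alpha>: "0 < \<alpha>" "\<alpha> \<le> 1" and n: "1 \<le> n"
  shows "cmod (stieltjes (normalized_spectral_measure n A) z - stieltjes (normalized_spectral_measure n B) z)
    \<le> 2 * real n powr (- 1 - \<alpha> / 2) * (\<Sum>i<n. \<Sum>j<n. cmod ((A - B) $$ (i, j)) powr \<alpha>)" (is "_ \<le> _ * ?S")
proof -
  note Ac = herm_mats_carrier[OF A] and Bc = herm_mats_carrier[OF B]
  have z0: "0 < Im z" using z by simp
  have sq: "sqrt (real n) > 0" using n by simp
  have "cmod (trace_res z (scaled n A) - trace_res z (scaled n B))
      \<le> 2 * (\<Sum>i<n. \<Sum>j<n. cmod ((scaled n A - scaled n B) $$ (i, j)) powr \<alpha>)"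
    by (rule trace_res_diff_le_quasinorm[OF real_smult_herm_mats[OF A] real_smult_herm_mats[OF B] z \<alpha>])
  also have "(\<Sum>i<n. \<Sum>j<n. cmod ((scaled n A - scaled n B) $$ (i, j)) powr \<alpha>) = ?S / sqrt (real n) powr \<alpha>"
    unfolding sum_divide_distrib using sq
    by (intro sum.cong refl) (simp only: scaled_diff_index[OF Ac Bc] lessThan_iff powr_divide norm_ge_zero less_imp_le)
  finally have "cmod (trace_res z (scaled n A) - trace_res z (scaled n B)) / n
      \<le> 2 * (?S / sqrt (real n) powr \<alpha>) / n"
    by (intro divide_right_mono) auto
  also have "\<dots> = 2 * (real n powr (- 1) * real n powr (- \<alpha> / 2)) * ?S"
    using n by (simp add: powr_minus powr_powr field_simps flip: powr_half_sqrt)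
  also have "\<dots> = 2 * real n powr (- 1 - \<alpha> / 2) * ?S"
    unfolding powr_add[symmetric] by simp
  finally show ?thesis
    by (simp only: stieltjes_normalized_spectral_measure[OF A n z0] stieltjes_normalized_spectral_measure[OF B n z0]
      diff_divide_distrib[symmetric] norm_divide norm_of_nat)
qed

section \<open>Measurability and the mean spectral measure\<close>

lemma measurable_sum_of_pointwise_limit:
  fixes e :: "'w \<Rightarrow> nat \<Rightarrow> real" and f :: "nat \<Rightarrow> real \<Rightarrow> 'b::{second_countable_topology, real_normed_vector}"
  assumes "\<And>k. (\<lambda>\<omega>. \<Sum>i<n. f k (e \<omega> i)) \<in> borel_measurable M"
    and "\<And>x. (\<lambda>k. f k x) \<longlonglongrightarrow> g x"
  shows "(\<lambda>\<omega>. \<Sum>i<n. g (e \<omega> i)) \<in> borel_measurable M"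
  by (rule borel_measurable_LIMSEQ_metric[where f = "\<lambda>k \<omega>. \<Sum>i<n. f k (e \<omega> i)"])
    (auto intro!: assms tendsto_sum)

text \<open>Think of \<open>e \<omega>\<close> as a family of \<open>n\<close> points on the line. The resolvent sums on the imaginary axis
  determine the moments by expansion at infinity: with \<open>z = i y\<close>, the functions
  \<open>x\<^sup>k z / (z - x)\<close> satisfy a recursion in \<open>k\<close> and tend to \<open>x\<^sup>k\<close> as \<open>y\<close> grows. Only pointwise limits
  matter because the sums are finite.\<close>

lemma measurable_power_sums_of_resolvent_sums:
  fixes e :: "'w \<Rightarrow> nat \<Rightarrow> real"
  assumes res: "\<And>y. 2 \<le> y \<Longrightarrow> (\<lambda>\<omega>. \<Sum>i<n. 1 / (Complex 0 y - of_real (e \<omega> i))) \<in> borel_measurable M"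
  shows "(\<lambda>\<omega>. \<Sum>i<n. e \<omega> i ^ k) \<in> borel_measurable M"
proof -
  define \<phi> where "\<phi> k y x = complex_of_real x ^ k * (Complex 0 y / (Complex 0 y - of_real x))" for k y x
  have "(\<forall>y\<ge>2. (\<lambda>\<omega>. \<Sum>i<n. \<phi> k y (e \<omega> i)) \<in> borel_measurable M) \<and>
        (\<lambda>\<omega>. \<Sum>i<n. complex_of_real (e \<omega> i) ^ k) \<in> borel_measurable M"
  proof (induction k)
    case 0
    have "(\<lambda>\<omega>. \<Sum>i<n. \<phi> 0 y (e \<omega> i)) \<in> borel_measurable M" if "2 \<le> y" for y
    proof -
      have "(\<Sum>i<n. \<phi> 0 y (e \<omega> i)) = Complex 0 y * (\<Sum>i<n. 1 / (Complex 0 y - of_real (e \<omega> i)))" for \<omega>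
        by (simp add: \<phi>_def sum_distrib_left)
      thus ?thesis using res[OF that] by simp
    qed
    thus ?case by simp
  next
    case (Suc k)
    have A: "(\<lambda>\<omega>. \<Sum>i<n. \<phi> (Suc k) y (e \<omega> i)) \<in> borel_measurable M" if y: "2 \<le> y" for y
    proof -
      have "\<phi> (Suc k) y x = Complex 0 y * (\<phi> k y x - of_real x ^ k)" for x
      proof -
        have "Complex 0 y - of_real x \<noteq> 0" using y by (simp add: complex_eq_iff)
        thus ?thesis by (simp add: \<phi>_def field_simps)
      qed
      hence "(\<Sum>i<n. \<phi> (Suc k) y (e \<omega> i))
          = Complex 0 y * ((\<Sum>i<n. \<phi> k y (e \<omega> i)) - (\<Sum>i<n. complex_of_real (e \<omega> i) ^ k))" for \<omega>
        by (simp add: sum_subtractf flip: sum_distrib_left)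
      moreover have "(\<lambda>\<omega>. \<Sum>i<n. \<phi> k y (e \<omega> i)) \<in> borel_measurable M"
        and "(\<lambda>\<omega>. \<Sum>i<n. complex_of_real (e \<omega> i) ^ k) \<in> borel_measurable M"
        using Suc.IH y by auto
      ultimately show ?thesis by simp
    qed
    have lim: "(\<lambda>m. \<phi> (Suc k) (real (m + 2)) x) \<longlonglongrightarrow> complex_of_real x ^ Suc k" for x
    proof -
      have "(\<lambda>m. of_real x / Complex 0 (real (m + 2))) \<longlonglongrightarrow> 0"
      proof (rule Lim_null_comparison)
        show "(\<lambda>m. \<bar>x\<bar> / real (m + 2)) \<longlonglongrightarrow> 0" by real_asymp
        have "cmod (Complex 0 r) = \<bar>r\<bar>" for r by (simp add: complex_norm)
        thus "\<forall>\<^sub>F m in sequentially. cmod (of_real x / Complex 0 (real (m + 2))) \<le> \<bar>x\<bar> / real (m + 2)"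
          by (simp add: norm_divide)
      qed
      hence "(\<lambda>m. of_real x ^ Suc k * (1 / (1 - of_real x / Complex 0 (real (m + 2)))))
          \<longlonglongrightarrow> complex_of_real x ^ Suc k * (1 / (1 - 0))"
        by (intro tendsto_intros) auto
      moreover have "\<phi> (Suc k) (real (m + 2)) x
          = of_real x ^ Suc k * (1 / (1 - of_real x / Complex 0 (real (m + 2))))" for m
      proof -
        have "Complex 0 (real (m + 2)) \<noteq> 0" by (simp add: complex_eq_iff)
        hence "Complex 0 (real (m + 2)) / (Complex 0 (real (m + 2)) - of_real x)
            = 1 / ((Complex 0 (real (m + 2)) - of_real x) / Complex 0 (real (m + 2)))" by simp
        also have "(Complex 0 (real (m + 2)) - of_real x) / Complex 0 (real (m + 2))
            = 1 - of_real x / Complex 0 (real (m + 2))"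
          using \<open>Complex 0 (real (m + 2)) \<noteq> 0\<close> by (simp add: diff_divide_distrib)
        finally show ?thesis by (simp only: \<phi>_def)
      qed
      ultimately show ?thesis by simp
    qed
    have "(\<lambda>\<omega>. \<Sum>i<n. complex_of_real (e \<omega> i) ^ Suc k) \<in> borel_measurable M"
      by (rule measurable_sum_of_pointwise_limit[OF A lim]) simp
    thus ?case using A by blast
  qed
  hence S: "(\<lambda>\<omega>. \<Sum>i<n. complex_of_real (e \<omega> i) ^ k) \<in> borel_measurable M" by blast
  have "Re \<in> borel_measurable borel" by measurable
  from measurable_compose[OF S this]
  have "(\<lambda>\<omega>. Re (\<Sum>i<n. complex_of_real (e \<omega> i) ^ k)) \<in> borel_measurable M" .
  thus ?thesis by (simp flip: of_real_power)
qed

text \<open>By Weierstrass, every continuous function is a pointwise limit of polynomials.\<close>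

lemma measurable_continuous_sums_of_power_sums:
  fixes e :: "'w \<Rightarrow> nat \<Rightarrow> real" and f :: "real \<Rightarrow> real"
  assumes pow: "\<And>k. (\<lambda>\<omega>. \<Sum>i<n. e \<omega> i ^ k) \<in> borel_measurable M" and f: "continuous_on UNIV f"
  shows "(\<lambda>\<omega>. \<Sum>i<n. f (e \<omega> i)) \<in> borel_measurable M"
proof -
  have poly: "(\<lambda>\<omega>. \<Sum>i<n. p (e \<omega> i)) \<in> borel_measurable M" if pp: "real_polynomial_function p" for p
  proof -
    obtain a m where p: "p = (\<lambda>x. \<Sum>j\<le>m. a j * x ^ j)"
      using pp unfolding real_polynomial_function_iff_sum by blast
    have "(\<Sum>i<n. p (e \<omega> i)) = (\<Sum>j\<le>m. a j * (\<Sum>i<n. e \<omega> i ^ j))" for \<omega>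
      unfolding p sum_distrib_left by (rule sum.swap)
    thus ?thesis using pow by simp
  qed
  have "\<exists>p. real_polynomial_function p \<and> (\<forall>x\<in>{- real k..real k}. \<bar>f x - p x\<bar> < inverse (real (Suc k)))" for k
    by (rule Stone_Weierstrass_real_polynomial_function[of "{- real k..real k}" f "inverse (real (Suc k))"])
      (auto intro: continuous_on_subset[OF f])
  then obtain p where p: "\<And>k. real_polynomial_function (p k)"
    "\<And>k x. x \<in> {- real k..real k} \<Longrightarrow> \<bar>f x - p k x\<bar> < inverse (real (Suc k))" by metis
  have "(\<lambda>k. p k x) \<longlonglongrightarrow> f x" for x
  proof -
    have "\<forall>\<^sub>F k in sequentially. \<bar>x\<bar> \<le> real k"
      by (rule eventually_sequentiallyI[of "nat \<lceil>\<bar>x\<bar>\<rceil>"]) linarith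
    hence "\<forall>\<^sub>F k in sequentially. norm (p k x - f x) \<le> inverse (real (Suc k))"
    proof eventually_elim
      case (elim k)
      hence "x \<in> {- real k..real k}" by auto
      from p(2)[OF this] show ?case by (simp add: abs_minus_commute)
    qed
    hence "(\<lambda>k. p k x - f x) \<longlonglongrightarrow> 0" by (rule Lim_null_comparison) (rule LIMSEQ_inverse_real_of_nat)
    thus ?thesis by (simp add: LIM_zero_iff)
  qed
  thus ?thesis
    by (intro measurable_sum_of_pointwise_limit[where f = p and g = f and e = e and n = n] poly p(1))
qed

text \<open>The indicator of an open half-line is a pointwise limit of continuous functions.\<close>

lemma measurable_counts_of_resolvent_sums:
  fixes e :: "'w \<Rightarrow> nat \<Rightarrow> real"
  assumes res: "\<And>y. 2 \<le> y \<Longrightarrow> (\<lambda>\<omega>. \<Sum>i<n. 1 / (Complex 0 y - of_real (e \<omega> i))) \<in> borel_measurable M"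
  shows "(\<lambda>\<omega>. \<Sum>i<n. indicator {a<..} (e \<omega> i) :: real) \<in> borel_measurable M"
proof (rule measurable_sum_of_pointwise_limit[where f = "\<lambda>k x. min 1 (real k * max 0 (x - a))"
      and g = "indicator {a<..}" and e = e])
  show "(\<lambda>\<omega>. \<Sum>i<n. min 1 (real k * max 0 (e \<omega> i - a))) \<in> borel_measurable M" for k
  proof (rule measurable_continuous_sums_of_power_sums[where f = "\<lambda>x. min 1 (real k * max 0 (x - a))"])
    show "(\<lambda>\<omega>. \<Sum>i<n. e \<omega> i ^ j) \<in> borel_measurable M" for j
      by (rule measurable_power_sums_of_resolvent_sums) (rule res)
  qed (intro continuous_intros)
  show "(\<lambda>k. min 1 (real k * max 0 (x - a))) \<longlonglongrightarrow> indicator {a<..} x" for x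
  proof (cases "a < x")
    case True
    have "\<forall>\<^sub>F k in sequentially. 1 / (x - a) \<le> real k"
      by (rule eventually_sequentiallyI[of "nat \<lceil>1 / (x - a)\<rceil>"]) linarith
    hence "\<forall>\<^sub>F k in sequentially. min 1 (real k * max 0 (x - a)) = indicator {a<..} x"
    proof eventually_elim
      case (elim k)
      hence "1 \<le> real k * (x - a)" using True by (simp add: pos_divide_le_eq)
      thus ?case using True by (simp add: max_absorb2 min_absorb1)
    qed
    thus ?thesis by (rule tendsto_eventually)
  qed simp
qed

text \<open>Matrices of a fixed size are identified with families of complex numbers indexed by all pairs,
  padded with \<open>0\<close>, to have a topology at hand.\<close>

definition entries :: "nat \<Rightarrow> complex mat \<Rightarrow> nat \<times> nat \<Rightarrow> complex" where
  "entries n A = (\<lambda>p. if p \<in> {..<n} \<times> {..<n} then A $$ p else 0)"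

text \<open>A retraction onto the Hermitian matrices: it extends functions of Hermitian matrices to all
  families, where continuity can be expressed.\<close>

definition hermitization :: "nat \<Rightarrow> (nat \<times> nat \<Rightarrow> complex) \<Rightarrow> complex mat" where
  "hermitization n f = mat n n (\<lambda>(i, j). (f (i, j) + cnj (f (j, i))) / 2)"

lemma hermitization_herm_mats: "hermitization n f \<in> herm_mats 2 n"
proof -
  have "hermitization n f $$ (i, j) = cnj (hermitization n f $$ (j, i))" if "i < n" "j < n" for i j
    using that by (simp add: hermitization_def add.commute)
  moreover have "hermitization n f \<in> carrier_mat n n" by (simp add: hermitization_def)
  moreover have "(2::nat) \<noteq> 1" by simp
  ultimately show ?thesis unfolding herm_mats_def by blast
qed

lemma hermitization_entries:
  assumes "A \<in> herm_mats \<beta> n"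
  shows "hermitization n (entries n A) = A"
  using herm_mats_carrier[OF assms]
  by (intro eq_matI) (auto simp: hermitization_def entries_def herm_mats_cnj[OF assms])

lemma continuous_on_of_coordinate_bound:
  fixes h :: "('i \<Rightarrow> complex) \<Rightarrow> 'b::real_normed_vector"
  assumes "finite I" and le: "\<And>f g. norm (h f - h g) \<le> K * (\<Sum>p\<in>I. cmod (f p - g p))"
  shows "continuous_on UNIV h"
  unfolding continuous_on
proof
  fix f :: "'i \<Rightarrow> complex"
  have "((\<lambda>g. g p) \<longlongrightarrow> f p) (at f)" for p
    using continuous_on_product_coordinates[of p] unfolding continuous_on by auto
  hence "((\<lambda>g. K * (\<Sum>p\<in>I. cmod (g p - f p))) \<longlongrightarrow> K * (\<Sum>p\<in>I. cmod (f p - f p))) (at f)"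
    by (intro tendsto_intros)
  hence "((\<lambda>g. K * (\<Sum>p\<in>I. cmod (g p - f p))) \<longlongrightarrow> 0) (at f)" by simp
  hence "((\<lambda>g. h g - h f) \<longlongrightarrow> 0) (at f)"
    by (rule Lim_null_comparison[rotated]) (simp add: le)
  thus "(h \<longlongrightarrow> h f) (at f within UNIV)" by (simp add: LIM_zero_iff)
qed

abbreviation mat_stieltjes :: "nat \<Rightarrow> complex \<Rightarrow> complex mat \<Rightarrow> complex" where
  "mat_stieltjes n z A \<equiv> stieltjes (normalized_spectral_measure n A) z"

text \<open>The bound with \<open>\<alpha> = 1\<close> is a Lipschitz estimate in the entries.\<close>

lemma continuous_on_stieltjes_hermitization:
  assumes z: "2 \<le> Im z" and n: "1 \<le> n"
  shows "continuous_on UNIV (\<lambda>f. mat_stieltjes n z (hermitization n f))"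
proof (rule continuous_on_of_coordinate_bound)
  fix f g :: "nat \<times> nat \<Rightarrow> complex"
  let ?I = "{..<n} \<times> {..<n}"
  let ?A = "hermitization n f" and ?B = "hermitization n g"
  define d where "d i j = cmod (f (i, j) - g (i, j))" for i j
  have d: "cmod ((?A - ?B) $$ (i, j)) \<le> d i j + d j i" if "i < n" "j < n" for i j
  proof -
    have "(?A - ?B) $$ (i, j) = (f (i, j) - g (i, j)) / 2 + cnj (f (j, i) - g (j, i)) / 2"
      using that by (simp add: hermitization_def field_simps)
    also have "cmod \<dots> \<le> d i j / 2 + d j i / 2"
      by (rule order_trans[OF norm_triangle_ineq])
        (simp only: norm_divide complex_mod_cnj d_def norm_numeral order.refl)
    also have "\<dots> \<le> d i j + d j i"
    proof -
      have "0 \<le> d i j" "0 \<le> d j i" by (simp_all add: d_def)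
      thus ?thesis by linarith
    qed
    finally show ?thesis .
  qed
  have "cmod (mat_stieltjes n z ?A - mat_stieltjes n z ?B)
      \<le> 2 * real n powr (- 1 - 1 / 2) * (\<Sum>i<n. \<Sum>j<n. cmod ((?A - ?B) $$ (i, j)) powr 1)"
    by (rule stieltjes_diff_le_quasinorm[OF hermitization_herm_mats hermitization_herm_mats z _ _ n]) auto
  also have "\<dots> \<le> 2 * real n powr (- 1 - 1 / 2) * (\<Sum>i<n. \<Sum>j<n. d i j + d j i)"
    using d by (intro mult_left_mono sum_mono) auto
  also have "(\<Sum>i<n. \<Sum>j<n. d i j + d j i) = 2 * (\<Sum>i<n. \<Sum>j<n. d i j)"
    using sum.swap[of "\<lambda>i j. d j i" "{..<n}" "{..<n}"] by (simp add: sum.distrib)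
  also have "(\<Sum>i<n. \<Sum>j<n. d i j) = (\<Sum>p\<in>?I. cmod (f p - g p))"
    by (simp add: d_def sum.cartesian_product)
  finally show "cmod (mat_stieltjes n z ?A - mat_stieltjes n z ?B)
      \<le> (4 * real n powr (- 1 - 1 / 2)) * (\<Sum>p\<in>?I. cmod (f p - g p))"
    by simp
qed simp

lemma measurable_entries: "entries n \<in> borel_measurable (herm_borel \<beta> n)"
proof (rule measurable_coordinatewise_then_product)
  fix p :: "nat \<times> nat"
  let ?I = "{..<n} \<times> {..<n}" and ?N = "PiM ({..<n} \<times> {..<n}) (\<lambda>_. borel :: complex measure)"
  show "(\<lambda>A. entries n A p) \<in> borel_measurable (herm_borel \<beta> n)"
  proof (cases "p \<in> ?I")
    case True
    have "(\<lambda>A. \<lambda>p\<in>?I. A $$ p) \<in> measurable (herm_borel \<beta> n) ?N"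
      unfolding herm_borel_def by (rule measurable_vimage_algebra1) (auto simp: space_PiM)
    hence "(\<lambda>A. (\<lambda>p\<in>?I. A $$ p) p) \<in> borel_measurable (herm_borel \<beta> n)"
      using measurable_component_singleton[OF True] by (rule measurable_compose)
    thus ?thesis using True by (simp add: entries_def)
  next
    case False
    thus ?thesis by (simp add: entries_def)
  qed
qed

lemma space_herm_borel [simp]: "space (herm_borel \<beta> n) = herm_mats \<beta> n"
  by (simp add: herm_borel_def)

lemma measurable_mat_stieltjes:
  assumes z: "2 \<le> Im z" and n: "1 \<le> n"
  shows "mat_stieltjes n z \<in> borel_measurable (herm_borel \<beta> n)"
proof -
  have "(\<lambda>A. mat_stieltjes n z (hermitization n (entries n A))) \<in> borel_measurable (herm_borel \<beta> n)"
    by (rule measurable_compose[OF measurable_entries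
          borel_measurable_continuous_onI[OF continuous_on_stieltjes_hermitization[OF z n]]])
  thus ?thesis
    by (rule measurable_cong[THEN iffD1, rotated]) (simp add: hermitization_entries)
qed

text \<open>This makes the Giry bind in the mean spectral measure meaningful. It is enough to measure open
  half-lines, that is, to count eigenvalues beyond a point, and those counts are obtained from the
  Stieltjes transforms, which are continuous in the matrix.\<close>

lemma measurable_normalized_spectral_measure:
  assumes n: "1 \<le> n"
  shows "normalized_spectral_measure n \<in> herm_borel \<beta> n \<rightarrow>\<^sub>M prob_algebra borel"
proof (rule measurable_prob_algebra_generated[where \<Omega> = UNIV and G = "range (\<lambda>a. {a<..})"])
  show "sets borel = sigma_sets UNIV (range (\<lambda>a::real. {a<..}))"
    by (subst borel_Ioi) simp
  show "Int_stable (range (\<lambda>a::real. {a<..}))"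
  proof (rule Int_stableI)
    fix S T assume "S \<in> range (\<lambda>a::real. {a<..})" "T \<in> range (\<lambda>a::real. {a<..})"
    then obtain a b where "S = {a<..}" "T = {b<..}" by blast
    hence "S \<inter> T = {max a b<..}" by auto
    thus "S \<inter> T \<in> range (\<lambda>a::real. {a<..})" by blast
  qed
  show "prob_space (normalized_spectral_measure n A)" for A
    unfolding normalized_spectral_measure_def by (rule prob_space_spectral_measure)
  show "sets (normalized_spectral_measure n A) = sets borel" for A
    unfolding normalized_spectral_measure_def by simp
  fix S :: "real set" assume "S \<in> range (\<lambda>a. {a<..})"
  then obtain a where S: "S = {a<..}" by blast
  let ?e = "\<lambda>A i. Re (eigvals (scaled n A) ! i)"
  have res: "(\<lambda>A. \<Sum>i<n. 1 / (Complex 0 y - of_real (?e A i))) \<in> borel_measurable (herm_borel \<beta> n)"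
    if y: "2 \<le> y" for y
  proof -
    have "(\<lambda>A. of_nat n * mat_stieltjes n (Complex 0 y) A) \<in> borel_measurable (herm_borel \<beta> n)"
      using measurable_mat_stieltjes[of "Complex 0 y" n \<beta>] y n by simp
    thus ?thesis
    proof (rule measurable_cong[THEN iffD1, rotated])
      fix A assume "A \<in> space (herm_borel \<beta> n)"
      hence A: "A \<in> herm_mats \<beta> n" by simp
      show "of_nat n * mat_stieltjes n (Complex 0 y) A = (\<Sum>i<n. 1 / (Complex 0 y - of_real (?e A i)))"
        using y n trace_res_eq_sum_eigvals[OF real_smult_herm_mats[OF A, of "1 / sqrt (real n)"], of "Complex 0 y"]
        by (simp add: stieltjes_normalized_spectral_measure[OF A n])
    qed
  qed
  have "(\<lambda>A. ennreal ((1 / real n) * (\<Sum>i<n. indicator {a<..} (?e A i)))) \<in> borel_measurable (herm_borel \<beta> n)"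
    using measurable_counts_of_resolvent_sums[OF res] by simp
  thus "(\<lambda>A. emeasure (normalized_spectral_measure n A) S) \<in> borel_measurable (herm_borel \<beta> n)"
  proof (rule measurable_cong[THEN iffD1, rotated])
    fix A assume "A \<in> space (herm_borel \<beta> n)"
    hence A: "scaled n A \<in> carrier_mat n n"
      using herm_mats_carrier[OF real_smult_herm_mats[of A \<beta> n "1 / sqrt (real n)"]] by simp
    interpret P: prob_space "spectral_measure (scaled n A)" by (rule prob_space_spectral_measure)
    have "measure (spectral_measure (scaled n A)) S = (\<integral>x. indicator S x \<partial>spectral_measure (scaled n A))"
      by (simp add: S)
    also have "\<dots> = (1 / real n) * (\<Sum>i<n. indicator S (?e A i))"
      using integral_spectral_measure[OF A n, of "indicator S :: real \<Rightarrow> real"] by (simp add: S)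
    finally show "ennreal ((1 / real n) * (\<Sum>i<n. indicator {a<..} (?e A i)))
        = emeasure (normalized_spectral_measure n A) S"
      by (simp only: normalized_spectral_measure_def P.emeasure_eq_measure S)
  qed
qed auto

text \<open>The Stieltjes transform is linear in the measure, so it commutes with taking means.\<close>

lemma mean_spectral_measure:
  assumes M: "prob_space M" and X: "X \<in> M \<rightarrow>\<^sub>M herm_borel \<beta> n" and n: "1 \<le> n" and z: "2 \<le> Im z"
  shows "prob_space (mean_spectral_measure n M X)"
    and "sets (mean_spectral_measure n M X) = sets borel"
    and "stieltjes (mean_spectral_measure n M X) z = (\<integral>\<omega>. mat_stieltjes n z (X \<omega>) \<partial>M)"
proof -
  interpret prob_space M by (rule M)
  let ?N = "\<lambda>\<omega>. normalized_spectral_measure n (X \<omega>)"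
  have N: "?N \<in> M \<rightarrow>\<^sub>M prob_algebra borel"
    by (rule measurable_compose[OF X measurable_normalized_spectral_measure[OF n]])
  hence N': "?N \<in> M \<rightarrow>\<^sub>M subprob_algebra borel" by (rule measurable_prob_algebraD)
  have p: "prob_space (?N \<omega>)" for \<omega>
    unfolding normalized_spectral_measure_def by (rule prob_space_spectral_measure)
  have s: "sets (?N \<omega>) = sets borel" for \<omega>
    unfolding normalized_spectral_measure_def by simp
  show P: "prob_space (mean_spectral_measure n M X)"
    unfolding mean_spectral_measure_def by (rule prob_space_bind[OF _ N']) (simp add: p)
  show S: "sets (mean_spectral_measure n M X) = sets borel"
    unfolding mean_spectral_measure_def by (rule sets_bind[OF s not_empty])
  let ?f = "\<lambda>x. 1 / (z - complex_of_real x)"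
  have f: "?f \<in> borel_measurable borel" by measurable
  have bd: "cmod (?f x) \<le> 1" for x
  proof -
    have "2 \<le> cmod (z - complex_of_real x)" using z abs_Im_le_cmod[of "z - complex_of_real x"] by simp
    hence "1 / cmod (z - complex_of_real x) \<le> 1 / 1" by (intro divide_left_mono) auto
    thus ?thesis by (simp add: norm_divide)
  qed
  have int: "integrable \<mu> ?f" if "prob_space \<mu>" "sets \<mu> = sets borel" for \<mu>
  proof -
    interpret \<mu>: prob_space \<mu> by fact
    have "?f \<in> borel_measurable \<mu>" using f by (simp add: measurable_cong_sets[OF that(2) refl])
    thus ?thesis using bd by (intro \<mu>.integrable_const_bound[of _ 1]) auto
  qed
  have st: "mat_stieltjes n z \<in> borel_measurable (herm_borel \<beta> n)"
    by (rule measurable_mat_stieltjes[OF z n])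
  have cb: "cmod (mat_stieltjes n z (X \<omega>)) \<le> 1" for \<omega>
  proof -
    interpret \<mu>: prob_space "?N \<omega>" by (rule p)
    have "cmod (mat_stieltjes n z (X \<omega>)) \<le> (\<integral>x. cmod (?f x) \<partial>?N \<omega>)"
      unfolding stieltjes_def by (rule integral_norm_bound)
    also have "\<dots> \<le> (\<integral>x. 1 \<partial>?N \<omega>)" using int[OF p s] bd by (intro integral_mono) auto
    also have "\<dots> = 1" by (simp add: \<mu>.prob_space)
    finally show ?thesis .
  qed
  have intX: "integrable M (\<lambda>\<omega>. mat_stieltjes n z (X \<omega>))"
    using cb measurable_compose[OF X st] by (intro integrable_const_bound[of _ 1]) auto
  have part: "(\<integral>x. g x \<partial>mean_spectral_measure n M X) = (\<integral>\<omega>. (\<integral>x. g x \<partial>?N \<omega>) \<partial>M)"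
    if "g \<in> borel_measurable borel" "\<And>x. \<bar>g x\<bar> \<le> 1" for g :: "real \<Rightarrow> real"
    unfolding mean_spectral_measure_def
    by (rule integral_bind[where B = 1 and B' = 1, OF that(1) _ N' finite_measure_axioms])
      (auto simp: that(2) prob_space.emeasure_space_1[OF p])
  have bRe: "\<bar>Re (?f x)\<bar> \<le> 1" and bIm: "\<bar>Im (?f x)\<bar> \<le> 1" for x
    using bd[of x] abs_Re_le_cmod[of "?f x"] abs_Im_le_cmod[of "?f x"] by linarith+
  have "Re (stieltjes (mean_spectral_measure n M X) z) = (\<integral>x. Re (?f x) \<partial>mean_spectral_measure n M X)"
    unfolding stieltjes_def by (simp only: integral_Re[OF int[OF P S]])
  also have "\<dots> = (\<integral>\<omega>. (\<integral>x. Re (?f x) \<partial>?N \<omega>) \<partial>M)"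
    using f bRe by (intro part) auto
  also have "\<dots> = (\<integral>\<omega>. Re (mat_stieltjes n z (X \<omega>)) \<partial>M)"
    unfolding stieltjes_def by (simp only: integral_Re[OF int[OF p s]])
  also have "\<dots> = Re (\<integral>\<omega>. mat_stieltjes n z (X \<omega>) \<partial>M)" by (rule integral_Re[OF intX])
  finally have 1: "Re (stieltjes (mean_spectral_measure n M X) z) = Re (\<integral>\<omega>. mat_stieltjes n z (X \<omega>) \<partial>M)" .
  have "Im (stieltjes (mean_spectral_measure n M X) z) = (\<integral>x. Im (?f x) \<partial>mean_spectral_measure n M X)"
    unfolding stieltjes_def by (simp only: integral_Im[OF int[OF P S]])
  also have "\<dots> = (\<integral>\<omega>. (\<integral>x. Im (?f x) \<partial>?N \<omega>) \<partial>M)"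
    using f bIm by (intro part) auto
  also have "\<dots> = (\<integral>\<omega>. Im (mat_stieltjes n z (X \<omega>)) \<partial>M)"
    unfolding stieltjes_def by (simp only: integral_Im[OF int[OF p s]])
  also have "\<dots> = Im (\<integral>\<omega>. mat_stieltjes n z (X \<omega>) \<partial>M)" by (rule integral_Im[OF intX])
  finally have 2: "Im (stieltjes (mean_spectral_measure n M X) z) = Im (\<integral>\<omega>. mat_stieltjes n z (X \<omega>) \<partial>M)" .
  from 1 2 show "stieltjes (mean_spectral_measure n M X) z = (\<integral>\<omega>. mat_stieltjes n z (X \<omega>) \<partial>M)"
    by (simp add: complex_eq_iff)
qed

text \<open>The integrand \<open>1 / (z - x)\<close> is at most \<open>1 / 2\<close> in absolute value, and its derivative in \<open>z\<close> is at
  most \<open>1 / 4\<close>.\<close>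

lemma stieltjes_bounds:
  assumes \<mu>: "prob_space \<mu>" "sets \<mu> = sets borel" and z: "2 \<le> Im z" and w: "2 \<le> Im w"
  shows "cmod (stieltjes \<mu> z) \<le> 1 / 2"
    and "cmod (stieltjes \<mu> z - stieltjes \<mu> w) \<le> cmod (z - w) / 4"
proof -
  interpret prob_space \<mu> by fact
  have ge: "2 \<le> cmod (u - complex_of_real x)" if "2 \<le> Im u" for u x
    using that abs_Im_le_cmod[of "u - complex_of_real x"] by simp
  have bd: "cmod (1 / (u - complex_of_real x)) \<le> 1 / 2" if "2 \<le> Im u" for u x
  proof -
    have "1 / cmod (u - complex_of_real x) \<le> 1 / 2"
      using ge[OF that, of x] by (intro divide_left_mono) auto
    thus ?thesis by (simp add: norm_divide)
  qed
  have meas: "(\<lambda>x. 1 / (u - complex_of_real x)) \<in> borel_measurable \<mu>" for u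
    by (subst measurable_cong_sets[OF \<mu>(2) refl]) measurable
  have int: "integrable \<mu> (\<lambda>x. 1 / (u - complex_of_real x))" if "2 \<le> Im u" for u
    using bd[OF that] meas by (intro integrable_const_bound[of _ "1 / 2"]) auto
  have le: "cmod (\<integral>x. h x \<partial>\<mu>) \<le> c" if "integrable \<mu> h" "\<And>x. cmod (h x) \<le> c" for h :: "real \<Rightarrow> complex" and c
  proof -
    have "cmod (\<integral>x. h x \<partial>\<mu>) \<le> (\<integral>x. cmod (h x) \<partial>\<mu>)" by (rule integral_norm_bound)
    also have "\<dots> \<le> (\<integral>x. c \<partial>\<mu>)" using that by (intro integral_mono) auto
    also have "\<dots> = c" by (simp add: prob_space)
    finally show ?thesis .
  qed
  show "cmod (stieltjes \<mu> z) \<le> 1 / 2"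
    unfolding stieltjes_def by (rule le[OF int[OF z] bd[OF z]])
  have "stieltjes \<mu> z - stieltjes \<mu> w
      = (\<integral>x. 1 / (z - complex_of_real x) - 1 / (w - complex_of_real x) \<partial>\<mu>)"
    unfolding stieltjes_def by (rule Bochner_Integration.integral_diff[OF int[OF z] int[OF w], symmetric])
  also have "cmod \<dots> \<le> cmod (z - w) / 4"
  proof (rule le[OF Bochner_Integration.integrable_diff[OF int[OF z] int[OF w]]])
    fix x
    let ?a = "z - complex_of_real x" and ?b = "w - complex_of_real x"
    have nz: "?a \<noteq> 0" "?b \<noteq> 0" using ge[OF z, of x] ge[OF w, of x] by auto
    have "1 / ?a - 1 / ?b = (w - z) / (?a * ?b)" using nz by (simp add: field_simps)
    hence "cmod (1 / ?a - 1 / ?b) = cmod (z - w) / (cmod ?a * cmod ?b)"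
      by (simp add: norm_divide norm_mult norm_minus_commute)
    also have "\<dots> \<le> cmod (z - w) / (2 * 2)"
      using ge[OF z, of x] ge[OF w, of x] by (intro divide_left_mono mult_mono) (auto intro!: mult_pos_pos)
    finally show "cmod (1 / ?a - 1 / ?b) \<le> cmod (z - w) / 4" by simp
  qed
  finally show "cmod (stieltjes \<mu> z - stieltjes \<mu> w) \<le> cmod (z - w) / 4" .
qed

section \<open>From concentration of sets to concentration of functions\<close>

text \<open>Counting the integers up to \<open>x\<close> recovers \<open>x\<close> up to rounding; in expectation this bounds a mean
  by a sum of tail probabilities.\<close>

lemma le_one_plus_count:
  fixes x :: real
  assumes "x \<le> real N + 1"
  shows "x \<le> 1 + (\<Sum>k=1..N. if real k \<le> x then 1 else 0)"
  using assms
proof (induction N)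
  case (Suc N)
  show ?case
  proof (cases "x \<le> real N + 1")
    case True
    with Suc.IH show ?thesis by simp
  next
    case False
    hence "(\<Sum>k=1..Suc N. if real k \<le> x then 1 else 0) = (\<Sum>k=1..Suc N. 1 :: real)"
      by (intro sum.cong) auto
    thus ?thesis using Suc.prems by simp
  qed
qed simp

lemma sum_exp_minus_le_one: "(\<Sum>k=1..N. exp (- real k)) \<le> 1"
proof -
  have e: "exp (- 1 :: real) \<le> 1 / 2"
    using exp_ge_add_one_self[of "1::real"] by (simp add: exp_minus field_simps)
  have "(\<Sum>k=1..N. exp (- real k)) \<le> (\<Sum>k=1..N. (1 / 2) ^ k)"
  proof (rule sum_mono)
    fix k
    have "exp (- real k) = exp (- 1) ^ k" by (simp flip: exp_of_nat_mult)
    also have "\<dots> \<le> (1 / 2) ^ k" by (rule power_mono[OF e]) simp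
    finally show "exp (- real k) \<le> (1 / 2) ^ k" .
  qed
  also have "\<dots> = 1 - (1 / 2 :: real) ^ N" by (induction N) auto
  also have "\<dots> \<le> 1" by simp
  finally show ?thesis .
qed

text \<open>Let \<open>m\<close> be a median. Both one-sided hypotheses apply at \<open>m\<close> up to an error, which is chosen to be
  \<open>L s\<close> itself; this explains the factor \<open>2\<close> in front of \<open>L s\<close>. Integrating the resulting exponential
  tail shows that the mean is within \<open>20 * a\<close> of \<open>m\<close>, so that the median may be replaced by the
  mean.\<close>

lemma (in prob_space) concentration_about_expectation:
  fixes U :: "'a \<Rightarrow> real"
  assumes U: "U \<in> borel_measurable M" and bd: "\<And>\<omega>. \<omega> \<in> space M \<Longrightarrow> \<bar>U \<omega>\<bar> \<le> 1"
    and L: "\<And>s. 0 < s \<Longrightarrow> 0 < L s" and La: "\<And>s. 0 < s \<Longrightarrow> L s \<le> a * (1 + s)"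
    and up: "\<And>s m. 0 < s \<Longrightarrow> 1 / 2 \<le> prob {\<omega> \<in> space M. U \<omega> < m} \<Longrightarrow>
      prob {\<omega> \<in> space M. m + L s \<le> U \<omega>} \<le> 4 * exp (- s)"
    and down: "\<And>s m. 0 < s \<Longrightarrow> 1 / 2 \<le> prob {\<omega> \<in> space M. m < U \<omega>} \<Longrightarrow>
      prob {\<omega> \<in> space M. U \<omega> \<le> m - L s} \<le> 4 * exp (- s)"
    and s: "0 < s"
  shows "prob {\<omega> \<in> space M. 2 * L s + 20 * a \<le> \<bar>U \<omega> - expectation U\<bar>} \<le> 8 * exp (- s)"
proof -
  note [measurable] = U
  have a: "0 < a" using L[of 1] La[of 1] by simp
  \<comment> \<open>Taking \<open>m\<close> as this infimum yields a median without any continuity of the distribution function.\<close>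
  define S where "S = {x. 1 / 2 \<le> prob {\<omega> \<in> space M. U \<omega> \<le> x}}"
  define m where "m = Inf S"
  have "{\<omega> \<in> space M. U \<omega> \<le> 1} = space M"
    using bd by (auto simp: abs_le_iff)
  hence S1: "1 \<in> S" by (simp add: S_def prob_space)
  have Sm: "- 1 \<le> x" if "x \<in> S" for x
  proof (rule ccontr)
    assume "\<not> - 1 \<le> x"
    hence "{\<omega> \<in> space M. U \<omega> \<le> x} = {}" using bd by (force simp: abs_le_iff)
    hence "prob {\<omega> \<in> space M. U \<omega> \<le> x} = 0" by (simp only: measure_empty)
    thus False using \<open>x \<in> S\<close> by (simp add: S_def)
  qed
  have Sb: "bdd_below S" using Sm by (rule bdd_belowI)
  have lo: "1 / 2 \<le> prob {\<omega> \<in> space M. U \<omega> < m + \<epsilon>}" if "0 < \<epsilon>" for \<epsilon>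
  proof -
    have "Inf S < m + \<epsilon>" using that by (simp add: m_def)
    then obtain x where x: "x \<in> S" "x < m + \<epsilon>" using cInf_lessD[of S "m + \<epsilon>"] S1 by blast
    hence "prob {\<omega> \<in> space M. U \<omega> \<le> x} \<le> prob {\<omega> \<in> space M. U \<omega> < m + \<epsilon>}"
      by (intro finite_measure_mono) auto
    thus ?thesis using x by (simp add: S_def)
  qed
  have hi: "1 / 2 \<le> prob {\<omega> \<in> space M. m - \<epsilon> < U \<omega>}" if "0 < \<epsilon>" for \<epsilon>
  proof -
    have "m - \<epsilon> \<notin> S" using cInf_lower[OF _ Sb, of "m - \<epsilon>"] that by (auto simp: m_def)
    hence "prob {\<omega> \<in> space M. U \<omega> \<le> m - \<epsilon>} < 1 / 2" by (simp add: S_def)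
    moreover have "prob {\<omega> \<in> space M. \<not> U \<omega> \<le> m - \<epsilon>} = 1 - prob {\<omega> \<in> space M. U \<omega> \<le> m - \<epsilon>}"
      by (rule prob_neg) measurable
    ultimately show ?thesis by (simp add: not_le)
  qed
  have med: "prob {\<omega> \<in> space M. 2 * L s \<le> \<bar>U \<omega> - m\<bar>} \<le> 8 * exp (- s)" if s: "0 < s" for s
  proof -
    have "prob {\<omega> \<in> space M. 2 * L s \<le> \<bar>U \<omega> - m\<bar>}
        \<le> prob ({\<omega> \<in> space M. (m + L s) + L s \<le> U \<omega>} \<union> {\<omega> \<in> space M. U \<omega> \<le> (m - L s) - L s})"
      by (intro finite_measure_mono) auto
    also have "\<dots> \<le> prob {\<omega> \<in> space M. (m + L s) + L s \<le> U \<omega>}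
        + prob {\<omega> \<in> space M. U \<omega> \<le> (m - L s) - L s}"
      by (rule measure_Un_le) measurable
    also have "\<dots> \<le> 4 * exp (- s) + 4 * exp (- s)"
      using up[OF s lo[OF L[OF s]]] down[OF s hi[OF L[OF s]]] by (rule add_mono)
    finally show ?thesis by simp
  qed
  have m1: "\<bar>m\<bar> \<le> 1"
  proof -
    have "- 1 \<le> m" unfolding m_def
      by (rule cInf_greatest) (use S1 Sm in auto)
    moreover have "m \<le> 1" unfolding m_def by (rule cInf_lower[OF S1 Sb])
    ultimately show ?thesis by simp
  qed
  \<comment> \<open>As \<open>U\<close> is bounded, a finite number of tail events suffices.\<close>
  obtain N where N: "2 / (2 * a) \<le> real N" using real_arch_simple by blast
  define I where "I k \<omega> = (if 2 * a * (1 + real k) \<le> \<bar>U \<omega> - m\<bar> then 1 else 0 :: real)" for k \<omega>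
  have I_int: "integrable M (I k)" for k
    unfolding I_def by (rule integrable_const_bound[of _ 1]) auto
  have I_le: "expectation (I k) \<le> 8 * exp (- real k)" if "1 \<le> k" for k
  proof -
    have "expectation (I k) = expectation (indicator {\<omega> \<in> space M. 2 * a * (1 + real k) \<le> \<bar>U \<omega> - m\<bar>})"
      by (intro Bochner_Integration.integral_cong) (auto simp: I_def indicator_def)
    also have "\<dots> = prob {\<omega> \<in> space M. 2 * a * (1 + real k) \<le> \<bar>U \<omega> - m\<bar>}" by simp
    also have "\<dots> \<le> prob {\<omega> \<in> space M. 2 * L (real k) \<le> \<bar>U \<omega> - m\<bar>}"
      using La[of "real k"] that by (intro finite_measure_mono) (auto simp: mult.assoc)
    also have "\<dots> \<le> 8 * exp (- real k)" using that by (intro med) simp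
    finally show ?thesis .
  qed
  have U_int: "integrable M U" using bd by (intro integrable_const_bound[of _ 1]) auto
  have dev: "expectation (\<lambda>\<omega>. \<bar>U \<omega> - m\<bar>) \<le> 20 * a"
  proof -
    have "expectation (\<lambda>\<omega>. \<bar>U \<omega> - m\<bar>) \<le> expectation (\<lambda>\<omega>. 4 * a + 2 * a * (\<Sum>k=1..N. I k \<omega>))"
    proof (rule integral_mono)
      fix \<omega> assume w: "\<omega> \<in> space M"
      let ?x = "\<bar>U \<omega> - m\<bar> / (2 * a) - 1"
      have "\<bar>U \<omega> - m\<bar> \<le> 2" using bd[OF w] m1 by linarith
      hence "\<bar>U \<omega> - m\<bar> / (2 * a) \<le> 2 / (2 * a)" using a by (intro divide_right_mono) auto
      hence "?x \<le> real N + 1" using N by linarith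
      hence "?x \<le> 1 + (\<Sum>k=1..N. if real k \<le> ?x then 1 else 0)" by (rule le_one_plus_count)
      also have "(\<Sum>k=1..N. if real k \<le> ?x then 1 else 0) = (\<Sum>k=1..N. I k \<omega>)"
        using a by (intro sum.cong) (auto simp: I_def field_simps)
      finally show "\<bar>U \<omega> - m\<bar> \<le> 4 * a + 2 * a * (\<Sum>k=1..N. I k \<omega>)"
        using a by (simp add: field_simps)
    qed (use U_int I_int in auto)
    also have "\<dots> = 4 * a + 2 * a * (\<Sum>k=1..N. expectation (I k))"
      using I_int by (simp add: prob_space)
    also have "\<dots> \<le> 4 * a + 2 * a * (\<Sum>k=1..N. 8 * exp (- real k))"
      using a I_le by (intro add_left_mono mult_left_mono sum_mono) auto
    also have "\<dots> = 4 * a + 16 * a * (\<Sum>k=1..N. exp (- real k))" by (simp add: sum_distrib_left mult_ac)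
    also have "\<dots> \<le> 4 * a + 16 * a * 1"
      using a by (intro add_left_mono mult_left_mono sum_exp_minus_le_one) auto
    finally show ?thesis by simp
  qed
  have "expectation U - m = expectation (\<lambda>\<omega>. U \<omega> - m)" using U_int by (simp add: prob_space)
  hence "\<bar>expectation U - m\<bar> \<le> expectation (\<lambda>\<omega>. \<bar>U \<omega> - m\<bar>)"
    using integral_norm_bound[of M "\<lambda>\<omega>. U \<omega> - m"] by simp
  hence Em: "\<bar>expectation U - m\<bar> \<le> 20 * a" using dev by linarith
  have "prob {\<omega> \<in> space M. 2 * L s + 20 * a \<le> \<bar>U \<omega> - expectation U\<bar>}
      \<le> prob {\<omega> \<in> space M. 2 * L s \<le> \<bar>U \<omega> - m\<bar>}"
    using Em by (intro finite_measure_mono) auto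
  also have "\<dots> \<le> 8 * exp (- s)" by (rule med[OF s])
  finally show ?thesis .
qed

lemma herm_mats_real:
  assumes "A \<in> herm_mats 1 n" "i < n" "j < n"
  shows "A $$ (i, j) \<in> \<real>"
  using assms unfolding herm_mats_def by blast

lemma herm_mats_add:
  assumes A: "A \<in> herm_mats \<beta> n" and B: "B \<in> herm_mats \<beta> n"
  shows "A + B \<in> herm_mats \<beta> n"
proof -
  have e: "(A + B) $$ (i, j) = A $$ (i, j) + B $$ (i, j)" if "i < n" "j < n" for i j
    using herm_mats_carrier[OF B] that by simp
  have "(A + B) $$ (i, j) = cnj ((A + B) $$ (j, i))" if "i < n" "j < n" for i j
    using that by (simp add: e herm_mats_cnj[OF A] herm_mats_cnj[OF B])
  moreover have "(A + B) $$ (i, j) \<in> \<real>" if "\<beta> = 1" "i < n" "j < n" for i j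
    using herm_mats_real[OF A[unfolded that(1)] that(2,3)] herm_mats_real[OF B[unfolded that(1)] that(2,3)]
    by (simp add: e that(2,3))
  moreover have "A + B \<in> carrier_mat n n" using herm_mats_carrier[OF B] by simp
  ultimately show ?thesis unfolding herm_mats_def by blast
qed

lemma herm_mats_diff:
  assumes A: "A \<in> herm_mats \<beta> n" and B: "B \<in> herm_mats \<beta> n"
  shows "A - B \<in> herm_mats \<beta> n"
proof -
  have "A - B = A + complex_of_real (- 1) \<cdot>\<^sub>m B"
    using herm_mats_carrier[OF A] herm_mats_carrier[OF B] by (intro eq_matI) auto
  thus ?thesis using herm_mats_add[OF A real_smult_herm_mats[OF B, of "- 1"]] by simp
qed

text \<open>Strict sublevel sets of continuous functions are open, and a Minkowski sum with an open set is a
  union of open translates, hence open.\<close>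

lemma sets_enlarged_sublevel:
  assumes v: "continuous_on UNIV v" and S: "S \<subseteq> herm_mats \<beta> n" "T \<subseteq> herm_mats \<beta> n"
  shows "{Y \<in> herm_mats \<beta> n. v (entries n Y) < (m::real)} + S + T \<in> sets (herm_borel \<beta> n)"
proof -
  let ?A = "{Y \<in> herm_mats \<beta> n. v (entries n Y) < m}"
  let ?V = "\<Union>D\<in>S. \<Union>E\<in>T. {f. v (\<lambda>p. f p - entries n D p - entries n E p) < m}"
  have "open ?V"
  proof (intro open_UN ballI)
    fix D E
    have "continuous_on UNIV (\<lambda>f. v (\<lambda>p. f p - entries n D p - entries n E p))"
      by (rule continuous_on_compose2[OF v])
        (auto intro!: continuous_on_coordinatewise_then_product continuous_intros)
    thus "open {f. v (\<lambda>p. f p - entries n D p - entries n E p) < m}"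
      by (intro open_Collect_less continuous_on_const)
  qed
  hence "entries n -` ?V \<inter> space (herm_borel \<beta> n) \<in> sets (herm_borel \<beta> n)"
    by (intro measurable_sets[OF measurable_entries] borel_open)
  also have "entries n -` ?V \<inter> space (herm_borel \<beta> n) = ?A + S + T"
  proof (rule Set.set_eqI, rule iffI)
    fix Y assume "Y \<in> entries n -` ?V \<inter> space (herm_borel \<beta> n)"
    then obtain D E where Y: "Y \<in> herm_mats \<beta> n" and D: "D \<in> S" and E: "E \<in> T"
      and lt: "v (\<lambda>p. entries n Y p - entries n D p - entries n E p) < m" by auto
    have D': "D \<in> herm_mats \<beta> n" and E': "E \<in> herm_mats \<beta> n" using D E S by auto
    let ?Z = "Y - D - E"
    have Z: "?Z \<in> herm_mats \<beta> n" by (intro herm_mats_diff Y D' E')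
    have "entries n ?Z = (\<lambda>p. entries n Y p - entries n D p - entries n E p)"
      using herm_mats_carrier[OF Y] herm_mats_carrier[OF D'] herm_mats_carrier[OF E']
      by (auto simp: entries_def)
    hence "?Z \<in> ?A" using Z lt by simp
    moreover have "Y = ?Z + D + E"
      using herm_mats_carrier[OF Y] herm_mats_carrier[OF D'] herm_mats_carrier[OF E']
      by (intro eq_matI) auto
    ultimately show "Y \<in> ?A + S + T" using D E by (metis set_plus_intro)
  next
    fix Y assume "Y \<in> ?A + S + T"
    then obtain Z D E where Z: "Z \<in> ?A" and D: "D \<in> S" and E: "E \<in> T" and Y: "Y = Z + D + E"
      by (auto simp: set_plus_def)
    have Z': "Z \<in> herm_mats \<beta> n" and D': "D \<in> herm_mats \<beta> n" and E': "E \<in> herm_mats \<beta> n"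
      using Z D E S by auto
    have "(\<lambda>p. entries n Y p - entries n D p - entries n E p) = entries n Z"
      using herm_mats_carrier[OF Z'] herm_mats_carrier[OF D'] herm_mats_carrier[OF E']
      by (auto simp: entries_def Y)
    hence "v (\<lambda>p. entries n Y p - entries n D p - entries n E p) < m" using Z by simp
    hence "entries n Y \<in> ?V" using D E by blast
    moreover have "Y \<in> herm_mats \<beta> n" unfolding Y by (intro herm_mats_add Z' D' E')
    ultimately show "Y \<in> entries n -` ?V \<inter> space (herm_borel \<beta> n)" by simp
  qed
  finally show ?thesis .
qed

text \<open>The event that \<open>X\<close> misses the enlarged sublevel set is measurable, so the completed measure
  agrees with the original one on it; and a function that increases by at most \<open>r\<close> under the shifts
  stays below \<open>m + r\<close> on the enlargement.\<close>

lemma (in prob_space) prob_exceed_le_of_enlargement: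
  assumes X: "X \<in> M \<rightarrow>\<^sub>M herm_borel \<beta> n"
    and v: "continuous_on UNIV v" and S: "S \<subseteq> herm_mats \<beta> n" "T \<subseteq> herm_mats \<beta> n"
    and lip: "\<And>Z D E. Z \<in> herm_mats \<beta> n \<Longrightarrow> D \<in> S \<Longrightarrow> E \<in> T \<Longrightarrow>
      v (entries n (Z + D + E)) \<le> v (entries n Z) + r"
    and le: "measure (completion M)
      {\<omega> \<in> space M. X \<omega> \<notin> {Y \<in> herm_mats \<beta> n. v (entries n Y) < (m::real)} + S + T} \<le> b"
  shows "prob {\<omega> \<in> space M. m + r \<le> v (entries n (X \<omega>))} \<le> b"
proof -
  let ?B = "{Y \<in> herm_mats \<beta> n. v (entries n Y) < m} + S + T"
  have "X -` ?B \<inter> space M \<in> sets M"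
    by (rule measurable_sets[OF X sets_enlarged_sublevel[OF v S]])
  hence "space M - (X -` ?B \<inter> space M) \<in> sets M" by blast
  also have "space M - (X -` ?B \<inter> space M) = {\<omega> \<in> space M. X \<omega> \<notin> ?B}" by auto
  finally have meas: "{\<omega> \<in> space M. X \<omega> \<notin> ?B} \<in> sets M" .
  have "prob {\<omega> \<in> space M. m + r \<le> v (entries n (X \<omega>))} \<le> prob {\<omega> \<in> space M. X \<omega> \<notin> ?B}"
  proof (rule finite_measure_mono[OF _ meas], safe)
    fix \<omega> assume "m + r \<le> v (entries n (X \<omega>))" "X \<omega> \<in> ?B"
    then obtain Z D E where "Z \<in> herm_mats \<beta> n" "v (entries n Z) < m" "D \<in> S" "E \<in> T" "X \<omega> = Z + D + E"
      by (auto simp: set_plus_def)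
    thus False using lip[of Z D E] \<open>m + r \<le> v (entries n (X \<omega>))\<close> by simp
  qed
  also have "\<dots> = measure (completion M) {\<omega> \<in> space M. X \<omega> \<notin> ?B}"
    using meas by simp
  finally show ?thesis using le by simp
qed

lemma scaled_lp_ball:
  assumes D: "D \<in> scale_mats c (lp_ball \<beta> n p)" and c: "0 < c" and p: "0 < p"
  shows "D \<in> herm_mats \<beta> n" and "(\<Sum>i<n. \<Sum>j<n. cmod (D $$ (i, j)) powr p) \<le> c powr p"
proof -
  obtain Y where Y: "Y \<in> herm_mats \<beta> n" "lp_norm p Y \<le> 1" and DY: "D = complex_of_real c \<cdot>\<^sub>m Y"
    using D by (auto simp: scale_mats_def lp_ball_def)
  note Yc = herm_mats_carrier[OF Y(1)]
  show "D \<in> herm_mats \<beta> n" unfolding DY by (rule real_smult_herm_mats[OF Y(1)])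
  let ?S = "\<Sum>i<n. \<Sum>j<n. cmod (Y $$ (i, j)) powr p"
  have le1: "?S powr (1 / p) \<le> 1" using Y(2) Yc by (simp add: lp_norm_def)
  have S: "?S \<le> 1"
  proof (rule ccontr)
    assume "\<not> ?S \<le> 1"
    hence "1 < ?S" by linarith
    from gr_one_powr[OF this, of "1 / p"] le1 p show False by simp
  qed
  have "(\<Sum>i<n. \<Sum>j<n. cmod (D $$ (i, j)) powr p) = c powr p * ?S"
    unfolding sum_distrib_left using Yc c
    by (intro sum.cong refl) (simp add: DY norm_mult powr_mult)
  also have "\<dots> \<le> c powr p * 1" using S by (intro mult_left_mono) auto
  finally show "(\<Sum>i<n. \<Sum>j<n. cmod (D $$ (i, j)) powr p) \<le> c powr p" by simp
qed

lemma stieltjes_shift_lp: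
  assumes Z: "Z \<in> herm_mats \<beta> n" and D: "D \<in> scale_mats c (lp_ball \<beta> n p)" and c: "0 < c"
    and p: "1 \<le> p" "p \<le> 2" and z: "2 \<le> Im z" and n: "1 \<le> n"
  shows "cmod (mat_stieltjes n z (Z + D) - mat_stieltjes n z Z) \<le> real n powr (- 1 / 2 - 1 / p) * c / 2"
proof -
  have p0: "0 < p" using p by simp
  note D' = scaled_lp_ball[OF D c p0]
  have "Z + D - Z = D"
    using herm_mats_carrier[OF Z] herm_mats_carrier[OF D'(1)] by (intro eq_matI) auto
  thus ?thesis using D'(2)
    by (intro stieltjes_diff_le_lp[OF herm_mats_add[OF Z D'(1)] Z z p n c]) simp
qed

lemma stieltjes_shift_quasinorm:
  assumes Z: "Z \<in> herm_mats \<beta> n" and D: "D \<in> scale_mats c (lp_ball \<beta> n \<alpha>)" and c: "0 < c"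
    and \<alpha>: "0 < \<alpha>" "\<alpha> \<le> 1" and z: "2 \<le> Im z" and n: "1 \<le> n"
  shows "cmod (mat_stieltjes n z (Z + D) - mat_stieltjes n z Z) \<le> 2 * real n powr (- 1 - \<alpha> / 2) * c powr \<alpha>"
proof -
  note D' = scaled_lp_ball[OF D c \<alpha>(1)]
  have "Z + D - Z = D"
    using herm_mats_carrier[OF Z] herm_mats_carrier[OF D'(1)] by (intro eq_matI) auto
  hence "cmod (mat_stieltjes n z (Z + D) - mat_stieltjes n z Z)
      \<le> 2 * real n powr (- 1 - \<alpha> / 2) * (\<Sum>i<n. \<Sum>j<n. cmod (D $$ (i, j)) powr \<alpha>)"
    using stieltjes_diff_le_quasinorm[OF herm_mats_add[OF Z D'(1)] Z z \<alpha> n] by simp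
  also have "\<dots> \<le> 2 * real n powr (- 1 - \<alpha> / 2) * c powr \<alpha>"
    by (intro mult_left_mono D'(2)) simp
  finally show ?thesis .
qed

section \<open>Concentration of the Stieltjes transform at a point\<close>

text \<open>The amount by which the Stieltjes transform can move under the enlargement at level \<open>s\<close> in the
  concentration property: one term for each of the balls involved.\<close>

definition shift_modulus :: "real \<Rightarrow> real \<Rightarrow> nat \<Rightarrow> real \<Rightarrow> real" where
  "shift_modulus \<alpha> \<kappa> n s =
     (if 1 \<le> \<alpha> then
        \<kappa> * sqrt s / (2 * real n) + real n powr (- 1 / 2 - 1 / \<alpha>) * (\<kappa> * s powr (1 / \<alpha>)) / 2
      else
        \<kappa> * ln (real n) powr (1 / \<alpha> - 1) * (sqrt s / (2 * real n) + real n powr (- 3 / 2) * s / 2)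
          + 2 * real n powr (- 1 - \<alpha> / 2) * (\<kappa> powr \<alpha> * s))"

text \<open>The enlargement in the concentration property apart from its summand in the \<open>\<ell>\<^sup>\<alpha>\<close> ball.\<close>

definition bulk_enlargement :: "real \<Rightarrow> real \<Rightarrow> nat \<Rightarrow> nat \<Rightarrow> real \<Rightarrow> complex mat set" where
  "bulk_enlargement \<alpha> \<kappa> \<beta> n s =
     (if 1 \<le> \<alpha> then scale_mats (\<kappa> * sqrt s) (lp_ball \<beta> n 2)
      else scale_mats (\<kappa> * ln (real n) powr (1 / \<alpha> - 1))
             (scale_mats (sqrt s) (lp_ball \<beta> n 2) + scale_mats s (lp_ball \<beta> n 1)))"

lemma scale_mats_sum_cases:
  assumes D: "D \<in> scale_mats c (scale_mats a (lp_ball \<beta> n p) + scale_mats b (lp_ball \<beta> n q))"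
  obtains D1 D2 where "D1 \<in> scale_mats (c * a) (lp_ball \<beta> n p)" "D2 \<in> scale_mats (c * b) (lp_ball \<beta> n q)"
    "D = D1 + D2"
proof -
  obtain Y1 Y2 where Y: "Y1 \<in> lp_ball \<beta> n p" "Y2 \<in> lp_ball \<beta> n q"
    and DY: "D = complex_of_real c \<cdot>\<^sub>m (complex_of_real a \<cdot>\<^sub>m Y1 + complex_of_real b \<cdot>\<^sub>m Y2)"
    using D by (auto simp: scale_mats_def set_plus_def)
  have "Y1 \<in> carrier_mat n n" "Y2 \<in> carrier_mat n n"
    using Y herm_mats_carrier by (auto simp: lp_ball_def)
  hence "D = complex_of_real (c * a) \<cdot>\<^sub>m Y1 + complex_of_real (c * b) \<cdot>\<^sub>m Y2"
    unfolding DY by (intro eq_matI) (auto simp: algebra_simps)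
  thus ?thesis using Y by (intro that) (auto simp: scale_mats_def)
qed

lemma scale_mats_lp_ball_subset: "scale_mats c (lp_ball \<beta> n p) \<subseteq> herm_mats \<beta> n"
  by (auto simp: scale_mats_def lp_ball_def intro: real_smult_herm_mats)

lemma bulk_enlargement_subset: "bulk_enlargement \<alpha> \<kappa> \<beta> n s \<subseteq> herm_mats \<beta> n"
proof
  fix D assume D: "D \<in> bulk_enlargement \<alpha> \<kappa> \<beta> n s"
  show "D \<in> herm_mats \<beta> n"
  proof (cases "1 \<le> \<alpha>")
    case True
    thus ?thesis using D subsetD[OF scale_mats_lp_ball_subset] by (auto simp: bulk_enlargement_def)
  next
    case False
    hence "D \<in> scale_mats (\<kappa> * ln (real n) powr (1 / \<alpha> - 1))
        (scale_mats (sqrt s) (lp_ball \<beta> n 2) + scale_mats s (lp_ball \<beta> n 1))"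
      using D by (simp add: bulk_enlargement_def)
    thus ?thesis
      by (rule scale_mats_sum_cases) (use scale_mats_lp_ball_subset in \<open>blast intro: herm_mats_add\<close>)
  qed
qed

text \<open>Each shift is estimated in its own norm: the \<open>\<ell>\<^sup>2\<close>, \<open>\<ell>\<^sup>1\<close> and, for \<open>\<alpha> \<ge> 1\<close>, the \<open>\<ell>\<^sup>\<alpha>\<close> balls by
  the \<open>\<ell>\<^sup>p\<close> bound, the \<open>\<ell>\<^sup>\<alpha>\<close> ball for \<open>\<alpha> < 1\<close> by the bound with the quasinorm.\<close>

lemma stieltjes_enlargement:
  assumes \<alpha>: "0 < \<alpha>" "\<alpha> \<le> 2" and \<kappa>: "0 < \<kappa>" and n: "1 \<le> n" "\<alpha> < 1 \<Longrightarrow> 2 \<le> n" and s: "0 < s"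
    and z: "2 \<le> Im z" and Z: "Z \<in> herm_mats \<beta> n" and D: "D \<in> bulk_enlargement \<alpha> \<kappa> \<beta> n s"
    and E: "E \<in> scale_mats (\<kappa> * s powr (1 / \<alpha>)) (lp_ball \<beta> n \<alpha>)"
  shows "cmod (mat_stieltjes n z (Z + D + E) - mat_stieltjes n z Z) \<le> shift_modulus \<alpha> \<kappa> n s"
proof -
  let ?g = "mat_stieltjes n z"
  have e: "0 < \<kappa> * s powr (1 / \<alpha>)" using \<kappa> s by simp
  have D': "D \<in> herm_mats \<beta> n" using D bulk_enlargement_subset by blast
  have n1: "real n powr (- 1 / 2 - 1 / 2) = 1 / real n" using n by (simp add: powr_minus field_simps)
  show ?thesis
  proof (cases "1 \<le> \<alpha>")
    case True
    have D2: "D \<in> scale_mats (\<kappa> * sqrt s) (lp_ball \<beta> n 2)" using D True by (simp add: bulk_enlargement_def)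
    have c: "0 < \<kappa> * sqrt s" using \<kappa> s by simp
    have "cmod (?g (Z + D) - ?g Z) \<le> real n powr (- 1 / 2 - 1 / 2) * (\<kappa> * sqrt s) / 2"
      by (rule stieltjes_shift_lp[OF Z D2 c _ _ z n(1)]) auto
    moreover have "cmod (?g (Z + D + E) - ?g (Z + D)) \<le> real n powr (- 1 / 2 - 1 / \<alpha>) * (\<kappa> * s powr (1 / \<alpha>)) / 2"
      by (rule stieltjes_shift_lp[OF herm_mats_add[OF Z D'] E e True \<alpha>(2) z n(1)])
    moreover have "cmod (?g (Z + D + E) - ?g Z) \<le> cmod (?g (Z + D + E) - ?g (Z + D)) + cmod (?g (Z + D) - ?g Z)"
      by (rule norm_diff_triangle_le) auto
    ultimately show ?thesis
      using True unfolding n1 shift_modulus_def by simp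
  next
    case False
    let ?l = "ln (real n) powr (1 / \<alpha> - 1)"
    have l: "0 < ?l" using n(2) False by simp
    obtain D1 D2 where D1: "D1 \<in> scale_mats (\<kappa> * ?l * sqrt s) (lp_ball \<beta> n 2)"
      and D2: "D2 \<in> scale_mats (\<kappa> * ?l * s) (lp_ball \<beta> n 1)" and DD: "D = D1 + D2"
      using D False by (auto simp: bulk_enlargement_def elim: scale_mats_sum_cases)
    have c: "0 < \<kappa> * ?l * sqrt s" "0 < \<kappa> * ?l * s" using \<kappa> s l by auto
    have D1': "D1 \<in> herm_mats \<beta> n" by (rule scaled_lp_ball[OF D1 c(1)]) simp
    have D2': "D2 \<in> herm_mats \<beta> n" by (rule scaled_lp_ball[OF D2 c(2)]) simp
    have assoc: "Z + D = Z + D1 + D2"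
      unfolding DD using herm_mats_carrier[OF Z] herm_mats_carrier[OF D1'] herm_mats_carrier[OF D2']
      by (intro eq_matI) auto
    have "cmod (?g (Z + D1) - ?g Z) \<le> real n powr (- 1 / 2 - 1 / 2) * (\<kappa> * ?l * sqrt s) / 2"
      by (rule stieltjes_shift_lp[OF Z D1 c(1) _ _ z n(1)]) auto
    moreover have "cmod (?g (Z + D) - ?g (Z + D1)) \<le> real n powr (- 1 / 2 - 1 / 1) * (\<kappa> * ?l * s) / 2"
      unfolding assoc by (rule stieltjes_shift_lp[OF herm_mats_add[OF Z D1'] D2 c(2) _ _ z n(1)]) auto
    moreover have "cmod (?g (Z + D + E) - ?g (Z + D))
        \<le> 2 * real n powr (- 1 - \<alpha> / 2) * (\<kappa> * s powr (1 / \<alpha>)) powr \<alpha>"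
      by (rule stieltjes_shift_quasinorm[OF herm_mats_add[OF Z D'] E e \<alpha>(1) _ z n(1)]) (use False in auto)
    moreover have "(\<kappa> * s powr (1 / \<alpha>)) powr \<alpha> = \<kappa> powr \<alpha> * s"
      using \<kappa> s \<alpha> by (simp add: powr_mult powr_powr)
    moreover have "cmod (?g (Z + D + E) - ?g Z)
        \<le> cmod (?g (Z + D + E) - ?g (Z + D)) + (cmod (?g (Z + D) - ?g (Z + D1)) + cmod (?g (Z + D1) - ?g Z))"
      using norm_triangle_ineq[of "?g (Z + D + E) - ?g (Z + D)" "?g (Z + D) - ?g Z"]
        norm_triangle_ineq[of "?g (Z + D) - ?g (Z + D1)" "?g (Z + D1) - ?g Z"] by simp
    ultimately have "cmod (?g (Z + D + E) - ?g Z) \<le> 2 * real n powr (- 1 - \<alpha> / 2) * (\<kappa> powr \<alpha> * s)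
        + (real n powr (- 3 / 2) * (\<kappa> * ?l * s) / 2 + 1 / real n * (\<kappa> * ?l * sqrt s) / 2)"
      unfolding n1 by simp
    also have "\<dots> = shift_modulus \<alpha> \<kappa> n s"
      using False by (simp add: shift_modulus_def algebra_simps)
    finally show ?thesis .
  qed
qed

lemma shift_modulus_pos:
  assumes "0 < \<kappa>" "1 \<le> n" "0 < s"
  shows "0 < shift_modulus \<alpha> \<kappa> n s"
  using assms unfolding shift_modulus_def
  by (auto intro!: add_pos_pos add_nonneg_pos mult_nonneg_nonneg)

text \<open>The real and imaginary part of the Stieltjes transform at \<open>z\<close> are its real parts after
  multiplication by the unit complex numbers \<open>1\<close> and \<open>- \<i>\<close>; lower deviations for \<open>c\<close> are upper
  deviations for \<open>- c\<close>. Hence it suffices to bound upper deviations for all unit \<open>c\<close>.\<close>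

lemma stieltjes_concentration:
  assumes \<alpha>: "0 < \<alpha>" "\<alpha> \<le> 2" and \<kappa>: "0 < \<kappa>" and n: "1 \<le> n" "\<alpha> < 1 \<Longrightarrow> 2 \<le> n"
    and M: "prob_space M" and X: "X \<in> M \<rightarrow>\<^sub>M herm_borel \<beta> n"
    and conc: "concentration_property \<alpha> \<kappa> \<beta> n M X"
    and z: "2 \<le> Im z" and s: "0 < s"
    and La: "\<And>s. 0 < s \<Longrightarrow> shift_modulus \<alpha> \<kappa> n s \<le> a * (1 + s)"
  shows "measure M {\<omega> \<in> space M. 4 * shift_modulus \<alpha> \<kappa> n s + 40 * a
    \<le> cmod (mat_stieltjes n z (X \<omega>) - stieltjes (mean_spectral_measure n M X) z)} \<le> 16 * exp (- s)"
proof -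
  interpret prob_space M by (rule M)
  let ?L = "shift_modulus \<alpha> \<kappa> n" and ?g = "mat_stieltjes n z"
  let ?m = "stieltjes (mean_spectral_measure n M X) z"
  have XH: "X \<omega> \<in> herm_mats \<beta> n" if "\<omega> \<in> space M" for \<omega>
    using measurable_space[OF X that] by simp
  have gX: "(\<lambda>\<omega>. ?g (X \<omega>)) \<in> borel_measurable M"
    by (rule measurable_compose[OF X measurable_mat_stieltjes[OF z n(1)]])
  have gbd: "cmod (?g A) \<le> 1 / 2" for A
    unfolding normalized_spectral_measure_def
    by (rule stieltjes_bounds(1)[OF prob_space_spectral_measure sets_spectral_measure z z])
  have gint: "integrable M (\<lambda>\<omega>. ?g (X \<omega>))"
    using gX gbd by (intro integrable_const_bound[of _ "1 / 2"]) auto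
  have exceed: "prob {\<omega> \<in> space M. m + ?L s \<le> Re (c * ?g (X \<omega>))} \<le> 4 * exp (- s)"
    if c: "cmod c = 1" and s: "0 < s" and half: "1 / 2 \<le> prob {\<omega> \<in> space M. Re (c * ?g (X \<omega>)) < m}" for c m s
  proof -
    define v where "v f = Re (c * ?g (hermitization n f))" for f
    have v: "continuous_on UNIV v"
      unfolding v_def by (intro continuous_intros continuous_on_stieltjes_hermitization[OF z n(1)])
    have ve: "v (entries n A) = Re (c * ?g A)" if "A \<in> herm_mats \<beta> n" for A
      by (simp only: v_def hermitization_entries[OF that])
    let ?A = "{Y \<in> herm_mats \<beta> n. v (entries n Y) < m}"
    let ?S = "bulk_enlargement \<alpha> \<kappa> \<beta> n s" and ?T = "scale_mats (\<kappa> * s powr (1 / \<alpha>)) (lp_ball \<beta> n \<alpha>)"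
    have sub: "?S \<subseteq> herm_mats \<beta> n" "?T \<subseteq> herm_mats \<beta> n"
      by (rule bulk_enlargement_subset, rule scale_mats_lp_ball_subset)
    have "(\<lambda>Y. v (entries n Y)) \<in> borel_measurable (herm_borel \<beta> n)"
      by (rule measurable_compose[OF measurable_entries borel_measurable_continuous_onI[OF v]])
    from measurable_sets[OF this, of "{..<m}"] have A: "?A \<in> sets (herm_borel \<beta> n)"
      by (simp add: vimage_def Int_def conj_commute)
    have "{\<omega> \<in> space M. X \<omega> \<in> ?A} = {\<omega> \<in> space M. Re (c * ?g (X \<omega>)) < m}"
      using XH by (auto simp: ve)
    hence "1 / 2 \<le> measure M {\<omega> \<in> space M. X \<omega> \<in> ?A}" using half by simp
    from conc[unfolded concentration_property_def, rule_format, OF A s this]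
    have "measure (completion M) {\<omega> \<in> space M. X \<omega> \<notin> ?A + ?S + ?T} \<le> 4 * exp (- s)"
      by (auto simp: bulk_enlargement_def split: if_splits intro: order_trans)
    hence "prob {\<omega> \<in> space M. m + ?L s \<le> v (entries n (X \<omega>))} \<le> 4 * exp (- s)"
    proof (rule prob_exceed_le_of_enlargement[OF X v sub, rotated])
      fix Z D E assume Z: "Z \<in> herm_mats \<beta> n" and D: "D \<in> ?S" and E: "E \<in> ?T"
      note en = stieltjes_enlargement[OF \<alpha> \<kappa> n s z Z D E]
      have "Re (c * ?g (Z + D + E)) - Re (c * ?g Z) \<le> cmod (c * (?g (Z + D + E) - ?g Z))"
        using complex_Re_le_cmod[of "c * (?g (Z + D + E) - ?g Z)"] by (simp add: right_diff_distrib)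
      also have "\<dots> \<le> ?L s" using en c by (simp add: norm_mult)
      finally show "v (entries n (Z + D + E)) \<le> v (entries n Z) + ?L s"
        using ve[OF Z] ve[OF herm_mats_add[OF herm_mats_add[OF Z subsetD[OF sub(1) D]] subsetD[OF sub(2) E]]] by simp
    qed
    moreover have "{\<omega> \<in> space M. m + ?L s \<le> v (entries n (X \<omega>))} = {\<omega> \<in> space M. m + ?L s \<le> Re (c * ?g (X \<omega>))}"
      using XH by (auto simp: ve)
    ultimately show ?thesis by simp
  qed
  have part: "prob {\<omega> \<in> space M. 2 * ?L s + 20 * a \<le> \<bar>Re (c * ?g (X \<omega>)) - Re (c * ?m)\<bar>} \<le> 8 * exp (- s)"
    if c: "cmod c = 1" for c
  proof -
    have "expectation (\<lambda>\<omega>. Re (c * ?g (X \<omega>))) = Re (c * ?m)"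
      using gint mean_spectral_measure(3)[OF M X n(1) z] by simp
    moreover have "prob {\<omega> \<in> space M. 2 * ?L s + 20 * a
        \<le> \<bar>Re (c * ?g (X \<omega>)) - expectation (\<lambda>\<omega>. Re (c * ?g (X \<omega>)))\<bar>} \<le> 8 * exp (- s)"
    proof (rule concentration_about_expectation[OF _ _ _ La _ _ s])
      show "(\<lambda>\<omega>. Re (c * ?g (X \<omega>))) \<in> borel_measurable M" using gX by measurable
      show "\<bar>Re (c * ?g (X \<omega>))\<bar> \<le> 1" for \<omega>
        using abs_Re_le_cmod[of "c * ?g (X \<omega>)"] gbd[of "X \<omega>"] c by (simp add: norm_mult)
      show "0 < ?L r" if "0 < r" for r by (rule shift_modulus_pos[OF \<kappa> n(1) that])
      show "prob {\<omega> \<in> space M. m + ?L r \<le> Re (c * ?g (X \<omega>))} \<le> 4 * exp (- r)"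
        if "0 < r" "1 / 2 \<le> prob {\<omega> \<in> space M. Re (c * ?g (X \<omega>)) < m}" for r m
        by (rule exceed[OF c that])
      show "prob {\<omega> \<in> space M. Re (c * ?g (X \<omega>)) \<le> m - ?L r} \<le> 4 * exp (- r)"
        if r: "0 < r" and half: "1 / 2 \<le> prob {\<omega> \<in> space M. m < Re (c * ?g (X \<omega>))}" for r m
      proof -
        have "prob {\<omega> \<in> space M. - m + ?L r \<le> Re ((- c) * ?g (X \<omega>))} \<le> 4 * exp (- r)"
        proof (rule exceed[OF _ r])
          have "Re ((- c) * ?g (X \<omega>)) < - m \<longleftrightarrow> m < Re (c * ?g (X \<omega>))" for \<omega> by auto
          thus "1 / 2 \<le> prob {\<omega> \<in> space M. Re ((- c) * ?g (X \<omega>)) < - m}"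
            using half by (simp only:)
        qed (use c in simp)
        moreover have "- m + ?L r \<le> Re ((- c) * ?g (X \<omega>)) \<longleftrightarrow> Re (c * ?g (X \<omega>)) \<le> m - ?L r" for \<omega>
          by auto
        ultimately show ?thesis by (simp only:)
      qed
    qed
    ultimately show ?thesis by simp
  qed
  define d where "d \<omega> = ?g (X \<omega>) - ?m" for \<omega>
  let ?r = "2 * ?L s + 20 * a"
  have dm [measurable]: "d \<in> borel_measurable M" unfolding d_def using gX by measurable
  have "prob {\<omega> \<in> space M. 4 * ?L s + 40 * a \<le> cmod (d \<omega>)}
      \<le> prob ({\<omega> \<in> space M. ?r \<le> \<bar>Re (d \<omega>)\<bar>} \<union> {\<omega> \<in> space M. ?r \<le> \<bar>Im (d \<omega>)\<bar>})"
  proof (rule finite_measure_mono)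
    show "{\<omega> \<in> space M. 4 * ?L s + 40 * a \<le> cmod (d \<omega>)}
        \<subseteq> {\<omega> \<in> space M. ?r \<le> \<bar>Re (d \<omega>)\<bar>} \<union> {\<omega> \<in> space M. ?r \<le> \<bar>Im (d \<omega>)\<bar>}"
    proof
      fix \<omega> assume "\<omega> \<in> {\<omega> \<in> space M. 4 * ?L s + 40 * a \<le> cmod (d \<omega>)}"
      thus "\<omega> \<in> {\<omega> \<in> space M. ?r \<le> \<bar>Re (d \<omega>)\<bar>} \<union> {\<omega> \<in> space M. ?r \<le> \<bar>Im (d \<omega>)\<bar>}"
        using cmod_le[of "d \<omega>"] by auto
    qed
  qed measurable
  also have "\<dots> \<le> prob {\<omega> \<in> space M. ?r \<le> \<bar>Re (d \<omega>)\<bar>} + prob {\<omega> \<in> space M. ?r \<le> \<bar>Im (d \<omega>)\<bar>}"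
    by (rule measure_Un_le) measurable
  also have "\<dots> \<le> 8 * exp (- s) + 8 * exp (- s)"
    using part[of 1] part[of "- \<i>"] by (intro add_mono) (simp_all add: d_def)
  finally show ?thesis by (simp add: d_def)
qed

section \<open>Rates, nets and the uniform bound\<close>

text \<open>The rate is, up to a constant, the level at which the modulus reaches \<open>t\<close>: each of the two terms
  of the modulus takes at most \<open>t / 16\<close>. The linear bound in \<open>s\<close> controls the distance between
  median and mean.\<close>

lemma shift_modulus_bounds_ge_one:
  assumes \<alpha>: "1 \<le> \<alpha>" "\<alpha> \<le> 2" and \<kappa>: "0 < \<kappa>" and n: "1 \<le> n"
  shows "0 < s \<Longrightarrow> shift_modulus \<alpha> \<kappa> n s \<le> \<kappa> / real n * (1 + s)"
    and "0 < t \<Longrightarrow> 0 < rate \<alpha> \<kappa> n t"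
    and "0 < t \<Longrightarrow> shift_modulus \<alpha> \<kappa> n (1 / 64 * rate \<alpha> \<kappa> n t) \<le> t / 8"
proof -
  show "shift_modulus \<alpha> \<kappa> n s \<le> \<kappa> / real n * (1 + s)" if s: "0 < s"
  proof -
    have "sqrt s \<le> 1 + s"
      by (rule real_le_lsqrt) (use s in \<open>auto simp: power2_eq_square algebra_simps\<close>)
    moreover have "s powr (1 / \<alpha>) \<le> 1 + s"
    proof (cases "1 \<le> s")
      case True
      hence "s powr (1 / \<alpha>) \<le> s powr 1" using \<alpha> by (intro powr_mono) auto
      thus ?thesis using s by simp
    next
      case False
      hence "s powr (1 / \<alpha>) \<le> 1" using s \<alpha> by (intro powr_le1) auto
      thus ?thesis using s by simp
    qed
    moreover have "real n powr (- 1 / 2 - 1 / \<alpha>) \<le> 1 / real n"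
    proof -
      have "real n powr (- 1 / 2 - 1 / \<alpha>) \<le> real n powr (- 1)"
        using n \<alpha> by (intro powr_mono) (auto simp: field_simps)
      thus ?thesis using n by (simp add: powr_minus field_simps)
    qed
    ultimately have "\<kappa> * sqrt s / (2 * real n) + real n powr (- 1 / 2 - 1 / \<alpha>) * (\<kappa> * s powr (1 / \<alpha>)) / 2
        \<le> \<kappa> * (1 + s) / (2 * real n) + 1 / real n * (\<kappa> * (1 + s)) / 2"
      using \<kappa> n s by (intro add_mono divide_right_mono mult_mono mult_left_mono) auto
    also have "\<dots> = \<kappa> / real n * (1 + s)" by (simp add: field_simps)
    finally show ?thesis using \<alpha> by (simp add: shift_modulus_def)
  qed
  show pos: "0 < rate \<alpha> \<kappa> n t" if "0 < t"
    using that \<kappa> n \<alpha> by (simp add: rate_def)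
  show "shift_modulus \<alpha> \<kappa> n (1 / 64 * rate \<alpha> \<kappa> n t) \<le> t / 8" if t: "0 < t"
  proof -
    let ?\<rho> = "rate \<alpha> \<kappa> n t"
    have r1: "?\<rho> \<le> (real n * t / \<kappa>)\<^sup>2" and r2: "?\<rho> \<le> real n powr (1 + \<alpha> / 2) * t powr \<alpha> / \<kappa> powr \<alpha>"
      using \<alpha> by (auto simp: rate_def power_mult_distrib power_divide)
    have "sqrt (1 / 64 * ?\<rho>) \<le> sqrt (1 / 64 * (real n * t / \<kappa>)\<^sup>2)"
      using r1 by (intro real_sqrt_le_mono) auto
    also have "\<dots> = 1 / 8 * (real n * t / \<kappa>)"
      using n t \<kappa> real_sqrt_unique[of 8 64] by (simp add: real_sqrt_mult real_sqrt_divide)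
    finally have "\<kappa> * sqrt (1 / 64 * ?\<rho>) / (2 * real n) \<le> \<kappa> * (1 / 8 * (real n * t / \<kappa>)) / (2 * real n)"
      using \<kappa> by (intro divide_right_mono mult_left_mono) auto
    also have "\<dots> = t / 16" using \<kappa> n by (simp add: field_simps)
    finally have A: "\<kappa> * sqrt (1 / 64 * ?\<rho>) / (2 * real n) \<le> t / 16" .
    have "(1 / 64 * ?\<rho>) powr (1 / \<alpha>)
        \<le> (1 / 64 * (real n powr (1 + \<alpha> / 2) * t powr \<alpha> / \<kappa> powr \<alpha>)) powr (1 / \<alpha>)"
      using r2 pos[OF t] \<alpha> by (intro powr_mono2) auto
    also have "\<dots> = (1 / 64) powr (1 / \<alpha>) * (real n powr (1 / \<alpha> + 1 / 2) * t / \<kappa>)"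
      using \<alpha> \<kappa> t n by (simp add: powr_mult powr_divide powr_powr add_divide_distrib)
    also have "\<dots> \<le> 1 / 8 * (real n powr (1 / \<alpha> + 1 / 2) * t / \<kappa>)"
    proof (rule mult_right_mono)
      have "(1 / 64 :: real) powr (1 / \<alpha>) \<le> (1 / 64) powr (1 / 2)"
        using \<alpha> by (intro powr_mono') (auto simp: field_simps)
      also have "(1 / 64 :: real) powr (1 / 2) = 1 / 8"
        using real_sqrt_unique[of 8 64] by (simp add: powr_half_sqrt real_sqrt_divide)
      finally show "(1 / 64 :: real) powr (1 / \<alpha>) \<le> 1 / 8" .
    qed (use t \<kappa> in simp)
    finally have "(1 / 64 * ?\<rho>) powr (1 / \<alpha>) \<le> 1 / 8 * (real n powr (1 / \<alpha> + 1 / 2) * t / \<kappa>)" .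
    hence "real n powr (- 1 / 2 - 1 / \<alpha>) * (\<kappa> * (1 / 64 * ?\<rho>) powr (1 / \<alpha>)) / 2
        \<le> real n powr (- 1 / 2 - 1 / \<alpha>) * (\<kappa> * (1 / 8 * (real n powr (1 / \<alpha> + 1 / 2) * t / \<kappa>))) / 2"
      using \<kappa> by (intro divide_right_mono mult_left_mono) auto
    also have "\<dots> = (real n powr (- 1 / 2 - 1 / \<alpha>) * real n powr (1 / \<alpha> + 1 / 2)) * t / 16"
      using \<kappa> by simp
    also have "real n powr (- 1 / 2 - 1 / \<alpha>) * real n powr (1 / \<alpha> + 1 / 2) = 1"
      unfolding powr_add[symmetric] using n by simp
    finally have "real n powr (- 1 / 2 - 1 / \<alpha>) * (\<kappa> * (1 / 64 * ?\<rho>) powr (1 / \<alpha>)) / 2 \<le> t / 16"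
      by simp
    thus ?thesis using A \<alpha> by (simp add: shift_modulus_def)
  qed
qed

text \<open>This absorbs the logarithm of the \<open>\<ell>\<^sup>1\<close> term into the gap between \<open>n\<close> to the power \<open>3 / 2\<close> and
  \<open>n\<close> to the power \<open>1 + \<alpha> / 2\<close>.\<close>

lemma ln_powr_le:
  assumes "0 < \<alpha>" "\<alpha> < 1" "1 \<le> n"
  shows "ln (real n) powr (1 / \<alpha> - 1) \<le> (2 / \<alpha>) powr (1 / \<alpha> - 1) * real n powr ((1 - \<alpha>) / 2)"
proof -
  have "ln (real n) \<le> real n powr (\<alpha> / 2) / (\<alpha> / 2)"
    using assms by (intro ln_powr_bound) auto
  hence "ln (real n) powr (1 / \<alpha> - 1) \<le> (2 / \<alpha> * real n powr (\<alpha> / 2)) powr (1 / \<alpha> - 1)"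
    using assms by (intro powr_mono2) (auto simp: field_simps)
  also have "\<dots> = (2 / \<alpha>) powr (1 / \<alpha> - 1) * real n powr (\<alpha> / 2 * (1 / \<alpha> - 1))"
    by (simp only: powr_mult powr_powr)
  also have "\<alpha> / 2 * (1 / \<alpha> - 1) = (1 - \<alpha>) / 2" using assms by (simp add: field_simps)
  finally show ?thesis .
qed

text \<open>The lower bound on \<open>\<kappa>\<close> is what allows \<open>\<kappa>\<close> itself instead of its \<open>\<alpha>\<close>-th power in the rate.\<close>

lemma powr_le_mult_of_ge:
  fixes \<kappa> \<kappa>\<^sub>0 :: real
  assumes "0 < \<kappa>\<^sub>0" "\<kappa>\<^sub>0 \<le> \<kappa>" "\<alpha> \<le> 1"
  shows "\<kappa> powr \<alpha> \<le> \<kappa>\<^sub>0 powr (\<alpha> - 1) * \<kappa>"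
proof -
  have "\<kappa> powr \<alpha> = \<kappa> powr (\<alpha> - 1) * \<kappa>" using assms by (simp add: powr_diff)
  also have "\<dots> \<le> \<kappa>\<^sub>0 powr (\<alpha> - 1) * \<kappa>"
    using assms by (intro mult_right_mono powr_mono2') auto
  finally show ?thesis .
qed

text \<open>The three terms of the modulus take at most \<open>t / 24\<close> each. For \<open>n \<ge> 2\<close> the logarithm is bounded
  away from \<open>0\<close>, so the term without a logarithm is dominated by the others at the cost of a
  constant.\<close>

lemma shift_modulus_bounds_less_one:
  assumes \<alpha>: "0 < \<alpha>" "\<alpha> < 1" and \<kappa>0: "0 < \<kappa>\<^sub>0"
  shows "\<exists>c>0. \<exists>C\<ge>0. \<forall>\<kappa>\<ge>\<kappa>\<^sub>0. \<forall>n\<ge>2.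
    (\<forall>s>0. shift_modulus \<alpha> \<kappa> n s \<le> C * (\<kappa> / real n * ln (real n) powr (1 / \<alpha> - 1)) * (1 + s)) \<and>
    (\<forall>t>0. 0 < rate \<alpha> \<kappa> n t \<and> shift_modulus \<alpha> \<kappa> n (c * rate \<alpha> \<kappa> n t) \<le> t / 8)"
proof -
  \<comment> \<open>\<open>B\<close>, \<open>G\<close> and \<open>l2\<close> are the constants for the logarithm, for the power of \<open>\<kappa>\<close>, and for
    \<open>ln n \<ge> ln 2\<close>; \<open>c\<close> makes each term of the modulus at most \<open>t / 24\<close>.\<close>
  define B where "B = (2 / \<alpha>) powr (1 / \<alpha> - 1)"
  define G where "G = \<kappa>\<^sub>0 powr (\<alpha> - 1)"
  define l2 where "l2 = ln (2::real) powr (1 / \<alpha> - 1)"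
  have B: "0 < B" and G: "0 < G" and l2: "0 < l2" using \<alpha> \<kappa>0 by (auto simp: B_def G_def l2_def)
  define c where "c = min (1 / 144) (min (1 / (12 * B)) (1 / (48 * G)))"
  define C where "C = 1 + 2 * G / l2"
  have c: "0 < c" using B G by (simp add: c_def)
  have cB: "c * B \<le> 1 / 12"
  proof -
    have "c * B \<le> 1 / (12 * B) * B" using B by (intro mult_right_mono) (auto simp: c_def)
    thus ?thesis using B by simp
  qed
  have cG: "c * G \<le> 1 / 48"
  proof -
    have "c * G \<le> 1 / (48 * G) * G" using G by (intro mult_right_mono) (auto simp: c_def)
    thus ?thesis using G by simp
  qed
  have main: "(\<forall>s>0. shift_modulus \<alpha> \<kappa> n s \<le> C * (\<kappa> / real n * ln (real n) powr (1 / \<alpha> - 1)) * (1 + s)) \<and>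
    (\<forall>t>0. 0 < rate \<alpha> \<kappa> n t \<and> shift_modulus \<alpha> \<kappa> n (c * rate \<alpha> \<kappa> n t) \<le> t / 8)"
    if \<kappa>: "\<kappa>\<^sub>0 \<le> \<kappa>" and n: "2 \<le> n" for \<kappa> n
  proof (intro conjI allI impI)
    define l where "l = ln (real n) powr (1 / \<alpha> - 1)"
    have \<kappa>p: "0 < \<kappa>" using \<kappa> \<kappa>0 by simp
    have lp: "0 < l" using n by (simp add: l_def)
    have ll: "l2 \<le> l" unfolding l_def l2_def using n \<alpha> by (intro powr_mono2) auto
    have \<kappa>\<alpha>: "\<kappa> powr \<alpha> \<le> G * \<kappa>" unfolding G_def using powr_le_mult_of_ge[OF \<kappa>0 \<kappa>] \<alpha> by simp
    have mod: "shift_modulus \<alpha> \<kappa> n s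
        = \<kappa> * l * (sqrt s / (2 * real n) + real n powr (- 3 / 2) * s / 2)
          + 2 * real n powr (- 1 - \<alpha> / 2) * (\<kappa> powr \<alpha> * s)" for s
      using \<alpha> by (simp add: shift_modulus_def l_def)
    {
      fix s :: real assume s: "0 < s"
      have sq: "sqrt s \<le> 1 + s"
        by (rule real_le_lsqrt) (use s in \<open>auto simp: power2_eq_square algebra_simps\<close>)
      have n3: "real n powr (- 3 / 2) \<le> 1 / real n" and na: "real n powr (- 1 - \<alpha> / 2) \<le> 1 / real n"
      proof -
        have "real n powr (- 3 / 2) \<le> real n powr (- 1)" using n by (intro powr_mono) auto
        moreover have "real n powr (- 1 - \<alpha> / 2) \<le> real n powr (- 1)" using n \<alpha> by (intro powr_mono) auto
        ultimately show "real n powr (- 3 / 2) \<le> 1 / real n" "real n powr (- 1 - \<alpha> / 2) \<le> 1 / real n"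
          using n by (auto simp: powr_minus field_simps)
      qed
      have "shift_modulus \<alpha> \<kappa> n s \<le> \<kappa> * l * ((1 + s) / (2 * real n) + 1 / real n * (1 + s) / 2)
          + 2 * (1 / real n) * (G * \<kappa> * (1 + s))"
        unfolding mod using sq n3 na \<kappa>\<alpha> \<kappa>p lp s n G
        by (intro add_mono mult_mono mult_left_mono divide_right_mono) auto
      also have "\<dots> = \<kappa> / real n * (l + 2 * G) * (1 + s)"
        by (simp add: field_simps add_divide_distrib)
      also have "\<dots> \<le> \<kappa> / real n * (C * l) * (1 + s)"
      proof -
        have "2 * G / l2 * l2 \<le> 2 * G / l2 * l" using ll G l2 by (intro mult_left_mono) auto
        hence "2 * G \<le> 2 * G / l2 * l" using l2 by simp
        hence "l + 2 * G \<le> C * l" by (simp add: C_def distrib_right)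
        thus ?thesis using \<kappa>p n s by (intro mult_right_mono mult_left_mono) auto
      qed
      finally show "shift_modulus \<alpha> \<kappa> n s \<le> C * (\<kappa> / real n * ln (real n) powr (1 / \<alpha> - 1)) * (1 + s)"
        by (simp add: l_def mult_ac)
    }
    {
      fix t :: real assume t: "0 < t"
      let ?\<rho> = "rate \<alpha> \<kappa> n t"
      have l2e: "ln (real n) powr (2 * (1 / \<alpha> - 1)) = l\<^sup>2"
        using n by (simp add: l_def power2_eq_square flip: powr_add)
      have rate: "?\<rho> = min ((real n * t / (\<kappa> * l))\<^sup>2) (real n powr (1 + \<alpha> / 2) * t / \<kappa>)"
        unfolding rate_def l2e using \<alpha> by (simp add: power_mult_distrib power_divide)
      show pos: "0 < ?\<rho>" unfolding rate using n t \<kappa>p lp by simp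
      have r1: "?\<rho> \<le> (real n * t / (\<kappa> * l))\<^sup>2" and r2: "?\<rho> \<le> real n powr (1 + \<alpha> / 2) * t / \<kappa>"
        unfolding rate by auto
      have "sqrt (c * ?\<rho>) \<le> sqrt (1 / 144 * (real n * t / (\<kappa> * l))\<^sup>2)"
        using r1 pos c by (intro real_sqrt_le_mono mult_mono) (auto simp: c_def)
      also have "\<dots> = 1 / 12 * (real n * t / (\<kappa> * l))"
        using n t \<kappa>p lp real_sqrt_unique[of 12 144] by (simp add: real_sqrt_mult real_sqrt_divide)
      finally have "\<kappa> * l * (sqrt (c * ?\<rho>) / (2 * real n)) \<le> \<kappa> * l * (1 / 12 * (real n * t / (\<kappa> * l)) / (2 * real n))"
        using \<kappa>p lp by (intro mult_left_mono divide_right_mono) auto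
      also have "\<dots> = t / 24" using \<kappa>p lp n by (simp add: field_simps)
      finally have T1: "\<kappa> * l * (sqrt (c * ?\<rho>) / (2 * real n)) \<le> t / 24" .
      have lB: "l \<le> B * real n powr ((1 - \<alpha>) / 2)"
        unfolding l_def B_def using ln_powr_le[OF \<alpha>] n by simp
      have "\<kappa> * l * (real n powr (- 3 / 2) * (c * ?\<rho>) / 2)
          \<le> \<kappa> * (B * real n powr ((1 - \<alpha>) / 2)) * (real n powr (- 3 / 2) * (c * (real n powr (1 + \<alpha> / 2) * t / \<kappa>)) / 2)"
        using lB r2 pos c \<kappa>p lp B t by (intro mult_mono mult_left_mono divide_right_mono) auto
      also have "\<dots> = (real n powr ((1 - \<alpha>) / 2) * real n powr (- 3 / 2) * real n powr (1 + \<alpha> / 2)) * (c * B * t / 2)"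
        using \<kappa>p by (simp add: field_simps)
      also have "real n powr ((1 - \<alpha>) / 2) * real n powr (- 3 / 2) * real n powr (1 + \<alpha> / 2) = 1"
        unfolding powr_add[symmetric] using n by (simp add: field_simps)
      also have "1 * (c * B * t / 2) \<le> 1 / 12 * t / 2"
        using mult_right_mono[OF cB less_imp_le[OF t]] by linarith
      finally have T2: "\<kappa> * l * (real n powr (- 3 / 2) * (c * ?\<rho>) / 2) \<le> t / 24" by simp
      have "2 * real n powr (- 1 - \<alpha> / 2) * (\<kappa> powr \<alpha> * (c * ?\<rho>))
          \<le> 2 * real n powr (- 1 - \<alpha> / 2) * (G * \<kappa> * (c * (real n powr (1 + \<alpha> / 2) * t / \<kappa>)))"
        using \<kappa>\<alpha> r2 pos c \<kappa>p G by (intro mult_mono mult_left_mono) auto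
      also have "\<dots> = (real n powr (- 1 - \<alpha> / 2) * real n powr (1 + \<alpha> / 2)) * (2 * (c * G) * t)"
        using \<kappa>p by (simp add: field_simps)
      also have "real n powr (- 1 - \<alpha> / 2) * real n powr (1 + \<alpha> / 2) = 1"
        unfolding powr_add[symmetric] using n by simp
      also have "1 * (2 * (c * G) * t) \<le> 2 * (1 / 48) * t"
        using mult_right_mono[OF cG less_imp_le[OF t]] by linarith
      finally have T3: "2 * real n powr (- 1 - \<alpha> / 2) * (\<kappa> powr \<alpha> * (c * ?\<rho>)) \<le> t / 24" by simp
      show "shift_modulus \<alpha> \<kappa> n (c * ?\<rho>) \<le> t / 8"
        unfolding mod distrib_left using T1 T2 T3 by linarith
    }
  qed
  have "0 \<le> C" using G l2 by (simp add: C_def)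
  thus ?thesis using c main by blast
qed

text \<open>A set of diameter at most \<open>1\<close> meets at most \<open>(2 m + 1)\<^sup>2\<close> cells of a square grid of mesh \<open>1 / m\<close>;
  one representative of each cell gives a net.\<close>

lemma finite_net:
  fixes K :: "complex set"
  assumes K: "bounded K" "diameter K \<le> 1" "K \<noteq> {}" and t: "0 < t" "t \<le> 1"
  shows "\<exists>F\<subseteq>K. finite F \<and> real (card F) \<le> 49 / t\<^sup>2 \<and> (\<forall>z\<in>K. \<exists>w\<in>F. cmod (z - w) \<le> t)"
proof -
  obtain z0 where z0: "z0 \<in> K" using K by blast
  \<comment> \<open>A cell of mesh \<open>1 / m\<close> has diameter at most \<open>2 / m \<le> t\<close>.\<close>
  define m where "m = nat \<lceil>2 / t\<rceil>"
  have m2: "2 / t \<le> real m" unfolding m_def by (rule real_nat_ceiling_ge)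
  have m3: "real m \<le> 3 / t"
  proof -
    have "0 \<le> 2 / t" using t by simp
    hence "real m \<le> 2 / t + 1" unfolding m_def by linarith
    also have "\<dots> \<le> 2 / t + 1 / t" using t by (simp add: field_simps)
    finally show ?thesis by simp
  qed
  have mp: "0 < real m" using m2 divide_pos_pos[of 2 t] t by linarith
  define g where "g z = (\<lfloor>Re (z - z0) * real m\<rfloor>, \<lfloor>Im (z - z0) * real m\<rfloor>)" for z
  have gK: "g ` K \<subseteq> {- int m..int m} \<times> {- int m..int m}"
  proof
    fix c assume "c \<in> g ` K"
    then obtain z where z: "z \<in> K" "c = g z" by blast
    have "cmod (z - z0) \<le> 1"
      using diameter_bounded_bound[OF K(1) z(1) z0] K(2) by (simp add: dist_norm)
    hence "\<bar>Re (z - z0)\<bar> \<le> 1" "\<bar>Im (z - z0)\<bar> \<le> 1"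
      using abs_Re_le_cmod[of "z - z0"] abs_Im_le_cmod[of "z - z0"] by linarith+
    moreover have "\<lfloor>x * real m\<rfloor> \<in> {- int m..int m}" if "\<bar>x\<bar> \<le> 1" for x
    proof -
      have "\<bar>x * real m\<bar> \<le> real m" using that mult_right_mono[OF that, of "real m"] by (simp add: abs_mult)
      hence "- real m \<le> x * real m" "x * real m \<le> real m" by linarith+
      hence "- int m \<le> \<lfloor>x * real m\<rfloor>" "\<lfloor>x * real m\<rfloor> \<le> int m" by linarith+
      thus ?thesis by simp
    qed
    ultimately show "c \<in> {- int m..int m} \<times> {- int m..int m}" by (auto simp: z(2) g_def)
  qed
  hence fin: "finite (g ` K)" by (rule finite_subset) simp
  define F where "F = (\<lambda>c. SOME z. z \<in> K \<and> g z = c) ` g ` K"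
  have rep: "(SOME w. w \<in> K \<and> g w = g z) \<in> K \<and> g (SOME w. w \<in> K \<and> g w = g z) = g z" if "z \<in> K" for z
    by (rule someI[of "\<lambda>w. w \<in> K \<and> g w = g z" z]) (use that in simp)
  have "F \<subseteq> K" using rep by (auto simp: F_def)
  moreover have "finite F" unfolding F_def by (rule finite_imageI[OF fin])
  moreover have "real (card F) \<le> 49 / t\<^sup>2"
  proof -
    have "card F \<le> card (g ` K)" unfolding F_def by (rule card_image_le[OF fin])
    also have "\<dots> \<le> card ({- int m..int m} \<times> {- int m..int m})" by (rule card_mono[OF _ gK]) simp
    also have "\<dots> = (2 * m + 1)\<^sup>2"
    proof -
      have "nat (int m + int m + 1) = 2 * m + 1" by simp
      thus ?thesis by (simp add: power2_eq_square)
    qed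
    finally have "real (card F) \<le> real ((2 * m + 1)\<^sup>2)" by (simp only: of_nat_le_iff)
    also have "\<dots> = (2 * real m + 1)\<^sup>2" by simp
    also have "\<dots> \<le> (7 / t)\<^sup>2"
    proof (rule power_mono)
      have "2 * real m + 1 \<le> 2 * (3 / t) + 1 / t" using m3 t by (intro add_mono mult_left_mono) auto
      thus "2 * real m + 1 \<le> 7 / t" by simp
    qed simp
    finally show ?thesis by (simp add: power_divide)
  qed
  moreover have "\<exists>w\<in>F. cmod (z - w) \<le> t" if z: "z \<in> K" for z
  proof -
    obtain w where w: "g w = g z" and wF: "w \<in> F"
    proof
      show "g (SOME w. w \<in> K \<and> g w = g z) = g z" using rep[OF z] by blast
      show "(SOME w. w \<in> K \<and> g w = g z) \<in> F" using z by (auto simp: F_def)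
    qed
    have close: "\<bar>x - y\<bar> \<le> t / 2" if "\<lfloor>x * real m\<rfloor> = \<lfloor>y * real m\<rfloor>" for x y
    proof -
      have "\<bar>(x - y) * real m\<bar> \<le> 1" unfolding left_diff_distrib using that by linarith
      hence "\<bar>x - y\<bar> * real m \<le> 1" by (simp add: abs_mult)
      hence "\<bar>x - y\<bar> \<le> 1 / real m" using mp by (simp add: pos_le_divide_eq)
      also have "\<dots> \<le> 1 / (2 / t)" using m2 mp t by (intro divide_left_mono) auto
      also have "\<dots> = t / 2" by simp
      finally show ?thesis .
    qed
    have "\<lfloor>Re (z - z0) * real m\<rfloor> = \<lfloor>Re (w - z0) * real m\<rfloor>"
      and "\<lfloor>Im (z - z0) * real m\<rfloor> = \<lfloor>Im (w - z0) * real m\<rfloor>"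
      using w by (simp_all only: g_def prod.inject)
    from this[THEN close] have "cmod (z - w) \<le> t" using cmod_le[of "z - w"] by simp
    thus ?thesis using wF by blast
  qed
  ultimately show ?thesis by blast
qed

text \<open>Both Stieltjes transforms are Lipschitz with constant \<open>1 / 4\<close>, so passing from \<open>K\<close> to a net of mesh
  \<open>t\<close> costs \<open>t / 2\<close>, and the union bound over the \<open>49 / t\<^sup>2\<close> points of the net gives
  \<open>784 = 49 * 16\<close>.\<close>

lemma stieltjes_dist_concentration:
  assumes K: "bounded K" "K \<subseteq> {z. 2 \<le> Im z}" "diameter K \<le> 1" "K \<noteq> {}"
    and \<alpha>: "0 < \<alpha>" "\<alpha> \<le> 2" and \<kappa>: "0 < \<kappa>" and n: "1 \<le> n" "\<alpha> < 1 \<Longrightarrow> 2 \<le> n"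
    and M: "prob_space M" and X: "X \<in> M \<rightarrow>\<^sub>M herm_borel \<beta> n"
    and conc: "concentration_property \<alpha> \<kappa> \<beta> n M X" and s: "0 < s"
    and La: "\<And>s. 0 < s \<Longrightarrow> shift_modulus \<alpha> \<kappa> n s \<le> a * (1 + s)"
    and t: "0 < t" "t \<le> 1" and Lt: "shift_modulus \<alpha> \<kappa> n s \<le> t / 8"
  shows "measure M {\<omega> \<in> space M. t + 40 * a
      < stieltjes_dist K (normalized_spectral_measure n (X \<omega>)) (mean_spectral_measure n M X)}
    \<le> 784 / t\<^sup>2 * exp (- s)"
proof -
  interpret prob_space M by (rule M)
  let ?L = "shift_modulus \<alpha> \<kappa> n s"
  define d where "d z \<omega> = cmod (mat_stieltjes n z (X \<omega>) - stieltjes (mean_spectral_measure n M X) z)" for z \<omega>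
  obtain F where F: "F \<subseteq> K" "finite F" "real (card F) \<le> 49 / t\<^sup>2"
    and net: "\<And>z. z \<in> K \<Longrightarrow> \<exists>w\<in>F. cmod (z - w) \<le> t"
    using finite_net[OF K(1,3,4) t] by blast
  have Im2: "2 \<le> Im z" if "z \<in> K" for z using that K(2) by auto
  note mean = mean_spectral_measure[OF M X n(1)]
  have dm: "d z \<in> borel_measurable M" if "z \<in> K" for z
    unfolding d_def using measurable_compose[OF X measurable_mat_stieltjes[OF Im2[OF that] n(1)]] by measurable
  have lip: "d z \<omega> \<le> d w \<omega> + cmod (z - w) / 2" if zK: "z \<in> K" and wK: "w \<in> K" for z w \<omega>
  proof -
    let ?a = "mat_stieltjes n z (X \<omega>)" and ?b = "mat_stieltjes n w (X \<omega>)"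
    let ?m = "stieltjes (mean_spectral_measure n M X)"
    have "cmod (?a - ?b) \<le> cmod (z - w) / 4"
      unfolding normalized_spectral_measure_def
      by (rule stieltjes_bounds(2)[OF prob_space_spectral_measure sets_spectral_measure Im2[OF zK] Im2[OF wK]])
    moreover have "cmod (?m z - ?m w) \<le> cmod (z - w) / 4"
      by (rule stieltjes_bounds(2)[OF mean(1)[OF Im2[OF zK]] mean(2)[OF Im2[OF zK]] Im2[OF zK] Im2[OF wK]])
    moreover have "?a - ?m z = (?b - ?m w) + ((?a - ?b) - (?m z - ?m w))" by simp
    hence "cmod (?a - ?m z) \<le> cmod (?b - ?m w) + (cmod (?a - ?b) + cmod (?m z - ?m w))"
      by (metis norm_triangle_ineq norm_triangle_ineq4 order_trans add_left_mono)
    ultimately show ?thesis by (simp add: d_def)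
  qed
  let ?bad = "\<Union>w\<in>F. {\<omega> \<in> space M. 4 * ?L + 40 * a \<le> d w \<omega>}"
  have meas: "{\<omega> \<in> space M. 4 * ?L + 40 * a \<le> d w \<omega>} \<in> events" if "w \<in> F" for w
    using borel_measurable_le[OF borel_measurable_const dm[OF subsetD[OF F(1) that]]] by simp
  have "prob {\<omega> \<in> space M. t + 40 * a
      < stieltjes_dist K (normalized_spectral_measure n (X \<omega>)) (mean_spectral_measure n M X)} \<le> prob ?bad"
  proof (rule finite_measure_mono)
    show "?bad \<in> events" using meas F(2) by blast
    show "{\<omega> \<in> space M. t + 40 * a
      < stieltjes_dist K (normalized_spectral_measure n (X \<omega>)) (mean_spectral_measure n M X)} \<subseteq> ?bad"
    proof
      fix \<omega> assume w: "\<omega> \<in> {\<omega> \<in> space M. t + 40 * a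
        < stieltjes_dist K (normalized_spectral_measure n (X \<omega>)) (mean_spectral_measure n M X)}"
      have "\<exists>z\<in>K. t + 40 * a < d z \<omega>"
      proof (rule ccontr)
        assume "\<not> (\<exists>z\<in>K. t + 40 * a < d z \<omega>)"
        hence "stieltjes_dist K (normalized_spectral_measure n (X \<omega>)) (mean_spectral_measure n M X) \<le> t + 40 * a"
          unfolding stieltjes_dist_def by (intro cSUP_least K(4)) (auto simp: d_def not_less)
        thus False using w by simp
      qed
      then obtain z where z: "z \<in> K" "t + 40 * a < d z \<omega>" by blast
      obtain v where v: "v \<in> F" "cmod (z - v) \<le> t" using net[OF z(1)] by blast
      have "d z \<omega> \<le> d v \<omega> + t / 2" using lip[OF z(1), of v \<omega>] v F(1) by auto
      hence "4 * ?L + 40 * a \<le> d v \<omega>" using z(2) Lt by linarith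
      thus "\<omega> \<in> ?bad" using v(1) w by blast
    qed
  qed
  also have "\<dots> \<le> (\<Sum>w\<in>F. prob {\<omega> \<in> space M. 4 * ?L + 40 * a \<le> d w \<omega>})"
    by (rule finite_measure_subadditive_finite[OF F(2)]) (use meas in blast)
  also have "\<dots> \<le> (\<Sum>w\<in>F. 16 * exp (- s))"
  proof (rule sum_mono)
    fix w assume "w \<in> F"
    hence "2 \<le> Im w" using F(1) Im2 by blast
    thus "prob {\<omega> \<in> space M. 4 * ?L + 40 * a \<le> d w \<omega>} \<le> 16 * exp (- s)"
      unfolding d_def by (intro stieltjes_concentration[OF \<alpha> \<kappa> n M X conc _ s La])
  qed
  also have "\<dots> = real (card F) * (16 * exp (- s))" by simp
  also have "\<dots> \<le> 49 / t\<^sup>2 * (16 * exp (- s))" using F(3) by (intro mult_right_mono) auto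
  finally show ?thesis by simp
qed

theorem proposition2p18:
  fixes \<alpha> \<kappa>\<^sub>0 :: real and K :: "complex set"
  assumes "0 < \<alpha>" and "\<alpha> \<le> 2" and "0 < \<kappa>\<^sub>0"
    and "compact K" and "K \<subseteq> {z. 2 \<le> Im z}" and "\<exists>z. z islimpt K" and "diameter K \<le> 1"
  shows "\<exists>c>0. \<exists>(\<delta> :: real \<Rightarrow> nat \<Rightarrow> real) C.
    (\<forall>\<kappa>>0. \<forall>n\<ge>1. \<bar>\<delta> \<kappa> n\<bar> \<le> C * (\<kappa> / real n * log_pow n (max (1 / \<alpha> - 1) 0))) \<and>
    (\<forall>\<kappa>>0. \<forall>n\<ge>1. \<forall>\<beta>\<in>{1, 2}. \<forall>(M :: 'w measure) (X :: 'w \<Rightarrow> complex mat).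
       (\<alpha> < 1 \<longrightarrow> \<kappa>\<^sub>0 \<le> \<kappa>) \<and> wigner \<beta> n M X \<and> concentration_property \<alpha> \<kappa> \<beta> n M X \<longrightarrow>
       (\<forall>t>0. measure M {\<omega> \<in> space M.
            stieltjes_dist K (normalized_spectral_measure n (X \<omega>)) (mean_spectral_measure n M X)
              > t + \<delta> \<kappa> n}
          \<le> 32 / t ^ 2 * exp (- c * rate \<alpha> \<kappa> n t)))"
proof -
  note \<alpha> = assms(1,2)
  have K: "bounded K" "K \<subseteq> {z. 2 \<le> Im z}" "diameter K \<le> 1" "K \<noteq> {}"
    using assms(4-7) by (auto simp: compact_imp_bounded)
  let ?l = "\<lambda>n. log_pow n (max (1 / \<alpha> - 1) 0)"
  \<comment> \<open>What is needed of the constants: the modulus grows at most linearly in the level \<open>s\<close>, which bounds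
    the distance of mean and median, and it is at most \<open>t / 8\<close> at the level \<open>c * rate\<close>. For \<open>\<alpha> < 1\<close>
    and \<open>n = 1\<close> the linear bound would be \<open>0\<close>, so this case is treated separately below.\<close>
  define good where "good c C \<longleftrightarrow>
    (\<forall>\<kappa>>0. \<forall>n\<ge>1. (\<alpha> < 1 \<longrightarrow> \<kappa>\<^sub>0 \<le> \<kappa> \<and> 2 \<le> n) \<longrightarrow>
      (\<forall>s>0. shift_modulus \<alpha> \<kappa> n s \<le> C * (\<kappa> / real n * ?l n) * (1 + s)) \<and>
      (\<forall>t>0. 0 < rate \<alpha> \<kappa> n t \<and> shift_modulus \<alpha> \<kappa> n (c * rate \<alpha> \<kappa> n t) \<le> t / 8))" for c C
  have "\<exists>c C. 0 < c \<and> 0 \<le> C \<and> good c C"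
  proof (cases "\<alpha> < 1")
    case True
    have l: "?l n = ln (real n) powr (1 / \<alpha> - 1)" for n
      using True \<alpha> by (simp add: log_pow_def)
    obtain c C where cC: "0 < c" "0 \<le> C" and b: "\<forall>\<kappa>\<ge>\<kappa>\<^sub>0. \<forall>n\<ge>2.
      (\<forall>s>0. shift_modulus \<alpha> \<kappa> n s \<le> C * (\<kappa> / real n * ln (real n) powr (1 / \<alpha> - 1)) * (1 + s)) \<and>
      (\<forall>t>0. 0 < rate \<alpha> \<kappa> n t \<and> shift_modulus \<alpha> \<kappa> n (c * rate \<alpha> \<kappa> n t) \<le> t / 8)"
      using shift_modulus_bounds_less_one[OF \<alpha>(1) True assms(3)] by blast
    have "good c C"
      unfolding good_def l using True b by (intro allI impI) blast
    thus ?thesis using cC by blast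
  next
    case False
    have l: "?l n = 1" for n
      using False by (simp add: log_pow_def max_def)
    have \<alpha>1: "1 \<le> \<alpha>" using False by simp
    note b = shift_modulus_bounds_ge_one[OF \<alpha>1 \<alpha>(2)]
    have "good (1 / 64) 1"
      unfolding good_def l mult_1_left mult_1_right using b by (intro allI impI conjI)
    thus ?thesis by (intro exI[of _ "1 / 64"] exI[of _ "1 :: real"]) simp
  qed
  then obtain c C where c: "0 < c" and C: "0 \<le> C" and good: "good c C" by blast
  have La: "shift_modulus \<alpha> \<kappa> n s \<le> C * (\<kappa> / real n * ?l n) * (1 + s)"
    if "0 < \<kappa>" "1 \<le> n" "\<alpha> < 1 \<longrightarrow> \<kappa>\<^sub>0 \<le> \<kappa> \<and> 2 \<le> n" "0 < s" for \<kappa> n s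
    using good[unfolded good_def, rule_format, OF that(1,2) that(3)[rule_format]] that(4) by blast
  have Lt: "0 < rate \<alpha> \<kappa> n t \<and> shift_modulus \<alpha> \<kappa> n (c * rate \<alpha> \<kappa> n t) \<le> t / 8"
    if "0 < \<kappa>" "1 \<le> n" "\<alpha> < 1 \<longrightarrow> \<kappa>\<^sub>0 \<le> \<kappa> \<and> 2 \<le> n" "0 < t" for \<kappa> n t
    using good[unfolded good_def, rule_format, OF that(1,2) that(3)[rule_format]] that(4) by blast
  define \<delta> where "\<delta> \<kappa> n = 40 * (C * (\<kappa> / real n * ?l n))" for \<kappa> n
  have l0: "0 \<le> ?l n" for n by (simp add: log_pow_def)
  have \<delta>0: "0 \<le> \<delta> \<kappa> n" if "0 < \<kappa>" for \<kappa> n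
    unfolding \<delta>_def using that C l0 by simp
  have bound: "measure M {\<omega> \<in> space M. t + \<delta> \<kappa> n
      < stieltjes_dist K (normalized_spectral_measure n (X \<omega>)) (mean_spectral_measure n M X)}
    \<le> 32 / t ^ 2 * exp (- (c / 2) * rate \<alpha> \<kappa> n t)" (is "measure M ?E \<le> _")
    if \<kappa>: "0 < \<kappa>" "\<alpha> < 1 \<Longrightarrow> \<kappa>\<^sub>0 \<le> \<kappa>" and n: "1 \<le> n" and W: "wigner \<beta> n M X"
      and conc: "concentration_property \<alpha> \<kappa> \<beta> n M X" and t: "0 < t"
    for \<kappa> n \<beta> t and M :: "'w measure" and X
  proof -
    have M: "prob_space M" and X: "X \<in> M \<rightarrow>\<^sub>M herm_borel \<beta> n" using W by (auto simp: wigner_def)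
    interpret prob_space M by (rule M)
    show ?thesis
    proof (cases "t \<le> 1")
      case False
      \<comment> \<open>Both Stieltjes transforms are at most \<open>1 / 2\<close> on \<open>K\<close>, so the distance never exceeds \<open>1\<close>.\<close>
      have "stieltjes_dist K (normalized_spectral_measure n (X \<omega>)) (mean_spectral_measure n M X) \<le> 1" for \<omega>
        unfolding stieltjes_dist_def
      proof (rule cSUP_least[OF K(4)])
        fix z assume "z \<in> K"
        hence z: "2 \<le> Im z" using K(2) by auto
        have "cmod (mat_stieltjes n z (X \<omega>)) \<le> 1 / 2"
          unfolding normalized_spectral_measure_def
          by (rule stieltjes_bounds(1)[OF prob_space_spectral_measure sets_spectral_measure z z])
        moreover have "cmod (stieltjes (mean_spectral_measure n M X) z) \<le> 1 / 2"
          by (rule stieltjes_bounds(1)[OF mean_spectral_measure(1,2)[OF M X n z] z z])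
        ultimately show "cmod (mat_stieltjes n z (X \<omega>) - stieltjes (mean_spectral_measure n M X) z) \<le> 1"
          using norm_triangle_ineq4[of "mat_stieltjes n z (X \<omega>)" "stieltjes (mean_spectral_measure n M X) z"]
          by linarith
      qed
      hence "\<not> t + \<delta> \<kappa> n < stieltjes_dist K (normalized_spectral_measure n (X \<omega>)) (mean_spectral_measure n M X)" for \<omega>
        using \<delta>0[OF \<kappa>(1), of n] False by (smt (verit))
      hence E: "?E = {}" by blast
      show ?thesis unfolding E by simp
    next
      case t1: True
      have t32: "32 \<le> 32 / t ^ 2" using t t1 by (simp add: power_le_one pos_le_divide_eq)
      show ?thesis
      proof (cases "\<alpha> < 1 \<and> n = 1")
        case True
        \<comment> \<open>The logarithm vanishes, so both \<open>\<delta>\<close> and the rate are \<open>0\<close>, and the right-hand side exceeds \<open>1\<close>.\<close>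
        have "rate \<alpha> \<kappa> n t = 0" using True \<kappa> t by (simp add: rate_def)
        hence "1 \<le> 32 / t ^ 2 * exp (- (c / 2) * rate \<alpha> \<kappa> n t)" using t32 by simp
        with prob_le_1 show ?thesis by (rule order_trans)
      next
        case False
        hence n2: "2 \<le> n" if "\<alpha> < 1" using that n by auto
        have ok: "\<alpha> < 1 \<longrightarrow> \<kappa>\<^sub>0 \<le> \<kappa> \<and> 2 \<le> n" using n2 \<kappa>(2) by blast
        define \<rho> where "\<rho> = rate \<alpha> \<kappa> n t"
        have \<rho>: "0 < \<rho>" and L: "shift_modulus \<alpha> \<kappa> n (c * \<rho>) \<le> t / 8"
          using Lt[OF \<kappa>(1) n ok t] by (auto simp: \<rho>_def)
        have s: "0 < c * \<rho>" using c \<rho> by simp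
        have P: "prob ?E \<le> 784 / t\<^sup>2 * exp (- (c * \<rho>))"
          unfolding \<delta>_def
          by (rule stieltjes_dist_concentration[OF K \<alpha> \<kappa>(1) n n2 M X conc s La[OF \<kappa>(1) n ok] t t1 L])
        \<comment> \<open>A probability is at most its square root, which trades half of the rate for the
          constant: \<open>784 = 28\<^sup>2\<close>.\<close>
        have "(prob ?E)\<^sup>2 \<le> prob ?E"
          using mult_left_mono[OF prob_le_1[of ?E], of "prob ?E"] by (simp add: power2_eq_square)
        also note P
        also have "784 / t\<^sup>2 * exp (- (c * \<rho>)) = (28 / t * exp (- (c / 2) * \<rho>))\<^sup>2"
          by (simp add: power_mult_distrib power_divide flip: exp_double)
        finally have "prob ?E \<le> 28 / t * exp (- (c / 2) * \<rho>)"
          by (rule power2_le_imp_le) (use t in simp)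
        also have "\<dots> \<le> 32 / t\<^sup>2 * exp (- (c / 2) * \<rho>)"
        proof (rule mult_right_mono)
          have "28 / t \<le> 32 / t" using t by (simp add: divide_right_mono)
          also have "\<dots> \<le> 32 / t\<^sup>2"
            using t t1 by (intro divide_left_mono) (auto simp: power2_eq_square mult_left_le)
          finally show "28 / t \<le> 32 / t\<^sup>2" .
        qed simp
        finally show ?thesis by (simp only: \<rho>_def)
      qed
    qed
  qed
  have "\<bar>\<delta> \<kappa> n\<bar> \<le> 40 * C * (\<kappa> / real n * ?l n)" if "0 < \<kappa>" for \<kappa> n
    using \<delta>0[OF that, of n] by (simp add: \<delta>_def)
  moreover have "0 < c / 2" using c by simp
  moreover note bound
  ultimately show ?thesis by blast
qed

end
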